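(* For any object $X_A$ in ${}^H\mathcal{S}$ the presheaf $\underline{X_A}=\mathrm{Hom}_{{}^H\mathcal{S}}(-,X_A):{}^H\mathcal{S}^{\mathrm{op}}\to\mathsf{Set}$ is a sheaf on ${}^H\mathcal{S}$. As a consequence, the Yoneda embedding induces a fully faithful embedding ${}^H\mathcal{S}\to{}^H\mathcal{G}$, $X_A\mapsto\underline{X_A}$, into the category of sheaves on ${}^H\mathcal{S}$.
   Context: Fix a field $\mathbb{K}$ and a positive integer $n$; $\otimes$ denotes $\otimes_{\mathbb{K}}$. $H=\mathcal{O}(\mathbb{T}^n)$ is the Hopf algebra over $\mathbb{K}$ with vector space basis $\{t_{\mathbf{m}} : \mathbf{m}\in\mathbb{Z}^n\}$, product $t_{\mathbf{m}}t_{\mathbf{m}'}=t_{\mathbf{m}+\mathbf{m}'}$, unit $1_H=t_{\mathbf{0}}$, coproduct $\Delta(t_{\mathbf{m}})=t_{\mathbf{m}}\otimes t_{\mathbf{m}}$, counit $\epsilon(t_{\mathbf{m}})=1$, antipode $S(t_{\mathbf{m}})=t_{-\mathbf{m}}$. Fix a cotriangular structure on $H$, i.e. a linear map $R:H\otimes H\to\mathbb{K}$ with $R(fg\otimes h)=R(f\otimes h_{(1)})R(g\otimes h_{(2)})$, $R(f\otimes gh)=R(f_{(1)}\otimes h)R(f_{(2)}\otimes g)$ and $\epsilon(h)\epsilon(g)=R(h_{(1)}\otimes g_{(1)})R(g_{(2)}\otimes h_{(2)})$ (Sweedler notation). ${}^H\mathcal{M}$ is the category of left $H$-comodules $(V,\rho^V)$,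 $\rho^V(v)=v_{(-1)}\otimes v_{(0)}$, with $H$-equivariant linear maps; it is monoidal with $\rho^{V\otimes W}(v\otimes w)=v_{(-1)}w_{(-1)}\otimes v_{(0)}\otimes w_{(0)}$ and unit $\mathbb{K}$ with trivial coaction $c\mapsto 1_H\otimes c$, and symmetric with $\tau_{V,W}(v\otimes w)=R(w_{(-1)}\otimes v_{(-1)})\,w_{(0)}\otimes v_{(0)}$. ${}^H\mathcal{A}$ is the category of (associative unital) algebra objects $A$ in ${}^H\mathcal{M}$ satisfying $a\,a'=R(a'_{(-1)}\otimes a_{(-1)})\,a'_{(0)}a_{(0)}$ for all $a,a'\in A$; morphisms are the ${}^H\mathcal{M}$-morphisms preserving products and units. $F_{\mathbf{m}_1,\dots,\mathbf{m}_N}$ (with $\mathbf{m}_i\in\mathbb{Z}^n$) is the free ${}^H\mathcal{A}$-algebra on generators $x_1,\dots,x_N$ with coaction $x_i\mapsto t_{\mathbf{m}_i}\otimes x_i$, i.e. the algebra generated by the $x_i$ subject to $x_ix_j=R(t_{\mathbf{m}_j}\otimes t_{\mathbf{m}_i})x_jx_i$. An object of ${}^H\mathcal{A}$ is finitely presented if it is isomorphic to $F_{\mathbf{m}_1,\dots,\mathbf{m}_N}/(f_k)$ (quotient by the two-sided ideal generated) for finitely many elements $f_k$ with $f_k\mapsto t_{\mathbf{n}_k}\otimes f_k$ for some $\mathbf{n}_k\in\mathbb{Z}^n$. ${}^H\mathcal{A}_{\mathrm{fp}}$ is the full subcategory of finitely presented objects. The coproduct $A\sqcup B$ in ${}^H\mathcal{A}$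 and in ${}^H\mathcal{A}_{\mathrm{fp}}$ is $A\otimes B$ with product $(a\otimes b)(a'\otimes b')=R(a'_{(-1)}\otimes b_{(-1)})\,(a\,a'_{(0)})\otimes(b_{(0)}\,b')$ and unit $1_A\otimes 1_B$. For an $H$-coinvariant $s\in A$ (i.e. $\rho^A(s)=1_H\otimes s$) the localization is $A[s^{-1}]:=(A\sqcup F_{\mathbf{0}})/(s\otimes x-1)$, where $x$ is the generator of $F_{\mathbf{0}}$, with $\ell_s:A\to A[s^{-1}]$, $a\mapsto[a\otimes 1]$. For coinvariants $s_i,s_j\in A$ put $A[s_i^{-1},s_j^{-1}]:=(A[s_i^{-1}])[\ell_{s_i}(s_j)^{-1}]\simeq(A[s_j^{-1}])[\ell_{s_j}(s_i)^{-1}]$. ${}^H\mathcal{S}:=({}^H\mathcal{A}_{\mathrm{fp}})^{\mathrm{op}}$; its objects are written $X_A$, and a morphism $f:X_B\to X_A$ corresponds to an ${}^H\mathcal{A}_{\mathrm{fp}}$-morphism $f^*:A\to B$. An ${}^H\mathcal{S}$-Zariski covering family is a finite family $\{f_i:X_{A[s_i^{-1}]}\to X_A\}$ where (i) each $s_i\in A$ is $H$-coinvariant; (ii) $f_i^*=\ell_{s_i}$; (iii) there exist $a_i\in A$ with $\sum_i a_i s_i=1_A$. A presheaf is a functor $Y:{}^H\mathcal{S}^{\mathrm{op}}\to\mathsf{Set}$. It is a sheaf if for every ${}^H\mathcal{S}$-Zariski covering family the diagram $Y(X_A)\to\prod_i Y(X_{A[s_i^{-1}]})\rightrightarrows\prod_{i,j}Y(X_{A[s_i^{-1},s_j^{-1}]})$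 (induced by the canonical localization morphisms) is an equalizer in $\mathsf{Set}$. ${}^H\mathcal{G}:=\mathrm{Sh}({}^H\mathcal{S})$ is the category of sheaves and natural transformations. On a morphism $f:X_A\to X_B$ the Yoneda embedding is given by $\underline{f}:\underline{X_A}\to\underline{X_B}$, $g\mapsto f\circ g$. *)

theory Defs
  imports
    "HOL-Analysis.Finite_Cartesian_Product"
    "HOL-Library.Poly_Mapping"
    "HOL-Algebra.Module"
    "HOL-Algebra.QuotRing"
begin

text \<open>
  Conventions. The ground field is a type \<open>'k\<close> of class \<open>field\<close>; \<open>type_ring\<close> turns it into a ring
  record. The rank \<open>n \<ge> 1\<close> of the torus is the cardinality of a finite type \<open>'n\<close>, so that the
  character lattice is \<open>int ^ 'n\<close>. Vector spaces are records of HOL-Algebra's \<open>module\<close> type over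
  this field, with a carrier inside some type; maps out of a vector space matter only on its carrier.
\<close>


definition type_ring :: "'a::comm_ring_1 ring" where
  "type_ring = \<lparr> carrier = UNIV, mult = (*), one = 1, zero = 0, add = (+) \<rparr>"

lemma cring_type_ring: "cring type_ring"
proof (rule cringI)
  show "abelian_group type_ring"
    by (rule abelian_groupI) (auto simp: type_ring_def algebra_simps intro: exI[of _ "- _"])
qed (auto simp: type_ring_def algebra_simps intro!: comm_monoidI)


section \<open>Tensor products of vector spaces\<close>

definition pscale :: "'k::field \<Rightarrow> ('x \<Rightarrow>\<^sub>0 'k) \<Rightarrow> ('x \<Rightarrow>\<^sub>0 'k)" where
  "pscale c p = Poly_Mapping.map ((*) c) p"

lemma lookup_pscale [simp]: "Poly_Mapping.lookup (pscale c p) x = c * Poly_Mapping.lookup p x"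
  unfolding pscale_def by transfer (simp add: when_def)

global_interpretation pspace: vector_space "pscale :: 'k::field \<Rightarrow> ('x \<Rightarrow>\<^sub>0 'k) \<Rightarrow> _"
  defines pspan = pspace.span
  by unfold_locales (auto intro!: poly_mapping_eqI simp: lookup_add algebra_simps)

type_synonym ('k, 'v, 'w) tensors = "('v \<times> 'w \<Rightarrow>\<^sub>0 'k) set"

text \<open>
  The tensor product of \<open>V\<close> and \<open>W\<close> is the vector space with basis \<open>carrier V \<times> carrier W\<close> modulo
  the subspace \<open>tnull V W\<close> spanned by the bilinearity relations; its elements are cosets.
\<close>

definition tnull ::
  "('k::field, 'v, 'm) module_scheme \<Rightarrow> ('k, 'w, 'l) module_scheme \<Rightarrow> ('k, 'v, 'w) tensors" where
  "tnull V W = pspan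
    ({Poly_Mapping.single (v \<oplus>\<^bsub>V\<^esub> v', w) 1 - Poly_Mapping.single (v, w) 1
        - Poly_Mapping.single (v', w) 1 | v v' w.
        v \<in> carrier V \<and> v' \<in> carrier V \<and> w \<in> carrier W}
   \<union> {Poly_Mapping.single (v, w \<oplus>\<^bsub>W\<^esub> w') 1 - Poly_Mapping.single (v, w) 1
        - Poly_Mapping.single (v, w') 1 | v w w'.
        v \<in> carrier V \<and> w \<in> carrier W \<and> w' \<in> carrier W}
   \<union> {Poly_Mapping.single (c \<odot>\<^bsub>V\<^esub> v, w) 1 - Poly_Mapping.single (v, w) c | c v w.
        v \<in> carrier V \<and> w \<in> carrier W}
   \<union> {Poly_Mapping.single (v, c \<odot>\<^bsub>W\<^esub> w) 1 - Poly_Mapping.single (v, w) c | c v w.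
        v \<in> carrier V \<and> w \<in> carrier W})"

definition tcls ::
  "('k::field, 'v, 'm) module_scheme \<Rightarrow> ('k, 'w, 'l) module_scheme \<Rightarrow> ('v \<times> 'w \<Rightarrow>\<^sub>0 'k)
    \<Rightarrow> ('k, 'v, 'w) tensors" where
  "tcls V W p = {q. q - p \<in> tnull V W}"

definition tens ::
  "('k::field, 'v, 'm) module_scheme \<Rightarrow> ('k, 'w, 'l) module_scheme \<Rightarrow> 'v \<Rightarrow> 'w
    \<Rightarrow> ('k, 'v, 'w) tensors" where
  "tens V W v w = tcls V W (Poly_Mapping.single (v, w) 1)"

text \<open>
  As a mere vector space, the record below has no meaningful \<open>mult\<close> and \<open>one\<close>.
\<close>

definition tensor ::
  "('k::field, 'v, 'm) module_scheme \<Rightarrow> ('k, 'w, 'l) module_scheme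
    \<Rightarrow> ('k, ('k, 'v, 'w) tensors) module" where
  "tensor V W =
    \<lparr> carrier = tcls V W ` {p. Poly_Mapping.keys p \<subseteq> carrier V \<times> carrier W},
      mult = undefined, one = undefined,
      zero = tcls V W 0,
      add = (\<lambda>X Y. \<Union>x\<in>X. \<Union>y\<in>Y. tcls V W (x + y)),
      smult = (\<lambda>c X. \<Union>x\<in>X. tcls V W (pscale c x)) \<rparr>"

text \<open>
  \<open>tlift U \<beta>\<close> is the linear map into \<open>U\<close> induced by a bilinear map \<open>\<beta>\<close>. It also serves to spell out
  Sweedler notation: if \<open>X\<close> is \<open>\<Sum>v\<^sub>i \<otimes> w\<^sub>i\<close>, then \<open>tlift U \<beta> X\<close> is \<open>\<Sum>\<beta> v\<^sub>i w\<^sub>i\<close>.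
\<close>

definition tlift ::
  "('k::field, 'u, 'm) module_scheme \<Rightarrow> ('v \<Rightarrow> 'w \<Rightarrow> 'u) \<Rightarrow> ('k, 'v, 'w) tensors \<Rightarrow> 'u" where
  "tlift U \<beta> X =
    (THE u. u \<in> (\<lambda>p. \<Oplus>\<^bsub>U\<^esub>z\<in>Poly_Mapping.keys p.
        Poly_Mapping.lookup p z \<odot>\<^bsub>U\<^esub> \<beta> (fst z) (snd z)) ` X)"

definition linear_map ::
  "('k::field, 'v, 'm) module_scheme \<Rightarrow> ('k, 'w, 'l) module_scheme \<Rightarrow> ('v \<Rightarrow> 'w) \<Rightarrow> bool" where
  "linear_map V W f \<longleftrightarrow> f \<in> carrier V \<rightarrow> carrier W
    \<and> (\<forall>v\<in>carrier V. \<forall>v'\<in>carrier V. f (v \<oplus>\<^bsub>V\<^esub> v') = f v \<oplus>\<^bsub>W\<^esub> f v')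
    \<and> (\<forall>c. \<forall>v\<in>carrier V. f (c \<odot>\<^bsub>V\<^esub> v) = c \<odot>\<^bsub>W\<^esub> f v)"

definition field_module :: "('k::field, 'k) module" where
  "field_module = ring.extend type_ring (module.fields (*))"


section \<open>The Hopf algebra of functions on the torus and its cotriangular structures\<close>

text \<open>The product of \<open>'k[\<int>\<^sup>n]\<close> is the convolution product of \<^typ>\<open>'a \<Rightarrow>\<^sub>0 'b\<close>.\<close>

type_synonym ('k, 'n) torus = "(int ^ 'n) \<Rightarrow>\<^sub>0 'k"

definition torus_module :: "('k::field, ('k, 'n::finite) torus) module" where
  "torus_module = ring.extend type_ring (module.fields pscale)"

definition tmon :: "int ^ 'n::finite \<Rightarrow> ('k::field, 'n) torus" where
  "tmon m = Poly_Mapping.single m 1"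

definition torus_comult ::
  "('k::field, 'n::finite) torus \<Rightarrow> ('k, ('k, 'n) torus, ('k, 'n) torus) tensors" where
  "torus_comult h = tcls torus_module torus_module
    (\<Sum>m\<in>Poly_Mapping.keys h. Poly_Mapping.single (tmon m, tmon m) (Poly_Mapping.lookup h m))"

definition torus_counit :: "('k::field, 'n::finite) torus \<Rightarrow> 'k" where
  "torus_counit h = (\<Sum>m\<in>Poly_Mapping.keys h. Poly_Mapping.lookup h m)"

type_synonym ('k, 'n) torus_form = "('k, ('k, 'n) torus, ('k, 'n) torus) tensors \<Rightarrow> 'k"

abbreviation rmat ::
  "('k::field, 'n::finite) torus_form \<Rightarrow> ('k, 'n) torus \<Rightarrow> ('k, 'n) torus \<Rightarrow> 'k" where
  "rmat R g h \<equiv> R (tens torus_module torus_module g h)"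

definition cotriangular :: "('k::field, 'n::finite) torus_form \<Rightarrow> bool" where
  "cotriangular R \<longleftrightarrow>
     linear_map (tensor torus_module torus_module) field_module R
   \<and> (\<forall>f g h. rmat R (f * g) h =
        tlift field_module (\<lambda>h1 h2. rmat R f h1 * rmat R g h2) (torus_comult h))
   \<and> (\<forall>f g h. rmat R f (g * h) =
        tlift field_module (\<lambda>f1 f2. rmat R f1 h * rmat R f2 g) (torus_comult f))
   \<and> (\<forall>g h. torus_counit h * torus_counit g =
        tlift field_module (\<lambda>h1 h2.
          tlift field_module (\<lambda>g1 g2. rmat R h1 g1 * rmat R g2 h2) (torus_comult g))
        (torus_comult h))"


section \<open>Comodules and braided-commutative comodule algebras\<close>

record (overloaded) ('k, 'n, 'v) comod_alg = "('k::zero, 'v) module" +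
  coact :: "'v \<Rightarrow> ('k, ('k, 'n::finite) torus, 'v) tensors"

text \<open>
  Coassociativity is stated in \<open>H \<otimes> (H \<otimes> V)\<close>, i.e. after identification of \<open>(H \<otimes> H) \<otimes> V\<close> with it.
  The fields \<open>mult\<close> and \<open>one\<close> play no role here.
\<close>

definition comodule :: "('k::field, 'n::finite, 'v, 'm) comod_alg_scheme \<Rightarrow> bool" where
  "comodule V \<longleftrightarrow>
     Module.module type_ring V
   \<and> linear_map V (tensor torus_module V) (coact V)
   \<and> (\<forall>v\<in>carrier V.
        tlift (tensor torus_module (tensor torus_module V))
          (\<lambda>h w. tens torus_module (tensor torus_module V) h (coact V w)) (coact V v)
      = tlift (tensor torus_module (tensor torus_module V))
          (\<lambda>h w. tlift (tensor torus_module (tensor torus_module V))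
             (\<lambda>h1 h2. tens torus_module (tensor torus_module V) h1 (tens torus_module V h2 w))
             (torus_comult h)) (coact V v))
   \<and> (\<forall>v\<in>carrier V. tlift V (\<lambda>h w. torus_counit h \<odot>\<^bsub>V\<^esub> w) (coact V v) = v)"

definition comodule_algebra :: "('k::field, 'n::finite, 'v, 'm) comod_alg_scheme \<Rightarrow> bool" where
  "comodule_algebra A \<longleftrightarrow>
     comodule A \<and> Ring.ring A
   \<and> (\<forall>c. \<forall>a\<in>carrier A. \<forall>b\<in>carrier A.
        (c \<odot>\<^bsub>A\<^esub> a) \<otimes>\<^bsub>A\<^esub> b = c \<odot>\<^bsub>A\<^esub> (a \<otimes>\<^bsub>A\<^esub> b)
      \<and> a \<otimes>\<^bsub>A\<^esub> (c \<odot>\<^bsub>A\<^esub> b) = c \<odot>\<^bsub>A\<^esub> (a \<otimes>\<^bsub>A\<^esub> b))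
   \<and> coact A \<one>\<^bsub>A\<^esub> = tens torus_module A 1 \<one>\<^bsub>A\<^esub>
   \<and> (\<forall>a\<in>carrier A. \<forall>b\<in>carrier A.
        coact A (a \<otimes>\<^bsub>A\<^esub> b) =
        tlift (tensor torus_module A) (\<lambda>h a0.
          tlift (tensor torus_module A) (\<lambda>h' b0.
            tens torus_module A (h * h') (a0 \<otimes>\<^bsub>A\<^esub> b0)) (coact A b)) (coact A a))"

definition braided_algebra ::
  "('k::field, 'n::finite) torus_form \<Rightarrow> ('k, 'n, 'v, 'm) comod_alg_scheme \<Rightarrow> bool" where
  "braided_algebra R A \<longleftrightarrow>
     comodule_algebra A
   \<and> (\<forall>a\<in>carrier A. \<forall>a'\<in>carrier A.
        a \<otimes>\<^bsub>A\<^esub> a' =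
        tlift A (\<lambda>h' a0'. tlift A (\<lambda>h a0. rmat R h' h \<odot>\<^bsub>A\<^esub> (a0' \<otimes>\<^bsub>A\<^esub> a0)) (coact A a)) (coact A a'))"

definition alg_morphism ::
  "('k::field, 'n::finite, 'v, 'm) comod_alg_scheme \<Rightarrow> ('k, 'n, 'w, 'l) comod_alg_scheme
    \<Rightarrow> ('v \<Rightarrow> 'w) \<Rightarrow> bool" where
  "alg_morphism A B f \<longleftrightarrow>
     linear_map A B f \<and> f \<in> ring_hom A B
   \<and> (\<forall>a\<in>carrier A. coact B (f a) =
        tlift (tensor torus_module B) (\<lambda>h a0. tens torus_module B h (f a0)) (coact A a))"

definition alg_iso ::
  "('k::field, 'n::finite, 'v, 'm) comod_alg_scheme \<Rightarrow> ('k, 'n, 'w, 'l) comod_alg_scheme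
    \<Rightarrow> ('v \<Rightarrow> 'w) \<Rightarrow> bool" where
  "alg_iso A B f \<longleftrightarrow> alg_morphism A B f \<and> bij_betw f (carrier A) (carrier B)"


section \<open>Quotients, free algebras, finite presentation\<close>

definition quotient_module ::
  "('k::field, 'n::finite, 'v, 'm) comod_alg_scheme \<Rightarrow> 'v set \<Rightarrow> ('k, 'v set) module" where
  "quotient_module A I = ring.extend (A Quot I)
     (module.fields (\<lambda>c X. \<Union>x\<in>X. I +>\<^bsub>A\<^esub> (c \<odot>\<^bsub>A\<^esub> x)))"

text \<open>
  The coaction on the quotient is the one for which the projection is equivariant; it exists if
  \<open>I\<close> is a subcomodule, in particular if \<open>I\<close> is generated by homogeneous elements.
\<close>

definition quotient_alg ::
  "('k::field, 'n::finite, 'v, 'm) comod_alg_scheme \<Rightarrow> 'v set \<Rightarrow> ('k, 'n, 'v set) comod_alg" where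
  "quotient_alg A I = module.extend (quotient_module A I)
     (comod_alg.fields (\<lambda>X. THE Y. Y \<in> (\<lambda>x. tlift (tensor torus_module (quotient_module A I))
         (\<lambda>h a. tens torus_module (quotient_module A I) h (I +>\<^bsub>A\<^esub> a)) (coact A x)) ` X))"

text \<open>
  Words in the letters \<open>x\<^sub>0, x\<^sub>1, \<dots>\<close> form a monoid under concatenation, so \<open>word \<Rightarrow>\<^sub>0 'k\<close> is
  the free associative algebra, with the product that the library provides for \<^typ>\<open>'a \<Rightarrow>\<^sub>0 'b\<close>.
\<close>

datatype word = Word (letters: "nat list")

instantiation word :: monoid_add
begin

definition zero_word :: word where "zero_word = Word []"

definition plus_word :: "word \<Rightarrow> word \<Rightarrow> word" where
  "plus_word u v = Word (letters u @ letters v)"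

instance
  by standard (auto simp: zero_word_def plus_word_def)

end

definition gen :: "nat \<Rightarrow> (word \<Rightarrow>\<^sub>0 'k::field)" where
  "gen i = Poly_Mapping.single (Word [i]) 1"

definition word_degree :: "(int ^ 'n::finite) list \<Rightarrow> word \<Rightarrow> int ^ 'n" where
  "word_degree ms w = (\<Sum>i\<leftarrow>letters w. ms ! i)"

definition words_module :: "nat \<Rightarrow> ('k::field, word \<Rightarrow>\<^sub>0 'k) module" where
  "words_module N =
    \<lparr> carrier = {p. \<forall>w\<in>Poly_Mapping.keys p. set (letters w) \<subseteq> {..<N}},
      mult = (*), one = 1, zero = 0, add = (+), smult = pscale \<rparr>"

definition words_alg ::
  "(int ^ 'n::finite) list \<Rightarrow> ('k::field, 'n, word \<Rightarrow>\<^sub>0 'k) comod_alg" where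
  "words_alg ms = module.extend (words_module (length ms))
     (comod_alg.fields (\<lambda>p. tcls torus_module (words_module (length ms))
         (\<Sum>w\<in>Poly_Mapping.keys p. Poly_Mapping.single (tmon (word_degree ms w), Poly_Mapping.single w 1)
            (Poly_Mapping.lookup p w))))"

definition braid_ideal ::
  "('k::field, 'n::finite) torus_form \<Rightarrow> (int ^ 'n) list \<Rightarrow> (word \<Rightarrow>\<^sub>0 'k) set" where
  "braid_ideal R ms = genideal (words_alg ms)
     {gen i * gen j - pscale (rmat R (tmon (ms ! j)) (tmon (ms ! i))) (gen j * gen i) | i j.
        i < length ms \<and> j < length ms}"

definition free_alg ::
  "('k::field, 'n::finite) torus_form \<Rightarrow> (int ^ 'n) list \<Rightarrow> ('k, 'n, (word \<Rightarrow>\<^sub>0 'k) set) comod_alg"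
  where
  "free_alg R ms = quotient_alg (words_alg ms) (braid_ideal R ms)"

definition finitely_presented ::
  "('k::field, 'n::finite) torus_form \<Rightarrow> ('k, 'n, 'v) comod_alg \<Rightarrow> bool" where
  "finitely_presented R A \<longleftrightarrow>
    (\<exists>ms fs \<phi>. finite fs \<and> fs \<subseteq> carrier (free_alg R ms)
      \<and> (\<forall>f\<in>fs. \<exists>m. coact (free_alg R ms) f = tens torus_module (free_alg R ms) (tmon m) f)
      \<and> alg_iso (quotient_alg (free_alg R ms) (genideal (free_alg R ms) fs)) A \<phi>)"


section \<open>Coproducts and localization\<close>

definition coproduct_alg ::
  "('k::field, 'n::finite) torus_form \<Rightarrow> ('k, 'n, 'v) comod_alg \<Rightarrow> ('k, 'n, 'w) comod_alg
    \<Rightarrow> ('k, 'n, ('k, 'v, 'w) tensors) comod_alg" where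
  "coproduct_alg R A B =
    \<lparr> carrier = carrier (tensor A B),
      mult = (\<lambda>X Y.
        tlift (tensor A B) (\<lambda>a b.
          tlift (tensor A B) (\<lambda>a' b'.
            tlift (tensor A B) (\<lambda>g a0'.
              tlift (tensor A B) (\<lambda>h b0.
                rmat R g h \<odot>\<^bsub>tensor A B\<^esub> tens A B (a \<otimes>\<^bsub>A\<^esub> a0') (b0 \<otimes>\<^bsub>B\<^esub> b'))
              (coact B b)) (coact A a')) Y) X),
      one = tens A B \<one>\<^bsub>A\<^esub> \<one>\<^bsub>B\<^esub>,
      zero = \<zero>\<^bsub>tensor A B\<^esub>,
      add = (\<oplus>\<^bsub>tensor A B\<^esub>),
      smult = (\<odot>\<^bsub>tensor A B\<^esub>),
      coact =
        tlift (tensor torus_module (tensor A B)) (\<lambda>a b.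
          tlift (tensor torus_module (tensor A B)) (\<lambda>g a0.
            tlift (tensor torus_module (tensor A B)) (\<lambda>h b0.
              tens torus_module (tensor A B) (g * h) (tens A B a0 b0))
            (coact B b)) (coact A a)) \<rparr>"

definition coinvariant :: "('k::field, 'n::finite, 'v) comod_alg \<Rightarrow> 'v \<Rightarrow> bool" where
  "coinvariant A s \<longleftrightarrow> s \<in> carrier A \<and> coact A s = tens torus_module A 1 s"

abbreviation line_alg :: "('k::field, 'n::finite) torus_form \<Rightarrow> ('k, 'n, (word \<Rightarrow>\<^sub>0 'k) set) comod_alg"
  where "line_alg R \<equiv> free_alg R [0]"

definition line_gen :: "('k::field, 'n::finite) torus_form \<Rightarrow> (word \<Rightarrow>\<^sub>0 'k) set" where
  "line_gen R = braid_ideal R [0] +>\<^bsub>words_alg [0 :: int ^ 'n] :: ('k, 'n, _) comod_alg\<^esub> gen 0"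

definition loc_ideal ::
  "('k::field, 'n::finite) torus_form \<Rightarrow> ('k, 'n, 'v) comod_alg \<Rightarrow> 'v
    \<Rightarrow> ('k, 'v, (word \<Rightarrow>\<^sub>0 'k) set) tensors set" where
  "loc_ideal R A s =
    (let P = coproduct_alg R A (line_alg R)
     in genideal P {tens A (line_alg R) s (line_gen R) \<ominus>\<^bsub>P\<^esub> \<one>\<^bsub>P\<^esub>})"

definition loc_alg ::
  "('k::field, 'n::finite) torus_form \<Rightarrow> ('k, 'n, 'v) comod_alg \<Rightarrow> 'v
    \<Rightarrow> ('k, 'n, ('k, 'v, (word \<Rightarrow>\<^sub>0 'k) set) tensors set) comod_alg" where
  "loc_alg R A s = quotient_alg (coproduct_alg R A (line_alg R)) (loc_ideal R A s)"

definition loc_map ::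
  "('k::field, 'n::finite) torus_form \<Rightarrow> ('k, 'n, 'v) comod_alg \<Rightarrow> 'v \<Rightarrow> 'v
    \<Rightarrow> ('k, 'v, (word \<Rightarrow>\<^sub>0 'k) set) tensors set" where
  "loc_map R A s a =
    loc_ideal R A s +>\<^bsub>coproduct_alg R A (line_alg R)\<^esub> tens A (line_alg R) a \<one>\<^bsub>line_alg R\<^esub>"


section \<open>Categories, functors, presheaves\<close>

record ('o, 'a) category =
  obj :: "'o set"
  arr :: "'a set"
  src :: "'a \<Rightarrow> 'o"
  tgt :: "'a \<Rightarrow> 'o"
  ident :: "'o \<Rightarrow> 'a"
  cmp :: "'a \<Rightarrow> 'a \<Rightarrow> 'a"

definition homset :: "('o, 'a) category \<Rightarrow> 'o \<Rightarrow> 'o \<Rightarrow> 'a set" where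
  "homset C X Y = {f \<in> arr C. src C f = X \<and> tgt C f = Y}"

definition is_category :: "('o, 'a) category \<Rightarrow> bool" where
  "is_category C \<longleftrightarrow>
     (\<forall>f\<in>arr C. src C f \<in> obj C \<and> tgt C f \<in> obj C)
   \<and> (\<forall>X\<in>obj C. ident C X \<in> homset C X X)
   \<and> (\<forall>f\<in>arr C. \<forall>g\<in>arr C. tgt C f = src C g \<longrightarrow> cmp C g f \<in> homset C (src C f) (tgt C g))
   \<and> (\<forall>f\<in>arr C. cmp C f (ident C (src C f)) = f \<and> cmp C (ident C (tgt C f)) f = f)
   \<and> (\<forall>f\<in>arr C. \<forall>g\<in>arr C. \<forall>h\<in>arr C. tgt C f = src C g \<longrightarrow> tgt C g = src C h \<longrightarrow>
        cmp C h (cmp C g f) = cmp C (cmp C h g) f)"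

definition opp :: "('o, 'a) category \<Rightarrow> ('o, 'a) category" where
  "opp C = \<lparr> obj = obj C, arr = arr C, src = tgt C, tgt = src C, ident = ident C,
             cmp = (\<lambda>g f. cmp C f g) \<rparr>"

definition full_subcategory :: "('o, 'a) category \<Rightarrow> 'o set \<Rightarrow> ('o, 'a) category" where
  "full_subcategory C P =
    C \<lparr> obj := obj C \<inter> P, arr := {f \<in> arr C. src C f \<in> P \<and> tgt C f \<in> P} \<rparr>"

record ('o1, 'a1, 'o2, 'a2) cfunctor =
  fobj :: "'o1 \<Rightarrow> 'o2"
  farr :: "'a1 \<Rightarrow> 'a2"

definition is_functor ::
  "('o1, 'a1) category \<Rightarrow> ('o2, 'a2) category \<Rightarrow> ('o1, 'a1, 'o2, 'a2) cfunctor \<Rightarrow> bool" where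
  "is_functor C D F \<longleftrightarrow>
     fobj F \<in> obj C \<rightarrow>\<^sub>E obj D \<and> farr F \<in> arr C \<rightarrow>\<^sub>E arr D
   \<and> (\<forall>f\<in>arr C. src D (farr F f) = fobj F (src C f) \<and> tgt D (farr F f) = fobj F (tgt C f))
   \<and> (\<forall>X\<in>obj C. farr F (ident C X) = ident D (fobj F X))
   \<and> (\<forall>f\<in>arr C. \<forall>g\<in>arr C. tgt C f = src C g \<longrightarrow>
        farr F (cmp C g f) = cmp D (farr F g) (farr F f))"

text \<open>Arrows carry their source and target, so hom-sets of distinct pairs of objects are disjoint.\<close>

definition functor_category ::
  "('o1, 'a1) category \<Rightarrow> ('o2, 'a2) category \<Rightarrow>
    (('o1, 'a1, 'o2, 'a2) cfunctor,
     ('o1, 'a1, 'o2, 'a2) cfunctor \<times> ('o1 \<Rightarrow> 'a2) \<times> ('o1, 'a1, 'o2, 'a2) cfunctor) category" where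
  "functor_category C D =
    \<lparr> obj = {F. is_functor C D F},
      arr = {(F, \<eta>, G). is_functor C D F \<and> is_functor C D G \<and> \<eta> \<in> extensional (obj C)
               \<and> (\<forall>X\<in>obj C. \<eta> X \<in> homset D (fobj F X) (fobj G X))
               \<and> (\<forall>f\<in>arr C. cmp D (\<eta> (tgt C f)) (farr F f) = cmp D (farr G f) (\<eta> (src C f)))},
      src = fst, tgt = snd \<circ> snd,
      ident = (\<lambda>F. (F, \<lambda>X\<in>obj C. ident D (fobj F X), F)),
      cmp = (\<lambda>(G', \<theta>, H) (F, \<eta>, G). (F, \<lambda>X\<in>obj C. cmp D (\<theta> X) (\<eta> X), H)) \<rparr>"

text \<open>The category of sets of elements of a type \<open>'v\<close>, where presheaves take their values.\<close>

definition set_category :: "('v set, 'v set \<times> ('v \<Rightarrow> 'v) \<times> 'v set) category" where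
  "set_category =
    \<lparr> obj = UNIV, arr = {(X, f, Y). f \<in> X \<rightarrow>\<^sub>E Y},
      src = fst, tgt = snd \<circ> snd,
      ident = (\<lambda>X. (X, \<lambda>x\<in>X. x, X)),
      cmp = (\<lambda>(Y', g, Z) (X, f, Y). (X, compose X g f, Z)) \<rparr>"

type_synonym ('o, 'a, 'v) presheaf =
  "('o, 'a, 'v set, 'v set \<times> ('v \<Rightarrow> 'v) \<times> 'v set) cfunctor"

abbreviation pullback_along :: "('o, 'a, 'v) presheaf \<Rightarrow> 'a \<Rightarrow> 'v \<Rightarrow> 'v" where
  "pullback_along Y f \<equiv> fst (snd (farr Y f))"

definition hom_presheaf :: "('o, 'a) category \<Rightarrow> 'o \<Rightarrow> ('o, 'a, 'a) presheaf" where
  "hom_presheaf C X =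
    \<lparr> fobj = (\<lambda>Z\<in>obj C. homset C Z X),
      farr = (\<lambda>k\<in>arr C. (homset C (tgt C k) X, \<lambda>g\<in>homset C (tgt C k) X. cmp C g k,
                         homset C (src C k) X)) \<rparr>"

definition yoneda ::
  "('o, 'a) category \<Rightarrow>
    ('o, 'a, ('o, 'a, 'a) presheaf,
     ('o, 'a, 'a) presheaf \<times> ('o \<Rightarrow> 'a set \<times> ('a \<Rightarrow> 'a) \<times> 'a set) \<times> ('o, 'a, 'a) presheaf) cfunctor"
  where
  "yoneda C =
    \<lparr> fobj = (\<lambda>X\<in>obj C. hom_presheaf C X),
      farr = (\<lambda>f\<in>arr C. (hom_presheaf C (src C f),
         \<lambda>Z\<in>obj C. (homset C Z (src C f), \<lambda>g\<in>homset C Z (src C f). cmp C f g, homset C Z (tgt C f)),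
         hom_presheaf C (tgt C f))) \<rparr>"

definition fully_faithful_embedding ::
  "('o1, 'a1) category \<Rightarrow> ('o2, 'a2) category \<Rightarrow> ('o1, 'a1, 'o2, 'a2) cfunctor \<Rightarrow> bool" where
  "fully_faithful_embedding C D F \<longleftrightarrow>
     is_category C \<and> is_category D \<and> is_functor C D F
   \<and> (\<forall>X\<in>obj C. \<forall>Y\<in>obj C. bij_betw (farr F) (homset C X Y) (homset D (fobj F X) (fobj F Y)))
   \<and> inj_on (fobj F) (obj C)"

text \<open>
  Universal property of an equalizer \<open>e : E \<rightarrow> P\<close> of two maps \<open>p, q : P \<rightarrow> Q\<close> of sets. Testing
  against sets \<open>T\<close> of elements of the type of \<open>P\<close> suffices, by the lemma below.
\<close>

definition set_equalizer ::
  "'e set \<Rightarrow> 'p set \<Rightarrow> 'q set \<Rightarrow> ('e \<Rightarrow> 'p) \<Rightarrow> ('p \<Rightarrow> 'q) \<Rightarrow> ('p \<Rightarrow> 'q) \<Rightarrow> bool" where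
  "set_equalizer E P Q e p q \<longleftrightarrow>
     e \<in> E \<rightarrow> P \<and> p \<in> P \<rightarrow> Q \<and> q \<in> P \<rightarrow> Q
   \<and> (\<forall>x\<in>E. p (e x) = q (e x))
   \<and> (\<forall>(T :: 'p set) k. k \<in> T \<rightarrow> P \<longrightarrow> (\<forall>x\<in>T. p (k x) = q (k x)) \<longrightarrow>
        (\<exists>!u. u \<in> T \<rightarrow>\<^sub>E E \<and> (\<forall>x\<in>T. e (u x) = k x)))"

lemma set_equalizer_iff_bij_betw:
  fixes E :: "'a set" and P :: "'b set" and Q :: "'c set"
  shows "set_equalizer E P Q e p q \<longleftrightarrow>
     p \<in> P \<rightarrow> Q \<and> q \<in> P \<rightarrow> Q \<and> bij_betw e E {x \<in> P. p x = q x}"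
proof
  assume L: "set_equalizer E P Q e p q"
  have univ: "\<exists>!u. u \<in> T \<rightarrow>\<^sub>E E \<and> (\<forall>x\<in>T. e (u x) = k x)"
    if "k \<in> T \<rightarrow> P" "\<forall>x\<in>T. p (k x) = q (k x)" for T :: "'b set" and k
    using L that unfolding set_equalizer_def by simp
  have e: "e \<in> E \<rightarrow> P" "\<forall>x\<in>E. p (e x) = q (e x)"
    using L unfolding set_equalizer_def by auto
  have "inj_on e E"
  proof (rule inj_onI)
    fix x y assume xy: "x \<in> E" "y \<in> E" "e x = e y"
    let ?X = "\<lambda>z\<in>{e x}. x" and ?Y = "\<lambda>z\<in>{e x}. y"
    have ex1: "\<exists>!u. u \<in> {e x} \<rightarrow>\<^sub>E E \<and> (\<forall>z\<in>{e x}. e (u z) = z)"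
      by (rule univ) (use e xy in auto)
    have "?X \<in> {e x} \<rightarrow>\<^sub>E E \<and> (\<forall>z\<in>{e x}. e (?X z) = z)"
      "?Y \<in> {e x} \<rightarrow>\<^sub>E E \<and> (\<forall>z\<in>{e x}. e (?Y z) = z)"
      using xy by auto
    with ex1 have "?X = ?Y" by blast
    then have "?X (e x) = ?Y (e x)" by (rule arg_cong)
    then show "x = y" by simp
  qed
  moreover have "{x \<in> P. p x = q x} \<subseteq> e ` E"
  proof
    fix x assume "x \<in> {x \<in> P. p x = q x}"
    then have "\<exists>!u. u \<in> {x} \<rightarrow>\<^sub>E E \<and> (\<forall>z\<in>{x}. e (u z) = z)"
      by (intro univ) auto
    then obtain u where "u \<in> {x} \<rightarrow>\<^sub>E E \<and> (\<forall>z\<in>{x}. e (u z) = z)"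
      by (rule ex1E) blast
    then have "u x \<in> E" "e (u x) = x" by auto
    then show "x \<in> e ` E" by (auto intro: rev_image_eqI)
  qed
  ultimately show "p \<in> P \<rightarrow> Q \<and> q \<in> P \<rightarrow> Q \<and> bij_betw e E {x \<in> P. p x = q x}"
    using L e unfolding set_equalizer_def bij_betw_def by (intro conjI) auto
next
  assume R: "p \<in> P \<rightarrow> Q \<and> q \<in> P \<rightarrow> Q \<and> bij_betw e E {x \<in> P. p x = q x}"
  then have inj: "inj_on e E" and im: "e ` E = {x \<in> P. p x = q x}"
    by (auto simp: bij_betw_def)
  have "\<exists>!u. u \<in> T \<rightarrow>\<^sub>E E \<and> (\<forall>x\<in>T. e (u x) = k x)"
    if k: "k \<in> T \<rightarrow> P" "\<forall>x\<in>T. p (k x) = q (k x)" for T :: "'b set" and k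
  proof (rule ex1I)
    have "k x \<in> e ` E" if "x \<in> T" for x using k im that by auto
    then show "(\<lambda>x\<in>T. inv_into E e (k x)) \<in> T \<rightarrow>\<^sub>E E
        \<and> (\<forall>x\<in>T. e ((\<lambda>x\<in>T. inv_into E e (k x)) x) = k x)"
      by (auto simp: f_inv_into_f inv_into_into)
    fix u assume u: "u \<in> T \<rightarrow>\<^sub>E E \<and> (\<forall>x\<in>T. e (u x) = k x)"
    show "u = (\<lambda>x\<in>T. inv_into E e (k x))"
    proof (rule extensionalityI[of _ T])
      fix x assume x: "x \<in> T"
      then have "u x \<in> E" "e (u x) = k x" using u by auto
      then show "u x = (\<lambda>x\<in>T. inv_into E e (k x)) x"
        using inj x inv_into_f_f[OF inj, of "u x"] by simp
    qed (use u in \<open>auto simp: PiE_def\<close>)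
  qed
  moreover have "e x \<in> P \<and> p (e x) = q (e x)" if "x \<in> E" for x
    using im that by blast
  ultimately show "set_equalizer E P Q e p q"
    unfolding set_equalizer_def using R by (intro conjI allI impI ballI) simp_all
qed


section \<open>The site and its sheaves\<close>

text \<open>
  The objects of the categories below are all algebras whose carrier is contained in a given type
  \<open>'u\<close>, which acts as the universe of small sets; an arrow is a triple consisting of source,
  underlying map and target. If \<open>'u\<close> is infinite and at least as large as \<open>'k\<close>, every finitely
  presented algebra, in particular every localization of one, has an isomorphic copy in \<open>'u\<close>.
\<close>

type_synonym ('k, 'n, 'u) alg_arrow =
  "('k, 'n, 'u) comod_alg \<times> ('u \<Rightarrow> 'u) \<times> ('k, 'n, 'u) comod_alg"

definition alg_category ::
  "('k::field, 'n::finite) torus_form \<Rightarrow> (('k, 'n, 'u) comod_alg, ('k, 'n, 'u) alg_arrow) category"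
  where
  "alg_category R =
    \<lparr> obj = {A. braided_algebra R A},
      arr = {(A, \<phi>, B). braided_algebra R A \<and> braided_algebra R B
               \<and> alg_morphism A B \<phi> \<and> \<phi> \<in> extensional (carrier A)},
      src = fst, tgt = snd \<circ> snd,
      ident = (\<lambda>A. (A, \<lambda>a\<in>carrier A. a, A)),
      cmp = (\<lambda>(B', \<psi>, C) (A, \<phi>, B). (A, compose (carrier A) \<psi> \<phi>, C)) \<rparr>"

definition fp_alg_category ::
  "('k::field, 'n::finite) torus_form \<Rightarrow> (('k, 'n, 'u) comod_alg, ('k, 'n, 'u) alg_arrow) category"
  where
  "fp_alg_category R = full_subcategory (alg_category R) {A. finitely_presented R A}"

text \<open>
  The object \<open>X\<^sub>A\<close> of the opposite category is \<open>A\<close> itself; an arrow \<open>f : X\<^sub>B \<rightarrow> X\<^sub>A\<close> is a triple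
  \<open>(A, \<phi>, B)\<close>, where \<open>\<phi> : A \<rightarrow> B\<close> is the algebra morphism called \<open>comorphism f\<close>.
\<close>

definition space_category ::
  "('k::field, 'n::finite) torus_form \<Rightarrow> (('k, 'n, 'u) comod_alg, ('k, 'n, 'u) alg_arrow) category"
  where
  "space_category R = opp (fp_alg_category R)"

abbreviation comorphism :: "('k::field, 'n::finite, 'u) alg_arrow \<Rightarrow> 'u \<Rightarrow> 'u" where
  "comorphism f \<equiv> fst (snd f)"

text \<open>
  \<open>A[s\<^sup>-\<^sup>1]\<close> is an object of the category up to isomorphism only: \<open>f : X\<^sub>B \<rightarrow> X\<^sub>A\<close> is a
  localization at \<open>s\<close> if \<open>B\<close> is identified with \<open>loc_alg R A s\<close> so that \<open>f\<^sup>*\<close> becomes \<open>loc_map R A s\<close>.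
\<close>

definition localization_at ::
  "('k::field, 'n::finite) torus_form \<Rightarrow> 'u \<Rightarrow> ('k, 'n, 'u) alg_arrow \<Rightarrow> bool" where
  "localization_at R s f \<longleftrightarrow>
     f \<in> arr (space_category R)
   \<and> (\<exists>\<psi>. alg_iso (loc_alg R (tgt (space_category R) f) s) (src (space_category R) f) \<psi>
        \<and> (\<forall>a\<in>carrier (tgt (space_category R) f).
             comorphism f a = \<psi> (loc_map R (tgt (space_category R) f) s a)))"

definition zariski_covering ::
  "('k::field, 'n::finite) torus_form \<Rightarrow> ('k, 'n, 'u) comod_alg \<Rightarrow> nat \<Rightarrow> (nat \<Rightarrow> 'u)
    \<Rightarrow> (nat \<Rightarrow> ('k, 'n, 'u) alg_arrow) \<Rightarrow> bool" where
  "zariski_covering R A N s f \<longleftrightarrow>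
     A \<in> obj (space_category R)
   \<and> (\<forall>i<N. coinvariant A (s i) \<and> tgt (space_category R) (f i) = A \<and> localization_at R (s i) (f i))
   \<and> (\<exists>a \<in> {..<N} \<rightarrow> carrier A. (\<Oplus>\<^bsub>A\<^esub>i\<in>{..<N}. a i \<otimes>\<^bsub>A\<^esub> s i) = \<one>\<^bsub>A\<^esub>)"

text \<open>
  For a covering \<open>f i : X\<^bsub>A[s i\<^sup>-\<^sup>1]\<^esub> \<rightarrow> X\<^sub>A\<close>, the source of \<open>g (i, j)\<close> is \<open>A[s i\<^sup>-\<^sup>1, s j\<^sup>-\<^sup>1]\<close>, obtained from
  \<open>A[s i\<^sup>-\<^sup>1]\<close> by inverting the image of \<open>s j\<close>. The arrow \<open>h (i, j)\<close> exhibits the same object as the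
  localization of \<open>A[s j\<^sup>-\<^sup>1]\<close> at the image of \<open>s i\<close>; compatibility with the maps to \<open>X\<^sub>A\<close> says that
  this is done through the canonical isomorphism.
\<close>

definition covering_overlaps ::
  "('k::field, 'n::finite) torus_form \<Rightarrow> nat \<Rightarrow> (nat \<Rightarrow> 'u) \<Rightarrow> (nat \<Rightarrow> ('k, 'n, 'u) alg_arrow)
    \<Rightarrow> (nat \<times> nat \<Rightarrow> ('k, 'n, 'u) alg_arrow) \<Rightarrow> (nat \<times> nat \<Rightarrow> ('k, 'n, 'u) alg_arrow) \<Rightarrow> bool" where
  "covering_overlaps R N s f g h \<longleftrightarrow> (\<forall>i<N. \<forall>j<N.
     tgt (space_category R) (g (i, j)) = src (space_category R) (f i)
   \<and> localization_at R (comorphism (f i) (s j)) (g (i, j))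
   \<and> tgt (space_category R) (h (i, j)) = src (space_category R) (f j)
   \<and> localization_at R (comorphism (f j) (s i)) (h (i, j))
   \<and> src (space_category R) (h (i, j)) = src (space_category R) (g (i, j))
   \<and> cmp (space_category R) (f i) (g (i, j)) = cmp (space_category R) (f j) (h (i, j)))"

definition is_sheaf ::
  "('k::field, 'n::finite) torus_form
    \<Rightarrow> (('k, 'n, 'u) comod_alg, ('k, 'n, 'u) alg_arrow, 'v) presheaf \<Rightarrow> bool" where
  "is_sheaf R Y \<longleftrightarrow>
     is_functor (opp (space_category R)) set_category Y
   \<and> (\<forall>A N s f g h. zariski_covering R A N s f \<and> covering_overlaps R N s f g h \<longrightarrow>
        set_equalizer
          (fobj Y A)
          (\<Pi>\<^sub>E i\<in>{..<N}. fobj Y (src (space_category R) (f i)))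
          (\<Pi>\<^sub>E ij\<in>{..<N} \<times> {..<N}. fobj Y (src (space_category R) (g ij)))
          (\<lambda>y. \<lambda>i\<in>{..<N}. pullback_along Y (f i) y)
          (\<lambda>y. \<lambda>ij\<in>{..<N} \<times> {..<N}. pullback_along Y (g ij) (y (fst ij)))
          (\<lambda>y. \<lambda>ij\<in>{..<N} \<times> {..<N}. pullback_along Y (h ij) (y (snd ij))))"

definition sheaf_category ::
  "('k::field, 'n::finite) torus_form \<Rightarrow>
    ((('k, 'n, 'u) comod_alg, ('k, 'n, 'u) alg_arrow, 'v) presheaf,
     (('k, 'n, 'u) comod_alg, ('k, 'n, 'u) alg_arrow, 'v) presheaf
      \<times> (('k, 'n, 'u) comod_alg \<Rightarrow> 'v set \<times> ('v \<Rightarrow> 'v) \<times> 'v set)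
      \<times> (('k, 'n, 'u) comod_alg, ('k, 'n, 'u) alg_arrow, 'v) presheaf) category" where
  "sheaf_category R =
    full_subcategory (functor_category (opp (space_category R)) set_category) {Y. is_sheaf R Y}"

end

theory Submission
  imports Defs "HOL-Algebra.Multiplicative_Group"
begin

text \<open>
  Full faithfulness of the embedding is the Yoneda lemma, so the point is that for a covering
  \<open>\<Sum> a\<^sub>i s\<^sub>i = 1\<close> the algebra \<open>A\<close> is the equalizer of the algebras \<open>A[s\<^sub>i\<^sup>-\<^sup>1]\<close> and
  \<open>A[s\<^sub>i\<^sup>-\<^sup>1, s\<^sub>j\<^sup>-\<^sup>1]\<close>. A coinvariant \<open>s\<close> is central because \<open>R(1 \<otimes> h) = \<epsilon>(h)\<close>, and since the
  generator of \<open>F\<^sub>0\<close> is coinvariant, \<open>A \<squnion> F\<^sub>0\<close> is the ordinary polynomial ring \<open>A[x]\<close>. Hence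
  \<open>A[s\<^sup>-\<^sup>1]\<close> is the classical localization at a central element, and the usual gluing argument
  applies, with \<open>\<Sum> c\<^sub>i s\<^sub>i\<^sup>n = 1\<close> in place of the given partition of unity. The glued map is
  equivariant because \<open>A \<rightarrow> \<Prod> A[s\<^sub>i\<^sup>-\<^sup>1]\<close> stays injective on every homogeneous component of the
  coaction.
\<close>

section \<open>Linear maps and tensor products\<close>

text \<open>The delicate point is the kernel of A -> A[s^-1]. The ideal generated by s x - 1 in A[x]
  involves arbitrary polynomial multiples, and evaluation at s^-1, which would control it, takes
  values in the very ring under construction. The remedy is to clear denominators beforehand:
  multiplied by a high power of s, the value of a polynomial at s^-1 lies in A. The polynomials for
  which this value is zero for all large powers form an ideal that contains s x - 1; for a constant
  the condition says that a power of s kills it. Since A[s^-1] occurs in the site only up to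
  isomorphism, gluing is done for ring homomorphisms with three properties, collected in
  \<open>is_loc\<close>, and not for the concrete quotient. Tensors are cosets of formal
  combinations, and a Sweedler expression is a description over all representatives of a coset. It
  can be evaluated only once its integrand is known to be bilinear, and nested expressions require
  this at each level; most of the preparatory computations are of this kind.\<close>

lemma type_ring_simps [simp]:
  "carrier type_ring = UNIV" "mult type_ring = (*)" "one type_ring = 1"
  "zero type_ring = 0" "add type_ring = (+)"
  by (simp_all add: type_ring_def)

abbreviation (input) vspace :: "('k::field, 'v, 'm) module_scheme \<Rightarrow> bool" where
  "vspace V \<equiv> Module.module type_ring V"

lemma vspaceI:
  fixes V (structure)
  assumes "abelian_group V"
    and "\<And>c x. x \<in> carrier V \<Longrightarrow> c \<odot> x \<in> carrier V"
    and "\<And>a b x. x \<in> carrier V \<Longrightarrow> (a + b) \<odot> x = a \<odot> x \<oplus> b \<odot> x"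
    and "\<And>a x y. \<lbrakk>x \<in> carrier V; y \<in> carrier V\<rbrakk> \<Longrightarrow> a \<odot> (x \<oplus> y) = a \<odot> x \<oplus> a \<odot> y"
    and "\<And>a b x. x \<in> carrier V \<Longrightarrow> (a * b) \<odot> x = a \<odot> (b \<odot> x)"
    and "\<And>x. x \<in> carrier V \<Longrightarrow> 1 \<odot> x = x"
  shows "vspace V"
  by (rule Module.moduleI) (use assms in \<open>auto simp: cring_type_ring\<close>)

text \<open>Phrased with the operations of the type \<open>'k\<close> instead of those of the record
  \<open>type_ring\<close>, so that identities between scalars can be settled by field
  arithmetic.\<close>

lemma vspaceD:
  fixes V (structure)
  assumes "vspace V"
  shows "abelian_group V"
    and "\<And>c x. x \<in> carrier V \<Longrightarrow> c \<odot> x \<in> carrier V"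
    and "\<And>a b x. x \<in> carrier V \<Longrightarrow> (a + b) \<odot> x = a \<odot> x \<oplus> b \<odot> x"
    and "\<And>a x y. \<lbrakk>x \<in> carrier V; y \<in> carrier V\<rbrakk> \<Longrightarrow> a \<odot> (x \<oplus> y) = a \<odot> x \<oplus> a \<odot> y"
    and "\<And>a b x. x \<in> carrier V \<Longrightarrow> (a * b) \<odot> x = a \<odot> (b \<odot> x)"
    and "\<And>x. x \<in> carrier V \<Longrightarrow> 1 \<odot> x = x"
    and "\<And>x. x \<in> carrier V \<Longrightarrow> 0 \<odot> x = \<zero>"
    and "\<And>c. c \<odot> \<zero> = \<zero>"
proof -
  interpret module type_ring V by fact
  show "abelian_group V"
    and "\<And>c x. x \<in> carrier V \<Longrightarrow> c \<odot> x \<in> carrier V"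
    and "\<And>a b x. x \<in> carrier V \<Longrightarrow> (a + b) \<odot> x = a \<odot> x \<oplus> b \<odot> x"
    and "\<And>a x y. \<lbrakk>x \<in> carrier V; y \<in> carrier V\<rbrakk> \<Longrightarrow> a \<odot> (x \<oplus> y) = a \<odot> x \<oplus> a \<odot> y"
    and "\<And>a b x. x \<in> carrier V \<Longrightarrow> (a * b) \<odot> x = a \<odot> (b \<odot> x)"
    and "\<And>x. x \<in> carrier V \<Longrightarrow> 1 \<odot> x = x"
    and "\<And>x. x \<in> carrier V \<Longrightarrow> 0 \<odot> x = \<zero>"
    and "\<And>c. c \<odot> \<zero> = \<zero>"
    using smult_closed smult_l_distr smult_r_distr smult_assoc1 smult_one smult_l_null smult_r_null
      M.abelian_group_axioms
    by simp_all
qed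

lemma linear_mapI:
  assumes "\<And>v. v \<in> carrier V \<Longrightarrow> f v \<in> carrier W"
    and "\<And>v v'. v \<in> carrier V \<Longrightarrow> v' \<in> carrier V \<Longrightarrow> f (v \<oplus>\<^bsub>V\<^esub> v') = f v \<oplus>\<^bsub>W\<^esub> f v'"
    and "\<And>c v. v \<in> carrier V \<Longrightarrow> f (c \<odot>\<^bsub>V\<^esub> v) = c \<odot>\<^bsub>W\<^esub> f v"
  shows "linear_map V W f"
  using assms unfolding linear_map_def by auto

lemma linear_mapD:
  assumes "linear_map V W f"
  shows "\<And>v. v \<in> carrier V \<Longrightarrow> f v \<in> carrier W"
    and "\<And>v v'. v \<in> carrier V \<Longrightarrow> v' \<in> carrier V \<Longrightarrow> f (v \<oplus>\<^bsub>V\<^esub> v') = f v \<oplus>\<^bsub>W\<^esub> f v'"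
    and "\<And>c v. v \<in> carrier V \<Longrightarrow> f (c \<odot>\<^bsub>V\<^esub> v) = c \<odot>\<^bsub>W\<^esub> f v"
  using assms unfolding linear_map_def by auto

lemma linear_map_zero:
  assumes "vspace V" "vspace W" "linear_map V W f"
  shows "f \<zero>\<^bsub>V\<^esub> = \<zero>\<^bsub>W\<^esub>"
proof -
  interpret V: abelian_group V by (rule vspaceD) fact
  have "f \<zero>\<^bsub>V\<^esub> = f (0 \<odot>\<^bsub>V\<^esub> \<zero>\<^bsub>V\<^esub>)" by (simp add: vspaceD[OF assms(1)])
  also have "\<dots> = 0 \<odot>\<^bsub>W\<^esub> f \<zero>\<^bsub>V\<^esub>" by (rule linear_mapD[OF assms(3)]) simp
  finally show ?thesis using linear_mapD(1)[OF assms(3)] by (simp add: vspaceD[OF assms(2)])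
qed

lemma linear_map_compose:
  assumes "linear_map U V f" "linear_map V W g"
  shows "linear_map U W (\<lambda>x. g (f x))"
  by (rule linear_mapI) (simp_all add: linear_mapD[OF assms(1)] linear_mapD[OF assms(2)])

lemma linear_map_finsum:
  assumes "vspace V" "vspace W" "linear_map V W f" "h \<in> S \<rightarrow> carrier V"
  shows "f (\<Oplus>\<^bsub>V\<^esub>i\<in>S. h i) = (\<Oplus>\<^bsub>W\<^esub>i\<in>S. f (h i))"
proof -
  interpret V: abelian_group V by (rule vspaceD) fact
  interpret W: abelian_group W by (rule vspaceD) fact
  show ?thesis
  proof (cases "finite S")
    case True
    then show ?thesis using assms(4)
    proof (induction S)
      case empty then show ?case using linear_map_zero assms by auto
    next
      case (insert x F)
      then have "h \<in> F \<rightarrow> carrier V" "h x \<in> carrier V" "(\<lambda>i. f (h i)) \<in> F \<rightarrow> carrier W"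
         "f (h x) \<in> carrier W"
        using linear_mapD(1)[OF assms(3)] by auto
      then show ?case using insert by (simp add: linear_mapD[OF assms(3)])
    qed
  next
    \<comment> \<open>\<open>finsum\<close> over an infinite set is \<zero> by convention, so both
      sides are \<zero>.\<close>
    case False
    then show ?thesis using linear_map_zero[OF assms(1-3)] by simp
  qed
qed

section \<open>Linear extension to formal combinations\<close>

definition lin :: "('k::field, 'u, 'm) module_scheme \<Rightarrow> ('z \<Rightarrow> 'u) \<Rightarrow> ('z \<Rightarrow>\<^sub>0 'k) \<Rightarrow> 'u" where
  "lin U \<gamma> p = (\<Oplus>\<^bsub>U\<^esub>z\<in>Poly_Mapping.keys p. Poly_Mapping.lookup p z \<odot>\<^bsub>U\<^esub> \<gamma> z)"

lemma tlift_eq_lin: "tlift U \<beta> X = (THE u. u \<in> lin U (\<lambda>z. \<beta> (fst z) (snd z)) ` X)"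
  by (simp add: tlift_def lin_def[abs_def])

text \<open>Allows sums over different supports to be compared over one index set. This is needed
  already for additivity, since terms can cancel in p + q.\<close>

lemma lin_superset:
  fixes U (structure)
  assumes U: "vspace U" and "finite S" "Poly_Mapping.keys p \<subseteq> S" "\<gamma> \<in> S \<rightarrow> carrier U"
  shows "lin U \<gamma> p = (\<Oplus>z\<in>S. Poly_Mapping.lookup p z \<odot> \<gamma> z)"
proof -
  interpret U: abelian_group U by (rule vspaceD) fact
  show ?thesis unfolding lin_def
    by (rule U.add.finprod_mono_neutral_cong_left)
      (use assms in \<open>auto simp: Pi_iff vspaceD[OF U] in_keys_iff\<close>)
qed

lemma keys_pscale: "Poly_Mapping.keys (pscale c p) \<subseteq> Poly_Mapping.keys p"
  by (auto simp: in_keys_iff)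

lemma pscale_single [simp]: "pscale c (Poly_Mapping.single z d) = Poly_Mapping.single z (c * d)"
  by (rule poly_mapping_eqI) (simp add: lookup_single when_def)

lemma lin_closed:
  assumes U: "vspace U" and "\<gamma> \<in> Poly_Mapping.keys p \<rightarrow> carrier U"
  shows "lin U \<gamma> p \<in> carrier U"
proof -
  interpret U: abelian_group U by (rule vspaceD) fact
  show ?thesis unfolding lin_def
    by (rule U.finsum_closed) (use assms in \<open>auto simp: Pi_iff vspaceD[OF U]\<close>)
qed

lemma lin_add:
  fixes U (structure)
  assumes U: "vspace U" and "\<gamma> \<in> D \<rightarrow> carrier U"
    "Poly_Mapping.keys p \<subseteq> D" "Poly_Mapping.keys q \<subseteq> D"
  shows "lin U \<gamma> (p + q) = lin U \<gamma> p \<oplus> lin U \<gamma> q"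
proof -
  interpret U: abelian_group U by (rule vspaceD) fact
  let ?S = "Poly_Mapping.keys p \<union> Poly_Mapping.keys q"
  have g: "\<gamma> \<in> ?S \<rightarrow> carrier U" using assms by auto
  have c: "(\<lambda>z. Poly_Mapping.lookup r z \<odot> \<gamma> z) \<in> ?S \<rightarrow> carrier U" for r
    using g by (auto simp: Pi_iff vspaceD[OF U])
  have "lin U \<gamma> (p + q) = (\<Oplus>z\<in>?S. Poly_Mapping.lookup (p+q) z \<odot> \<gamma> z)"
    by (rule lin_superset[OF U]) (use g keys_add[of p q] in auto)
  also have "\<dots> = (\<Oplus>z\<in>?S. (Poly_Mapping.lookup p z \<odot> \<gamma> z) \<oplus> (Poly_Mapping.lookup q z \<odot> \<gamma> z))"
    by (rule U.finsum_cong') (use g in \<open>auto simp: Pi_iff lookup_add vspaceD[OF U]\<close>)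
  also have "\<dots> = (\<Oplus>z\<in>?S. Poly_Mapping.lookup p z \<odot> \<gamma> z) \<oplus> (\<Oplus>z\<in>?S. Poly_Mapping.lookup q z \<odot> \<gamma> z)"
    by (rule U.finsum_addf[OF c c])
  finally show ?thesis
    using lin_superset[OF U _ _ g, of p] lin_superset[OF U _ _ g, of q] by simp
qed

lemma lin_pscale:
  fixes U (structure)
  assumes U: "vspace U" and g: "\<gamma> \<in> Poly_Mapping.keys p \<rightarrow> carrier U"
  shows "lin U \<gamma> (pscale c p) = c \<odot> lin U \<gamma> p"
proof -
  interpret U: abelian_group U by (rule vspaceD) fact
  have l: "linear_map U U (\<lambda>x. c \<odot> x)"
    by (rule linear_mapI) (simp_all add: vspaceD[OF U] flip: vspaceD(5)[OF U], simp add: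
        mult.commute)
  have c: "(\<lambda>z. Poly_Mapping.lookup p z \<odot> \<gamma> z) \<in> Poly_Mapping.keys p \<rightarrow> carrier U"
    using g by (auto simp: Pi_iff vspaceD[OF U])
  have "lin U \<gamma> (pscale c p) = (\<Oplus>z\<in>Poly_Mapping.keys p. c \<odot> (Poly_Mapping.lookup p z \<odot> \<gamma> z))"
    unfolding lin_superset[OF U finite_keys keys_pscale g]
    by (rule U.finsum_cong') (use g in \<open>auto simp: Pi_iff vspaceD[OF U]\<close>)
  then show ?thesis
    unfolding lin_def linear_map_finsum[OF U U l c] .
qed

lemma lin_single:
  assumes U: "vspace U" and g: "\<gamma> z \<in> carrier U"
  shows "lin U \<gamma> (Poly_Mapping.single z c) = c \<odot>\<^bsub>U\<^esub> \<gamma> z"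
proof -
  interpret U: abelian_group U by (rule vspaceD) fact
  have "lin U \<gamma> (Poly_Mapping.single z c) = (\<Oplus>\<^bsub>U\<^esub>y\<in>{z}. Poly_Mapping.lookup (Poly_Mapping.single z
      c) y \<odot>\<^bsub>U\<^esub> \<gamma> y)"
    by (rule lin_superset[OF U]) (use g in \<open>auto\<close>)
  then show ?thesis using g by (simp add: vspaceD[OF U])
qed

lemma lin_zero [simp]: 
  assumes U: "vspace U" shows "lin U \<gamma> 0 = \<zero>\<^bsub>U\<^esub>"
proof -
  interpret U: abelian_group U by (rule vspaceD) fact
  show ?thesis by (simp add: lin_def)
qed

definition bilin :: "('k::field, 'v, 'm) module_scheme \<Rightarrow> ('k, 'w, 'l) module_scheme
    \<Rightarrow> ('k, 'u, 'n) module_scheme \<Rightarrow> ('v \<Rightarrow> 'w \<Rightarrow> 'u) \<Rightarrow> bool" where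
  "bilin V W U \<beta> \<longleftrightarrow> (\<forall>v\<in>carrier V. linear_map W U (\<beta> v))
     \<and> (\<forall>w\<in>carrier W. linear_map V U (\<lambda>v. \<beta> v w))"

lemma bilinI:
  assumes "\<And>v. v \<in> carrier V \<Longrightarrow> linear_map W U (\<beta> v)"
    and "\<And>w. w \<in> carrier W \<Longrightarrow> linear_map V U (\<lambda>v. \<beta> v w)"
  shows "bilin V W U \<beta>"
  using assms by (simp add: bilin_def)

lemma bilinD:
  assumes "bilin V W U \<beta>"
  shows "\<And>v. v \<in> carrier V \<Longrightarrow> linear_map W U (\<beta> v)"
    and "\<And>w. w \<in> carrier W \<Longrightarrow> linear_map V U (\<lambda>v. \<beta> v w)"
  using assms by (simp_all add: bilin_def)

lemma bilin_closed:
  assumes "bilin V W U \<beta>" "v \<in> carrier V" "w \<in> carrier W"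
  shows "\<beta> v w \<in> carrier U"
  using linear_mapD(1)[OF bilinD(1)[OF assms(1,2)] assms(3)] .

lemma diff_pscale: "p - q = p + pscale (-1) q"
  by (rule poly_mapping_eqI) (simp add: lookup_add lookup_minus)

text \<open>Bilinear maps respect the defining relations. The support is tracked in the same
  induction because \<beta> is controlled only on the carriers, and \<open>lin\<close> is additive
  only on combinations supported there.\<close>

lemma lin_tnull:
  fixes U (structure)
  assumes V: "vspace V" and W: "vspace W" and U: "vspace U" and b: "bilin V W U \<beta>"
    and p: "p \<in> tnull V W"
  shows "Poly_Mapping.keys p \<subseteq> carrier V \<times> carrier W \<and> lin U (\<lambda>z. \<beta> (fst z) (snd z)) p = \<zero>"
proof -
  interpret V: abelian_group V by (rule vspaceD) fact
  interpret W: abelian_group W by (rule vspaceD) fact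
  interpret U: abelian_group U by (rule vspaceD) fact
  let ?D = "carrier V \<times> carrier W"
  let ?g = "\<lambda>z. \<beta> (fst z) (snd z)"
  have g: "?g \<in> ?D \<rightarrow> carrier U" using bilin_closed[OF b] by auto
  note lin = linear_mapD[OF bilinD(1)[OF b]] linear_mapD[OF bilinD(2)[OF b]]
  have neg: "pscale (-1) (Poly_Mapping.single z c) = Poly_Mapping.single z (-c)" for z :: "'b \<times>
      'd" and c :: 'a
    by simp
  have ad: "lin U ?g (p + q) = lin U ?g p \<oplus> lin U ?g q"
    if "Poly_Mapping.keys p \<subseteq> ?D" "Poly_Mapping.keys q \<subseteq> ?D" for p q
    by (rule lin_add[OF U g that])
  have kadd: "Poly_Mapping.keys (p + q) \<subseteq> ?D" 
    if "Poly_Mapping.keys p \<subseteq> ?D" "Poly_Mapping.keys q \<subseteq> ?D" for p q :: "'b \<times> 'd \<Rightarrow>\<^sub>0 'a"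
    using that keys_add[of p q] by blast
  have ks: "Poly_Mapping.keys (Poly_Mapping.single (v,w) c) \<subseteq> ?D" if "v \<in> carrier V" "w \<in> carrier
      W" for v w and c::'a
    using that by simp
  have ls: "lin U ?g (Poly_Mapping.single (v,w) c) = c \<odot> \<beta> v w" if "v \<in> carrier V" "w \<in> carrier W"
      for v w c
    using lin_single[OF U, of ?g "(v,w)" c] bilin_closed[OF b that] by simp
  have c3: "\<beta> v w \<in> carrier U" if "v \<in> carrier V" "w \<in> carrier W" for v w
    using bilin_closed[OF b that] .
  \<comment> \<open>\<open>cancel\<close> and \<open>cancel2\<close> are the values of the
    generators of \<open>tnull\<close> once subtraction is rewritten as scaling by -1: the former
    for additivity, the latter for homogeneity.\<close>
  have cancel: "x \<oplus> y \<oplus> (- 1) \<odot> x \<oplus> (- 1) \<odot> y = \<zero>" if "x \<in> carrier U" "y \<in> carrier U" for x y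
  proof -
    have inv: "z \<oplus> (- 1) \<odot> z = \<zero>" if "z \<in> carrier U" for z
      using vspaceD(3)[OF U that, of 1 "-1"] that by (simp add: vspaceD[OF U])
    have "x \<oplus> y \<oplus> (- 1) \<odot> x \<oplus> (- 1) \<odot> y = (x \<oplus> y) \<oplus> (- 1) \<odot> (x \<oplus> y)"
      using that by (simp add: vspaceD[OF U] U.a_ac)
    then show ?thesis using that inv by simp
  qed
  have cancel2: "c \<odot> x \<oplus> (- c) \<odot> x = \<zero>" if "x \<in> carrier U" for x c
    using vspaceD(3)[OF U that, of c "-c"] that by (simp add: vspaceD[OF U])
  show ?thesis
    using p unfolding tnull_def
  proof (induction rule: pspace.span_induct_alt)
    case base then show ?case by (simp add: U)
  next
    case (step c x y)
    have "Poly_Mapping.keys x \<subseteq> ?D \<and> lin U ?g x = \<zero>"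
      using step(1)
      by (elim UnE CollectE exE conjE)
        (simp_all add: diff_pscale neg ad kadd ks ls lin c3 cancel cancel2 vspaceD[OF U]
            vspaceD[OF V] vspaceD[OF W])
    then have x: "Poly_Mapping.keys x \<subseteq> ?D" "lin U ?g x = \<zero>" by auto
    from x g have "?g \<in> Poly_Mapping.keys x \<rightarrow> carrier U" by blast
    from lin_pscale[OF U this] x have "lin U ?g (pscale c x) = \<zero>"
      by (simp add: vspaceD(8)[OF U])
    moreover have "Poly_Mapping.keys (pscale c x) \<subseteq> ?D"
      using keys_pscale[of c x] x(1) by (rule subset_trans)
    ultimately have "Poly_Mapping.keys (pscale c x) \<subseteq> ?D" "lin U ?g (pscale c x) = \<zero>"
      by blast+
    then show ?case using step ad kadd by auto
  qed
qed

section \<open>Tensor products as spaces of cosets\<close>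

lemma tnull_subspace:
  shows tnull_zero: "0 \<in> tnull V W"
    and tnull_add: "p \<in> tnull V W \<Longrightarrow> q \<in> tnull V W \<Longrightarrow> p + q \<in> tnull V W"
    and tnull_diff: "p \<in> tnull V W \<Longrightarrow> q \<in> tnull V W \<Longrightarrow> p - q \<in> tnull V W"
    and tnull_pscale: "p \<in> tnull V W \<Longrightarrow> pscale c p \<in> tnull V W"
  unfolding tnull_def
  by (rule pspace.span_zero pspace.span_add pspace.span_diff pspace.span_scale; assumption)+

lemma tcls_self: "p \<in> tcls V W p"
  by (simp add: tcls_def tnull_zero)

lemma tcls_eq_iff: "tcls V W p = tcls V W q \<longleftrightarrow> p - q \<in> tnull V W"
proof
  assume "tcls V W p = tcls V W q"
  then show "p - q \<in> tnull V W" using tcls_self[of p V W] by (simp add: tcls_def)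
next
  assume pq: "p - q \<in> tnull V W"
  have "r - p \<in> tnull V W \<longleftrightarrow> r - q \<in> tnull V W" for r
    using tnull_add[OF _ pq, of "r - p"] tnull_diff[OF _ pq, of "r - q"] by auto
  then show "tcls V W p = tcls V W q" by (auto simp: tcls_def)
qed

text \<open>The sum is defined as a union over all representatives. Any two choices differ by an
  element of the subspace \<open>tnull V W\<close>, so all members of the union are the same
  coset.\<close>

lemma tensor_add_tcls: "tcls V W p \<oplus>\<^bsub>tensor V W\<^esub> tcls V W q = tcls V W (p + q)"
proof -
  have "tcls V W (x + y) = tcls V W (p + q)" if "x \<in> tcls V W p" "y \<in> tcls V W q" for x y
  proof -
    have "x - p \<in> tnull V W" "y - q \<in> tnull V W" using that by (simp_all add: tcls_def)
    then have "(x - p) + (y - q) \<in> tnull V W" by (rule tnull_add)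
    moreover have "(x - p) + (y - q) = (x + y) - (p + q)" by (rule add_diff_add[symmetric])
    ultimately show ?thesis unfolding tcls_eq_iff by simp
  qed
  then have "(\<Union>x\<in>tcls V W p. \<Union>y\<in>tcls V W q. tcls V W (x + y)) = tcls V W (p + q)"
    using tcls_self[of p V W] tcls_self[of q V W] by blast
  then show ?thesis by (simp add: tensor_def)
qed

lemma pscale_diff: "pscale c (p - q) = pscale c p - pscale c q"
  by (rule poly_mapping_eqI) (simp add: lookup_minus algebra_simps)

lemma tensor_smult_tcls: "c \<odot>\<^bsub>tensor V W\<^esub> tcls V W p = tcls V W (pscale c p)"
proof -
  have "tcls V W (pscale c x) = tcls V W (pscale c p)" if "x \<in> tcls V W p" for x
  proof -
    have "x - p \<in> tnull V W" using that by (simp add: tcls_def)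
    then have "pscale c (x - p) \<in> tnull V W" by (rule tnull_pscale)
    then show ?thesis unfolding tcls_eq_iff pscale_diff .
  qed
  then have "(\<Union>x\<in>tcls V W p. tcls V W (pscale c x)) = tcls V W (pscale c p)"
    using tcls_self[of p V W] by blast
  then show ?thesis by (simp add: tensor_def)
qed

lemma tensor_zero: "\<zero>\<^bsub>tensor V W\<^esub> = tcls V W 0"
  by (simp add: tensor_def)

lemma tensor_carrierE:
  assumes "X \<in> carrier (tensor V W)"
  obtains p where "X = tcls V W p" "Poly_Mapping.keys p \<subseteq> carrier V \<times> carrier W"
  using assms by (auto simp: tensor_def)

lemma tcls_carrier:
  "Poly_Mapping.keys p \<subseteq> carrier V \<times> carrier W \<Longrightarrow> tcls V W p \<in> carrier (tensor V W)"
  by (auto simp: tensor_def)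

lemma tensor_vspace: "vspace (tensor V W)"
proof (rule vspaceI)
  show "abelian_group (tensor V W)"
  proof (rule abelian_groupI)
    fix X Y assume "X \<in> carrier (tensor V W)" "Y \<in> carrier (tensor V W)"
    then show "X \<oplus>\<^bsub>tensor V W\<^esub> Y \<in> carrier (tensor V W)"
      by (elim tensor_carrierE)
        (simp add: tensor_add_tcls tcls_carrier order_trans[OF keys_add])
    show "X \<oplus>\<^bsub>tensor V W\<^esub> Y = Y \<oplus>\<^bsub>tensor V W\<^esub> X"
      using \<open>X \<in> _\<close> \<open>Y \<in> _\<close> by (elim tensor_carrierE) (simp add: tensor_add_tcls add.commute)
  next
    fix X assume "X \<in> carrier (tensor V W)"
    then obtain p where p: "X = tcls V W p" "Poly_Mapping.keys p \<subseteq> carrier V \<times> carrier W"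
      by (rule tensor_carrierE)
    have "tcls V W (- p) \<in> carrier (tensor V W)" by (simp add: tcls_carrier p)
    moreover have "tcls V W (- p) \<oplus>\<^bsub>tensor V W\<^esub> X = \<zero>\<^bsub>tensor V W\<^esub>"
      by (simp add: p tensor_add_tcls tensor_zero)
    ultimately show "\<exists>Y\<in>carrier (tensor V W). Y \<oplus>\<^bsub>tensor V W\<^esub> X = \<zero>\<^bsub>tensor V W\<^esub>" by blast
  qed (auto elim!: tensor_carrierE simp: tensor_add_tcls tensor_zero tcls_carrier add.assoc)
next
  fix c X assume "X \<in> carrier (tensor V W)"
  then show "c \<odot>\<^bsub>tensor V W\<^esub> X \<in> carrier (tensor V W)"
    by (elim tensor_carrierE)
      (simp add: tensor_smult_tcls tcls_carrier order_trans[OF keys_pscale])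
qed (auto elim!: tensor_carrierE simp: tensor_add_tcls tensor_smult_tcls tensor_zero
    pspace.scale_left_distrib pspace.scale_right_distrib)

text \<open>By \<open>lin_tnull\<close> the linear extension is constant on a coset, so the
  description by \<open>THE\<close> in \<open>tlift\<close> has exactly one candidate.\<close>

lemma tlift_tcls:
  assumes V: "vspace V" and W: "vspace W" and U: "vspace U" and b: "bilin V W U \<beta>"
    and p: "Poly_Mapping.keys p \<subseteq> carrier V \<times> carrier W"
  shows "tlift U \<beta> (tcls V W p) = lin U (\<lambda>z. \<beta> (fst z) (snd z)) p"
proof -
  let ?g = "\<lambda>z. \<beta> (fst z) (snd z)"
  interpret U: abelian_group U by (rule vspaceD) fact
  have g: "?g \<in> carrier V \<times> carrier W \<rightarrow> carrier U" using bilin_closed[OF b] by auto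
  have "lin U ?g q = lin U ?g p" if "q \<in> tcls V W p" for q
  proof -
    have "q - p \<in> tnull V W" using that by (simp add: tcls_def)
    from lin_tnull[OF V W U b this]
    have d: "Poly_Mapping.keys (q - p) \<subseteq> carrier V \<times> carrier W" "lin U ?g (q - p) = \<zero>\<^bsub>U\<^esub>" by auto
    have "lin U ?g ((q - p) + p) = lin U ?g (q - p) \<oplus>\<^bsub>U\<^esub> lin U ?g p"
      by (rule lin_add[OF U g d(1) p])
    moreover have "lin U ?g p \<in> carrier U"
      by (rule lin_closed[OF U]) (use g p in blast)
    ultimately show ?thesis unfolding d(2) diff_add_cancel by (simp only: U.l_zero)
  qed
  then have "lin U ?g ` tcls V W p = {lin U ?g p}"
    using tcls_self[of p V W] by blast
  then show ?thesis by (simp add: tlift_eq_lin)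
qed

lemma tlift_linear:
  assumes V: "vspace V" and W: "vspace W" and U: "vspace U" and b: "bilin V W U \<beta>"
  shows "linear_map (tensor V W) U (tlift U \<beta>)"
proof -
  let ?g = "\<lambda>z. \<beta> (fst z) (snd z)"
  have g: "?g \<in> carrier V \<times> carrier W \<rightarrow> carrier U" using bilin_closed[OF b] by auto
  note tl = tlift_tcls[OF V W U b]
  show ?thesis
  proof (rule linear_mapI)
    fix X assume "X \<in> carrier (tensor V W)"
    then obtain p where p: "X = tcls V W p" "Poly_Mapping.keys p \<subseteq> carrier V \<times> carrier W"
      by (rule tensor_carrierE)
    then have gp: "?g \<in> Poly_Mapping.keys p \<rightarrow> carrier U" using g by blast
    then show "tlift U \<beta> X \<in> carrier U" by (simp add: tl p lin_closed[OF U])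
    show "tlift U \<beta> (c \<odot>\<^bsub>tensor V W\<^esub> X) = c \<odot>\<^bsub>U\<^esub> tlift U \<beta> X" for c
      unfolding p(1) tensor_smult_tcls tl[OF p(2)] tl[OF order_trans[OF keys_pscale p(2)]]
      by (rule lin_pscale[OF U gp])
    fix Y assume "Y \<in> carrier (tensor V W)"
    then obtain q where q: "Y = tcls V W q" "Poly_Mapping.keys q \<subseteq> carrier V \<times> carrier W"
      by (rule tensor_carrierE)
    have "Poly_Mapping.keys (p + q) \<subseteq> carrier V \<times> carrier W"
      using keys_add[of p q] p(2) q(2) by blast
    then show "tlift U \<beta> (X \<oplus>\<^bsub>tensor V W\<^esub> Y) = tlift U \<beta> X \<oplus>\<^bsub>U\<^esub> tlift U \<beta> Y"
      unfolding p(1) q(1) tensor_add_tcls tl[OF p(2)] tl[OF q(2)]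
      by (subst tl) (auto intro: lin_add[OF U g p(2) q(2)])
  qed
qed

lemma tens_carrier: "v \<in> carrier V \<Longrightarrow> w \<in> carrier W \<Longrightarrow> tens V W v w \<in> carrier (tensor V W)"
  unfolding tens_def by (rule tcls_carrier) simp

lemma tlift_tens:
  assumes V: "vspace V" and W: "vspace W" and U: "vspace U" and b: "bilin V W U \<beta>"
    and "v \<in> carrier V" "w \<in> carrier W"
  shows "tlift U \<beta> (tens V W v w) = \<beta> v w"
  using assms(5,6) bilin_closed[OF b assms(5,6)]
  by (simp add: tens_def tlift_tcls[OF V W U b] lin_single[OF U] vspaceD[OF U])

text \<open>Each identity says that one of the spanning relations of \<open>tnull\<close> lies in
  its span.\<close>

lemma tens_bilin: "bilin V W (tensor V W) (tens V W)"
proof (rule bilinI; rule linear_mapI)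
  fix v w assume v: "v \<in> carrier V" and w: "w \<in> carrier W"
  then show "tens V W v w \<in> carrier (tensor V W)" "tens V W v w \<in> carrier (tensor V W)"
    by (simp_all add: tens_carrier)
  show "tens V W (c \<odot>\<^bsub>V\<^esub> v) w = c \<odot>\<^bsub>tensor V W\<^esub> tens V W v w" for c
    unfolding tens_def tensor_smult_tcls tcls_eq_iff tnull_def
    by (rule pspace.span_base) (use v w in auto)
  show "tens V W v (c \<odot>\<^bsub>W\<^esub> w) = c \<odot>\<^bsub>tensor V W\<^esub> tens V W v w" for c
    unfolding tens_def tensor_smult_tcls tcls_eq_iff tnull_def
    by (rule pspace.span_base) (use v w in auto)
  show "tens V W (v \<oplus>\<^bsub>V\<^esub> v') w = tens V W v w \<oplus>\<^bsub>tensor V W\<^esub> tens V W v' w"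
    if v': "v' \<in> carrier V" for v'
    unfolding tens_def tensor_add_tcls tcls_eq_iff tnull_def diff_diff_eq[symmetric]
    by (rule pspace.span_base) (use v w v' in blast)
  show "tens V W v (w \<oplus>\<^bsub>W\<^esub> w') = tens V W v w \<oplus>\<^bsub>tensor V W\<^esub> tens V W v w'"
    if w': "w' \<in> carrier W" for w'
    unfolding tens_def tensor_add_tcls tcls_eq_iff tnull_def diff_diff_eq[symmetric]
    by (rule pspace.span_base) (use v w w' in blast)
qed

lemma update_eq_add:
  "z \<notin> Poly_Mapping.keys f \<Longrightarrow> Poly_Mapping.update z c f = Poly_Mapping.single z c + f"
  by (intro poly_mapping_eqI)
    (auto simp: lookup_update lookup_add lookup_single when_def in_keys_iff)

text \<open>No case for scalars is required: a coefficient is absorbed into the left factor of a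
  pure tensor, and the zero class is itself a pure tensor.\<close>

lemma tensor_induct [consumes 3, case_names tens add]:
  assumes V: "vspace V" and W: "vspace W" and X: "X \<in> carrier (tensor V W)"
    and t: "\<And>v w. v \<in> carrier V \<Longrightarrow> w \<in> carrier W \<Longrightarrow> P (tens V W v w)"
    and a: "\<And>X Y. X \<in> carrier (tensor V W) \<Longrightarrow> Y \<in> carrier (tensor V W) \<Longrightarrow> P X \<Longrightarrow> P Y
        \<Longrightarrow> P (X \<oplus>\<^bsub>tensor V W\<^esub> Y)"
  shows "P X"
proof -
  interpret V: abelian_group V by (rule vspaceD) fact
  interpret W: abelian_group W by (rule vspaceD) fact
  have s: "tcls V W (Poly_Mapping.single (v, w) c) = tens V W (c \<odot>\<^bsub>V\<^esub> v) w"
    if "v \<in> carrier V" "w \<in> carrier W" for v w c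
    using linear_mapD(3)[OF bilinD(2)[OF tens_bilin that(2)] that(1), of c]
    by (simp add: tens_def tensor_smult_tcls)
  have z: "tcls V W 0 = tens V W \<zero>\<^bsub>V\<^esub> \<zero>\<^bsub>W\<^esub>"
    using s[of "\<zero>\<^bsub>V\<^esub>" "\<zero>\<^bsub>W\<^esub>" 0] by (simp add: vspaceD[OF V])
  obtain p where p: "X = tcls V W p" "Poly_Mapping.keys p \<subseteq> carrier V \<times> carrier W"
    using X by (rule tensor_carrierE)
  have "P (tcls V W p)"
    using p(2)
  proof (induction p rule: update_induct)
    case const then show ?case by (simp add: z t)
  next
    case (update f z c)
    have eq: "Poly_Mapping.update z c f = Poly_Mapping.single z c + f"
      by (rule update_eq_add[OF update(1)])
    have "Poly_Mapping.keys (Poly_Mapping.update z c f) = insert z (Poly_Mapping.keys f)"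
      using update(2) by (simp add: keys_update)
    then have k: "z \<in> carrier V \<times> carrier W" "Poly_Mapping.keys f \<subseteq> carrier V \<times> carrier W"
      using update by auto
    then have "P (tcls V W (Poly_Mapping.single z c))" by (cases z) (auto simp: s t vspaceD[OF V])
    then have "P (tcls V W (Poly_Mapping.single z c) \<oplus>\<^bsub>tensor V W\<^esub> tcls V W f)"
      by (intro a tcls_carrier) (use k update in auto)
    then show ?case by (simp add: eq tensor_add_tcls)
  qed
  then show ?thesis by (simp add: p)
qed

lemma field_module_simps [simp]:
  "carrier field_module = UNIV" "add field_module = (+)" "zero field_module = 0"
  "smult field_module = (*)"
  by (simp_all add: field_module_def type_ring_def ring.defs module.defs)

lemma field_module_vspace: "vspace (field_module :: ('k::field, 'k) module)"
proof (rule vspaceI)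
  show "abelian_group (field_module :: ('k, 'k) module)"
    by (rule abelian_groupI) (auto simp: algebra_simps intro: exI[of _ "- _"])
qed (simp_all add: algebra_simps)

text \<open>Only the claim of \<open>lin_tnull\<close> about supports is wanted, so it is applied to
  the zero bilinear map. The result covers all representatives of a class, not just the one that
  witnesses membership in the carrier.\<close>

lemma tensor_mem_keys:
  assumes V: "vspace V" and W: "vspace W" and X: "X \<in> carrier (tensor V W)" and q: "q \<in> X"
  shows "Poly_Mapping.keys q \<subseteq> carrier V \<times> carrier W"
proof -
  have "bilin V W field_module (\<lambda>_ _. 0)"
    by (auto intro!: bilinI linear_mapI)
  note n = lin_tnull[OF V W field_module_vspace this]
  obtain p where p: "X = tcls V W p" "Poly_Mapping.keys p \<subseteq> carrier V \<times> carrier W"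
    using X by (rule tensor_carrierE)
  have "Poly_Mapping.keys (q - p) \<subseteq> carrier V \<times> carrier W"
    using n q p by (auto simp: tcls_def)
  then show ?thesis using keys_add[of "q - p" p] p(2) by auto
qed

text \<open>The two sums are compared on each representative separately. This permits an integrand
  to be rewritten before it is known to be bilinear, which is how nested Sweedler sums are
  simplified from the inside.\<close>

lemma tlift_cong:
  assumes V: "vspace V" and W: "vspace W" and U: "vspace U" and X: "X \<in> carrier (tensor V W)"
    and cl: "\<And>v w. v \<in> carrier V \<Longrightarrow> w \<in> carrier W \<Longrightarrow> \<beta>' v w \<in> carrier U"
    and eq: "\<And>v w. v \<in> carrier V \<Longrightarrow> w \<in> carrier W \<Longrightarrow> \<beta> v w = \<beta>' v w"
  shows "tlift U \<beta> X = tlift U \<beta>' X"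
proof -
  interpret U: abelian_group U by (rule vspaceD) fact
  have "lin U (\<lambda>z. \<beta> (fst z) (snd z)) q = lin U (\<lambda>z. \<beta>' (fst z) (snd z)) q" if "q \<in> X" for q
  proof -
    note k = tensor_mem_keys[OF V W X that]
    show ?thesis unfolding lin_def
      by (rule U.finsum_cong') (use k cl eq in \<open>auto simp: vspaceD[OF U]\<close>)
  qed
  then show ?thesis unfolding tlift_eq_lin by (simp cong: image_cong_simp)
qed

section \<open>Presheaves and the Yoneda lemma\<close>

lemma is_categoryD:
  assumes "is_category C"
  shows "\<And>f. f \<in> arr C \<Longrightarrow> src C f \<in> obj C" "\<And>f. f \<in> arr C \<Longrightarrow> tgt C f \<in> obj C"
    and "\<And>X. X \<in> obj C \<Longrightarrow> ident C X \<in> arr C"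
    and "\<And>X. X \<in> obj C \<Longrightarrow> src C (ident C X) = X" "\<And>X. X \<in> obj C \<Longrightarrow> tgt C (ident C X) = X"
    and "\<And>f g. f \<in> arr C \<Longrightarrow> g \<in> arr C \<Longrightarrow> tgt C f = src C g \<Longrightarrow> cmp C g f \<in> arr C"
    and "\<And>f g. f \<in> arr C \<Longrightarrow> g \<in> arr C \<Longrightarrow> tgt C f = src C g \<Longrightarrow> src C (cmp C g f) = src C f"
    and "\<And>f g. f \<in> arr C \<Longrightarrow> g \<in> arr C \<Longrightarrow> tgt C f = src C g \<Longrightarrow> tgt C (cmp C g f) = tgt C g"
    and "\<And>f. f \<in> arr C \<Longrightarrow> cmp C f (ident C (src C f)) = f"
    and "\<And>f. f \<in> arr C \<Longrightarrow> cmp C (ident C (tgt C f)) f = f"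
    and "\<And>f g h. f \<in> arr C \<Longrightarrow> g \<in> arr C \<Longrightarrow> h \<in> arr C \<Longrightarrow> tgt C f = src C g \<Longrightarrow> tgt C g = src C h
        \<Longrightarrow> cmp C (cmp C h g) f = cmp C h (cmp C g f)"
  using assms unfolding is_category_def homset_def by simp_all

lemma opp_simps [simp]:
  "obj (opp C) = obj C" "arr (opp C) = arr C" "src (opp C) = tgt C" "tgt (opp C) = src C"
  "ident (opp C) = ident C" "cmp (opp C) g f = cmp C f g"
  by (simp_all add: opp_def)

lemma opp_category: "is_category C \<Longrightarrow> is_category (opp C)"
  unfolding is_category_def homset_def by simp

lemma full_subcategory_simps [simp]:
  "obj (full_subcategory C P) = obj C \<inter> P"
  "arr (full_subcategory C P) = {f \<in> arr C. src C f \<in> P \<and> tgt C f \<in> P}"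
  "src (full_subcategory C P) = src C" "tgt (full_subcategory C P) = tgt C"
  "ident (full_subcategory C P) = ident C" "cmp (full_subcategory C P) = cmp C"
  by (simp_all add: full_subcategory_def)

lemma full_subcategory_category: "is_category C \<Longrightarrow> is_category (full_subcategory C P)"
  unfolding is_category_def homset_def by simp

lemma set_category_simps [simp]:
  "obj set_category = UNIV" "(X, f, Y) \<in> arr set_category \<longleftrightarrow> f \<in> X \<rightarrow>\<^sub>E Y"
  "src set_category = fst" "tgt set_category = snd \<circ> snd"
  "ident set_category X = (X, \<lambda>x\<in>X. x, X)"
  "cmp set_category (Y', g, Z) (X, f, Y) = (X, compose X g f, Z)"
  by (simp_all add: set_category_def)

lemma set_category_category: "is_category set_category"
  unfolding is_category_def homset_def
  by (auto simp: set_category_def compose_def fun_eq_iff PiE_def extensional_def Pi_iff)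

lemma is_functorD:
  assumes "is_functor C D F"
  shows "\<And>X. X \<in> obj C \<Longrightarrow> fobj F X \<in> obj D"
    and "\<And>f. f \<in> arr C \<Longrightarrow> farr F f \<in> arr D"
    and "\<And>f. f \<in> arr C \<Longrightarrow> src D (farr F f) = fobj F (src C f)"
    and "\<And>f. f \<in> arr C \<Longrightarrow> tgt D (farr F f) = fobj F (tgt C f)"
    and "\<And>X. X \<in> obj C \<Longrightarrow> farr F (ident C X) = ident D (fobj F X)"
    and "\<And>f g. f \<in> arr C \<Longrightarrow> g \<in> arr C \<Longrightarrow> tgt C f = src C g
          \<Longrightarrow> farr F (cmp C g f) = cmp D (farr F g) (farr F f)"
  using assms unfolding is_functor_def by auto

lemma functor_category_arr:
  "(F, \<eta>, G) \<in> arr (functor_category C D) \<longleftrightarrow> is_functor C D F \<and> is_functor C D G \<and> \<eta> \<in> extensional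
      (obj C)
     \<and> (\<forall>X\<in>obj C. \<eta> X \<in> homset D (fobj F X) (fobj G X))
     \<and> (\<forall>f\<in>arr C. cmp D (\<eta> (tgt C f)) (farr F f) = cmp D (farr G f) (\<eta> (src C f)))"
  by (simp add: functor_category_def)

lemma functor_category_simps [simp]:
  "obj (functor_category C D) = {F. is_functor C D F}"
  "src (functor_category C D) = fst" "tgt (functor_category C D) = snd \<circ> snd"
  "ident (functor_category C D) F = (F, \<lambda>X\<in>obj C. ident D (fobj F X), F)"
  "cmp (functor_category C D) (G', \<theta>, H) (F, \<eta>, G) = (F, \<lambda>X\<in>obj C. cmp D (\<theta> X) (\<eta> X), H)"
  by (simp_all add: functor_category_def)

lemma functor_category_category:
  assumes C: "is_category C" and D: "is_category D"
  shows "is_category (functor_category C D)" (is "is_category ?E")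
proof -
  note [simp] = is_categoryD[OF C]
  note Dc = is_categoryD[OF D]
  have ident: "(F, \<lambda>X\<in>obj C. ident D (fobj F X), F) \<in> arr ?E" if F: "is_functor C D F" for F
    using F Dc(9,10) is_functorD[OF F]
    by (auto simp: functor_category_arr homset_def Dc) (metis Dc(9,10))
  have comp: "(F, \<lambda>X\<in>obj C. cmp D (\<theta> X) (\<eta> X), H) \<in> arr ?E"
    if \<eta>: "(F, \<eta>, G) \<in> arr ?E" and \<theta>: "(G, \<theta>, H) \<in> arr ?E" for F G H \<eta> \<theta>
  proof -
    from \<eta> have F: "is_functor C D F" and G: "is_functor C D G" by (simp_all add:
        functor_category_arr)
    from \<theta> have H: "is_functor C D H" by (simp add: functor_category_arr)
    have e: "\<eta> X \<in> arr D" "src D (\<eta> X) = fobj F X" "tgt D (\<eta> X) = fobj G X" if "X \<in> obj C" for X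
      using that \<eta> by (simp_all add: functor_category_arr homset_def)
    have t: "\<theta> X \<in> arr D" "src D (\<theta> X) = fobj G X" "tgt D (\<theta> X) = fobj H X" if "X \<in> obj C" for X
      using that \<theta> by (simp_all add: functor_category_arr homset_def)
    have "cmp D (cmp D (\<theta> (tgt C f)) (\<eta> (tgt C f))) (farr F f) =
        cmp D (farr H f) (cmp D (\<theta> (src C f)) (\<eta> (src C f)))" if f: "f \<in> arr C" for f
    proof -
      have n1: "cmp D (\<eta> (tgt C f)) (farr F f) = cmp D (farr G f) (\<eta> (src C f))"
        using \<eta> f by (simp add: functor_category_arr)
      have n2: "cmp D (\<theta> (tgt C f)) (farr G f) = cmp D (farr H f) (\<theta> (src C f))"
        using \<theta> f by (simp add: functor_category_arr)
      have "cmp D (cmp D (\<theta> (tgt C f)) (\<eta> (tgt C f))) (farr F f)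
          = cmp D (\<theta> (tgt C f)) (cmp D (\<eta> (tgt C f)) (farr F f))"
        by (rule Dc(11)) (use f in \<open>simp_all add: e t is_functorD[OF F]\<close>)
      also have "\<dots> = cmp D (cmp D (\<theta> (tgt C f)) (farr G f)) (\<eta> (src C f))"
        unfolding n1 by (rule Dc(11)[symmetric]) (use f in \<open>simp_all add: e t is_functorD[OF G]\<close>)
      also have "\<dots> = cmp D (farr H f) (cmp D (\<theta> (src C f)) (\<eta> (src C f)))"
        unfolding n2 by (rule Dc(11)) (use f in \<open>simp_all add: e t is_functorD[OF H]\<close>)
      finally show ?thesis .
    qed
    then show ?thesis using F H by (simp add: functor_category_arr homset_def e t Dc)
  qed
  have unit: "(\<lambda>X\<in>obj C. cmp D (\<eta> X) ((\<lambda>X\<in>obj C. ident D (fobj F X)) X)) = \<eta>"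
      "(\<lambda>X\<in>obj C. cmp D ((\<lambda>X\<in>obj C. ident D (fobj G X)) X) (\<eta> X)) = \<eta>"
    if \<eta>: "(F, \<eta>, G) \<in> arr ?E" for F \<eta> G
  proof -
    have e: "\<eta> X \<in> arr D" "src D (\<eta> X) = fobj F X" "tgt D (\<eta> X) = fobj G X" if "X \<in> obj C" for X
      using that \<eta> by (simp_all add: functor_category_arr homset_def)
    have x: "\<eta> \<in> extensional (obj C)" using \<eta> by (simp add: functor_category_arr)
    show "(\<lambda>X\<in>obj C. cmp D (\<eta> X) ((\<lambda>X\<in>obj C. ident D (fobj F X)) X)) = \<eta>"
      by (rule extensionalityI[OF _ x]) (use e Dc(9) in \<open>auto, metis\<close>)
    show "(\<lambda>X\<in>obj C. cmp D ((\<lambda>X\<in>obj C. ident D (fobj G X)) X) (\<eta> X)) = \<eta>"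
      by (rule extensionalityI[OF _ x]) (use e Dc(10) in \<open>auto, metis\<close>)
  qed
  have assoc: "(\<lambda>X\<in>obj C. cmp D (\<kappa> X) ((\<lambda>X\<in>obj C. cmp D (\<theta> X) (\<eta> X)) X)) =
     (\<lambda>X\<in>obj C. cmp D ((\<lambda>X\<in>obj C. cmp D (\<kappa> X) (\<theta> X)) X) (\<eta> X))"
    if "(F, \<eta>, G) \<in> arr ?E" "(G, \<theta>, H) \<in> arr ?E" "(H, \<kappa>, K) \<in> arr ?E" for F G H K \<eta> \<theta> \<kappa>
    by (rule restrict_ext) (use that in \<open>auto simp: functor_category_arr homset_def Dc(11)\<close>)
  have ends: "is_functor C D F" "is_functor C D G" if "(F, \<eta>, G) \<in> arr ?E" for F G \<eta>
    using that by (simp_all add: functor_category_arr)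
  have triples: "(\<forall>f\<in>arr ?E. Q f) \<longleftrightarrow> (\<forall>F \<eta> G. (F, \<eta>, G) \<in> arr ?E \<longrightarrow> Q (F, \<eta>, G))" for Q
    by auto
  show ?thesis
    unfolding is_category_def homset_def triples
    using ends by (auto simp del: restrict_apply intro: ident comp unit assoc)
qed

section \<open>Representable presheaves\<close>

lemma hom_presheaf_functor:
  assumes C: "is_category C" and X: "X \<in> obj C"
  shows "is_functor (opp C) set_category (hom_presheaf C X)"
proof -
  note Cc [simp] = is_categoryD[OF C]
  have id: "cmp C g (ident C Z) = g" if "g \<in> homset C Z X" for g Z
    using Cc(9)[of g] that by (auto simp: homset_def)
  show ?thesis
    unfolding is_functor_def hom_presheaf_def
    by (auto simp: homset_def compose_def fun_eq_iff id[unfolded homset_def])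
qed

lemma hom_presheaf_simps:
  "Z \<in> obj C \<Longrightarrow> fobj (hom_presheaf C X) Z = homset C Z X"
  "k \<in> arr C \<Longrightarrow> farr (hom_presheaf C X) k =
     (homset C (tgt C k) X, \<lambda>g\<in>homset C (tgt C k) X. cmp C g k, homset C (src C k) X)"
  by (simp_all add: hom_presheaf_def)

text \<open>A full subcategory has the same morphisms between its objects as the ambient category,
  so the Yoneda lemma for presheaves restricts to any class P that contains the representable ones.
  Later P is the class of sheaves.\<close>

lemma yoneda_fully_faithful:
  assumes C: "is_category C" and P: "\<And>X. X \<in> obj C \<Longrightarrow> hom_presheaf C X \<in> P"
  shows "fully_faithful_embedding C
    (full_subcategory (functor_category (opp C) set_category) P) (yoneda C)"
    (is "fully_faithful_embedding C ?D _")
proof -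
  note Cc [simp] = is_categoryD[OF C]
  have D: "is_category ?D"
    by (intro full_subcategory_category functor_category_category opp_category
        set_category_category C)
  note func = hom_presheaf_functor[OF C]
  let ?y = "\<lambda>f. \<lambda>Z\<in>obj C. (homset C Z (src C f), \<lambda>g\<in>homset C Z (src C f). cmp C f g, homset C Z
      (tgt C f))"
  have arrow: "(hom_presheaf C (src C f), ?y f, hom_presheaf C (tgt C f))
      \<in> arr (functor_category (opp C) set_category)" if f: "f \<in> arr C" for f
    unfolding functor_category_arr using f func
    by (auto simp: hom_presheaf_simps homset_def compose_def fun_eq_iff)
  have F: "is_functor C ?D (yoneda C)"
    unfolding is_functor_def yoneda_def
    using arrow func P
    by (auto simp: hom_presheaf_simps homset_def compose_def fun_eq_iff restrict_def)
  have bij: "bij_betw (farr (yoneda C)) (homset C X Y) (homset ?D (hom_presheaf C X) (hom_presheaf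
      C Y))"
    if X: "X \<in> obj C" and Y: "Y \<in> obj C" for X Y
  proof (rule bij_betw_imageI)
    show "inj_on (farr (yoneda C)) (homset C X Y)"
    proof (rule inj_onI)
      fix f g assume f: "f \<in> homset C X Y" and g: "g \<in> homset C X Y"
        and eq: "farr (yoneda C) f = farr (yoneda C) g"
      \<comment> \<open>The component at X, applied to the identity of X, returns the arrow.\<close>
      then have "?y f X = ?y g X" by (auto simp: yoneda_def homset_def)
      then have "(\<lambda>k\<in>homset C X X. cmp C f k) (ident C X) = (\<lambda>k\<in>homset C X X. cmp C g k) (ident C
          X)"
        using f g X by (auto simp: homset_def)
      then show "f = g" using f g X Cc(9)[of f] Cc(9)[of g] by (auto simp: homset_def)
    qed
    have "farr (yoneda C) f \<in> homset ?D (hom_presheaf C X) (hom_presheaf C Y)" if "f \<in> homset C X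
        Y" for f
      using that is_functorD(2-4)[OF F, of f] X Y by (auto simp: homset_def yoneda_def)
    moreover have "\<phi> \<in> farr (yoneda C) ` homset C X Y"
      if hom: "\<phi> \<in> homset ?D (hom_presheaf C X) (hom_presheaf C Y)" for \<phi>
    proof -
      obtain \<eta> where \<phi>: "\<phi> = (hom_presheaf C X, \<eta>, hom_presheaf C Y)"
        and \<eta>: "(hom_presheaf C X, \<eta>, hom_presheaf C Y) \<in> arr (functor_category (opp C)
            set_category)"
        using hom by (cases \<phi>) (auto simp: homset_def)
      have "\<exists>m. \<eta> Z = (homset C Z X, m, homset C Z Y) \<and> m \<in> homset C Z X \<rightarrow>\<^sub>E homset C Z Y"
        if Z: "Z \<in> obj C" for Z
      proof -
        have "\<eta> Z \<in> homset set_category (homset C Z X) (homset C Z Y)"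
          using \<eta> Z by (simp add: functor_category_arr hom_presheaf_simps)
        then show ?thesis by (cases "\<eta> Z") (simp add: homset_def[of set_category])
      qed
      then obtain m where m: "\<And>Z. Z \<in> obj C \<Longrightarrow> \<eta> Z = (homset C Z X, m Z, homset C Z Y)"
        "\<And>Z. Z \<in> obj C \<Longrightarrow> m Z \<in> homset C Z X \<rightarrow>\<^sub>E homset C Z Y" by metis
      \<comment> \<open>The Yoneda element: a natural transformation out of a representable presheaf
        is determined by its value at the identity.\<close>
      define f where "f = m X (ident C X)"
      have idX: "ident C X \<in> homset C X X" using X by (simp add: homset_def)
      then have f: "f \<in> homset C X Y" using m(2)[OF X] by (auto simp: f_def)
      have mZ: "m Z = (\<lambda>k\<in>homset C Z X. cmp C f k)" if Z: "Z \<in> obj C" for Z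
      proof (rule extensionalityI[of _ "homset C Z X"])
        fix k assume k: "k \<in> homset C Z X"
        then have k': "k \<in> arr C" "src C k = Z" "tgt C k = X" by (simp_all add: homset_def)
        \<comment> \<open>Naturality along k : Z -> X, to be evaluated at the identity of X.\<close>
        have "cmp set_category (\<eta> Z) (farr (hom_presheaf C X) k)
            = cmp set_category (farr (hom_presheaf C Y) k) (\<eta> X)"
          using \<eta> k' by (auto simp: functor_category_arr)
        then have "compose (homset C X X) (m Z) (\<lambda>g\<in>homset C X X. cmp C g k)
            = compose (homset C X X) (\<lambda>g\<in>homset C X Y. cmp C g k) (m X)"
          using k' X Z by (simp add: hom_presheaf_simps m)
        from fun_cong[OF this, of "ident C X"]
        have "m Z (cmp C (ident C X) k) = cmp C f k"
          using idX f by (simp add: compose_def f_def)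
        moreover have "cmp C (ident C X) k = k" using Cc(10)[of k] k' by simp
        ultimately show "m Z k = (\<lambda>k\<in>homset C Z X. cmp C f k) k" using k by simp
      qed (use m(2)[OF Z] in \<open>auto simp: PiE_def\<close>)
      have "\<eta> = ?y f"
      proof (rule extensionalityI[of _ "obj C"])
        show "\<eta> \<in> extensional (obj C)" using \<eta> by (simp add: functor_category_arr)
        show "\<eta> Z = ?y f Z" if "Z \<in> obj C" for Z
          using that f by (simp add: m mZ) (simp add: homset_def)
      qed simp
      then have "\<phi> = farr (yoneda C) f" using f by (auto simp: \<phi> yoneda_def homset_def)
      then show ?thesis using f by blast
    qed
    ultimately show "farr (yoneda C) ` homset C X Y = homset ?D (hom_presheaf C X) (hom_presheaf C
        Y)"
      by blast
  qed
  \<comment> \<open>Arrows remember their endpoints, so the identity of X can lie in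
    \<open>homset C X Y\<close> only if Y is X.\<close>
  have inj: "inj_on (fobj (yoneda C)) (obj C)"
  proof (rule inj_onI)
    fix X Y assume X: "X \<in> obj C" and Y: "Y \<in> obj C" and "fobj (yoneda C) X = fobj (yoneda C) Y"
    then have "fobj (hom_presheaf C X) X = fobj (hom_presheaf C Y) X" by (simp add: yoneda_def)
    then have "homset C X X = homset C X Y" unfolding hom_presheaf_simps(1)[OF X] .
    moreover have "ident C X \<in> homset C X X" using X by (simp add: homset_def)
    ultimately have "ident C X \<in> homset C X Y" by (rule subst)
    then show "X = Y" using X by (simp add: homset_def)
  qed
  have "fobj (yoneda C) X = hom_presheaf C X" if "X \<in> obj C" for X using that by (simp add:
      yoneda_def)
  then show ?thesis
    unfolding fully_faithful_embedding_def using C D F bij inj by simp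
qed

section \<open>Comodules over the torus and the category of algebras\<close>

lemma torus_module_simps [simp]:
  "carrier torus_module = UNIV" "add torus_module = (+)" "zero torus_module = 0"
  "smult torus_module = pscale"
  by (simp_all add: torus_module_def type_ring_def ring.defs module.defs)

lemma torus_vspace: "vspace (torus_module :: ('k::field, ('k, 'n::finite) torus) module)"
proof (rule vspaceI)
  show "abelian_group (torus_module :: ('k, ('k, 'n) torus) module)"
    by (rule abelian_groupI) (auto simp: algebra_simps intro: exI[of _ "- _"])
qed (simp_all add: pspace.scale_left_distrib pspace.scale_right_distrib)

section \<open>Linear maps on H \<otimes> V\<close>

lemma tensor_linear_eqI:
  assumes V: "vspace V" and W: "vspace W"
    and F: "linear_map (tensor V W) U F" and G: "linear_map (tensor V W) U G"
    and X: "X \<in> carrier (tensor V W)"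
    and eq: "\<And>v w. v \<in> carrier V \<Longrightarrow> w \<in> carrier W \<Longrightarrow> F (tens V W v w) = G (tens V W v w)"
  shows "F X = G X"
  using V W X by (induction X rule: tensor_induct) (simp_all add: eq linear_mapD[OF F]
      linear_mapD[OF G])

lemma linear_map_id: "linear_map V V (\<lambda>x. x)"
  by (simp add: linear_map_def)

lemma linear_map_cong:
  assumes V: "vspace V" and f: "linear_map V W f" and eq: "\<And>v. v \<in> carrier V \<Longrightarrow> f' v = f v"
  shows "linear_map V W f'"
proof -
  interpret V: abelian_group V by (rule vspaceD) fact
  show ?thesis by (rule linear_mapI) (simp_all add: eq vspaceD[OF V] linear_mapD[OF f])
qed

text \<open>The map id \<otimes> f on H \<otimes> V, written exactly as equivariance appears in
  \<open>alg_morphism\<close>.\<close>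

abbreviation hmap :: "('k::field, 'w, 'l) module_scheme \<Rightarrow> ('v \<Rightarrow> 'w)
    \<Rightarrow> ('k, ('k, 'n::finite) torus, 'v) tensors \<Rightarrow> ('k, ('k, 'n) torus, 'w) tensors" where
  "hmap W f \<equiv> tlift (tensor torus_module W) (\<lambda>h v. tens torus_module W h (f v))"

lemma tens_map_bilin:
  fixes V :: "('k::field, 'v, 'm) module_scheme"
  assumes f: "linear_map V W f"
  shows "bilin (torus_module :: ('k, ('k, 'n::finite) torus) module) V (tensor torus_module W) (\<lambda>h
      v. tens torus_module W h (f v))"
proof (rule bilinI)
  fix h :: "('k, 'n) torus" assume h: "h \<in> carrier torus_module"
  show "linear_map V (tensor torus_module W) (\<lambda>v. tens torus_module W h (f v))"
    using bilinD(1)[OF tens_bilin h] f by (rule linear_map_compose[rotated])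
next
  fix v assume "v \<in> carrier V"
  then show "linear_map torus_module (tensor torus_module W) (\<lambda>h. tens torus_module W h (f v))"
    by (intro bilinD(2)[OF tens_bilin] linear_mapD(1)[OF f])
qed

lemma hmap_linear:
  assumes "vspace V" "vspace W" "linear_map V W f"
  shows "linear_map (tensor torus_module V) (tensor torus_module W) (hmap W f)"
  by (rule tlift_linear[OF torus_vspace assms(1) tensor_vspace tens_map_bilin[OF assms(3)]])

lemma hmap_tens:
  assumes "vspace V" "vspace W" "linear_map V W f" "v \<in> carrier V"
  shows "hmap W f (tens torus_module V h v) = tens torus_module W h (f v)"
  by (rule tlift_tens[OF torus_vspace assms(1) tensor_vspace tens_map_bilin[OF assms(3)]])
    (use assms in auto)

lemma hmap_hmap:
  assumes U: "vspace U" and V: "vspace V" and W: "vspace W"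
    and f: "linear_map U V f" and g: "linear_map V W g"
    and X: "X \<in> carrier (tensor torus_module U)"
  shows "hmap W g (hmap V f X) = hmap W (\<lambda>u. g (f u)) X"
proof -
  note gf = linear_map_compose[OF f g]
  show ?thesis
    by (rule tensor_linear_eqI[OF torus_vspace U
          linear_map_compose[OF hmap_linear[OF U V f] hmap_linear[OF V W g]]
          hmap_linear[OF U W gf] X])
      (simp add: hmap_tens[OF U V f] hmap_tens[OF V W g] hmap_tens[OF U W gf] linear_mapD[OF f])
qed

lemma hmap_id:
  assumes V: "vspace V" and X: "X \<in> carrier (tensor torus_module V)"
  shows "hmap V (\<lambda>v. v) X = X"
  by (rule tensor_linear_eqI[OF torus_vspace V hmap_linear[OF V V linear_map_id] linear_map_id X])
    (simp add: hmap_tens[OF V V linear_map_id])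

lemma hmap_cong:
  assumes V: "vspace V" and W: "vspace W" and f: "linear_map V W f"
    and X: "X \<in> carrier (tensor torus_module V)"
    and eq: "\<And>v. v \<in> carrier V \<Longrightarrow> f' v = f v"
  shows "hmap W f' X = hmap W f X"
  by (rule tlift_cong[OF torus_vspace V tensor_vspace X])
    (use eq f in \<open>simp_all add: tens_carrier linear_mapD(1)\<close>)

text \<open>Contraction of the H-factor with the functional dual to the basis element t_m. Applied
  to the coaction of a vector it gives the component of degree m.\<close>

definition hcomp :: "('k::field, 'v, 'm) module_scheme \<Rightarrow> int ^ 'n::finite
    \<Rightarrow> ('k, ('k, 'n) torus, 'v) tensors \<Rightarrow> 'v" where
  "hcomp V m = tlift V (\<lambda>h v. Poly_Mapping.lookup h m \<odot>\<^bsub>V\<^esub> v)"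

lemma hcomp_bilin: 
  assumes V: "vspace V"
  shows "bilin torus_module V V (\<lambda>h v. Poly_Mapping.lookup h m \<odot>\<^bsub>V\<^esub> v)"
  by (intro bilinI linear_mapI)
    (simp_all add: vspaceD[OF V] lookup_add mult.commute flip: vspaceD(5)[OF V])

lemma hcomp_linear:
  assumes V: "vspace V" shows "linear_map (tensor torus_module V) V (hcomp V m)"
  unfolding hcomp_def by (rule tlift_linear[OF torus_vspace V V hcomp_bilin[OF V]])

lemma hcomp_tens:
  assumes V: "vspace V" and v: "v \<in> carrier V"
  shows "hcomp V m (tens torus_module V h v) = Poly_Mapping.lookup h m \<odot>\<^bsub>V\<^esub> v"
  unfolding hcomp_def by (rule tlift_tens[OF torus_vspace V V hcomp_bilin[OF V]]) (use v in auto)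

lemma hcomp_hmap:
  assumes V: "vspace V" and W: "vspace W" and f: "linear_map V W f"
    and X: "X \<in> carrier (tensor torus_module V)"
  shows "hcomp W m (hmap W f X) = f (hcomp V m X)"
  by (rule tensor_linear_eqI[OF torus_vspace V
          linear_map_compose[OF hmap_linear[OF V W f] hcomp_linear[OF W]]
          linear_map_compose[OF hcomp_linear[OF V] f] X])
    (simp add: hmap_tens[OF V W f] hcomp_tens[OF V] hcomp_tens[OF W] linear_mapD[OF f])

lemma poly_mapping_expand:
  "finite S \<Longrightarrow> Poly_Mapping.keys h \<subseteq> S
    \<Longrightarrow> (\<Sum>m\<in>S. Poly_Mapping.single m (Poly_Mapping.lookup h m)) = h"
  by (rule poly_mapping_eqI)
    (auto simp: lookup_sum lookup_single when_def sum.delta in_keys_iff subset_iff)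

lemma finsum_torus:
  fixes f :: "'i \<Rightarrow> ('k::field, 'n::finite) torus"
  assumes "finite S"
  shows "finsum torus_module f S = sum f S"
proof -
  interpret abelian_group "torus_module :: ('k, ('k, 'n) torus) module"
    by (rule vspaceD[OF torus_vspace])
  show ?thesis using assms by (induction S rule: finite_induct) simp_all
qed

text \<open>The expansion is claimed for every finite index set beyond some \<open>S0\<close>, not
  for one set: in the additive step two elements with different supports must be expanded over a
  common set.\<close>

lemma hcomp_expand:
  assumes V: "vspace V" and X: "X \<in> carrier (tensor torus_module V)"
  shows "\<exists>S0. finite S0 \<and> (\<forall>S. finite S \<longrightarrow> S0 \<subseteq> S \<longrightarrow>
    (\<Oplus>\<^bsub>tensor torus_module V\<^esub>m\<in>S. tens torus_module V (tmon m) (hcomp V m X)) = X)"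
  using torus_vspace V X
proof (induction X rule: tensor_induct)
  case (tens h v)
  let ?T = "tensor torus_module V"
  note lin = bilinD(2)[OF tens_bilin[of torus_module V] tens(2)]
  interpret T: abelian_group "tensor torus_module V" by (rule vspaceD[OF tensor_vspace])
  have "(\<Oplus>\<^bsub>?T\<^esub>m\<in>S. tens torus_module V (tmon m) (hcomp V m (tens torus_module V h v))) =
     tens torus_module V h v"
    if S: "finite S" "Poly_Mapping.keys h \<subseteq> S" for S
  proof -
    have "tens torus_module V h v = tens torus_module V
        (\<Oplus>\<^bsub>torus_module\<^esub>m\<in>S. pscale (Poly_Mapping.lookup h m) (tmon m)) v"
      by (simp add: finsum_torus S tmon_def poly_mapping_expand)
    also have "\<dots> = (\<Oplus>\<^bsub>?T\<^esub>m\<in>S. tens torus_module V (pscale (Poly_Mapping.lookup h m) (tmon m)) v)"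
      by (rule linear_map_finsum[OF torus_vspace tensor_vspace lin]) simp
    also have "\<dots> = (\<Oplus>\<^bsub>?T\<^esub>m\<in>S. tens torus_module V (tmon m) (hcomp V m (tens torus_module V h v)))"
    proof (rule T.finsum_cong')
      fix m
      show "tens torus_module V (pscale (Poly_Mapping.lookup h m) (tmon m)) v
        = tens torus_module V (tmon m) (hcomp V m (tens torus_module V h v))"
      proof -
        \<comment> \<open>The coefficient of t_m in h crosses the tensor sign, because
          \<open>hcomp\<close> records it on the V-side.\<close>
        have "tens torus_module V (pscale (Poly_Mapping.lookup h m) (tmon m)) v
            = Poly_Mapping.lookup h m \<odot>\<^bsub>?T\<^esub> tens torus_module V (tmon m) v"
          using linear_mapD(3)[OF lin] by simp
        also have "\<dots> = tens torus_module V (tmon m) (Poly_Mapping.lookup h m \<odot>\<^bsub>V\<^esub> v)"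
          by (rule linear_mapD(3)[OF bilinD(1)[OF tens_bilin] tens(2), symmetric]) simp
        finally show ?thesis by (simp add: hcomp_tens[OF V tens(2)])
      qed
    qed (use tens in \<open>auto simp: tens_carrier hcomp_tens[OF V] vspaceD[OF V]\<close>)
    finally show ?thesis by (rule sym)
  qed
  then show ?case by (intro exI[of _ "Poly_Mapping.keys h"]) auto
next
  case (add X Y)
  let ?T = "tensor torus_module V"
  interpret T: abelian_group "tensor torus_module V" by (rule vspaceD[OF tensor_vspace])
  obtain S1 where S1: "finite S1 \<and> (\<forall>S. finite S \<longrightarrow> S1 \<subseteq> S \<longrightarrow> (\<Oplus>\<^bsub>?T\<^esub>m\<in>S. tens torus_module V (tmon
      m) (hcomp V m X)) = X)"
    using add(3) by (rule exE)
  obtain S2 where S2: "finite S2 \<and> (\<forall>S. finite S \<longrightarrow> S2 \<subseteq> S \<longrightarrow> (\<Oplus>\<^bsub>?T\<^esub>m\<in>S. tens torus_module V (tmon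
      m) (hcomp V m Y)) = Y)"
    using add(4) by (rule exE)
  have cl: "hcomp V m X \<in> carrier V" "hcomp V m Y \<in> carrier V" for m
    using add linear_mapD(1)[OF hcomp_linear[OF V]] by auto
  have "(\<Oplus>\<^bsub>?T\<^esub>m\<in>S. tens torus_module V (tmon m)
      (hcomp V m (X \<oplus>\<^bsub>?T\<^esub> Y))) = X \<oplus>\<^bsub>?T\<^esub> Y"
    if S: "finite S" "S1 \<union> S2 \<subseteq> S" for S
  proof -
    have e: "tens torus_module V (tmon m) (hcomp V m (X \<oplus>\<^bsub>?T\<^esub> Y)) =
      tens torus_module V (tmon m) (hcomp V m X) \<oplus>\<^bsub>?T\<^esub> tens torus_module V (tmon m) (hcomp V m Y)"
          for m
      by (simp add: linear_mapD(2)[OF hcomp_linear[OF V]] add linear_mapD(2)[OF bilinD(1)[OF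
          tens_bilin]] cl)
    have "(\<Oplus>\<^bsub>?T\<^esub>m\<in>S. tens torus_module V (tmon m)
      (hcomp V m (X \<oplus>\<^bsub>?T\<^esub> Y))) = 
      (\<Oplus>\<^bsub>?T\<^esub>m\<in>S. tens torus_module V (tmon m) (hcomp V m X)) \<oplus>\<^bsub>?T\<^esub>
      (\<Oplus>\<^bsub>?T\<^esub>m\<in>S. tens torus_module V (tmon m) (hcomp V m Y))"
      unfolding e by (rule T.finsum_addf) (auto intro!: tens_carrier cl)
    also have "\<dots> = X \<oplus>\<^bsub>?T\<^esub> Y"
    proof (rule arg_cong2[where f = "add (tensor torus_module V)"])
      show "(\<Oplus>\<^bsub>?T\<^esub>m\<in>S. tens torus_module V (tmon m) (hcomp V m X)) = X"
        using S1 S by simp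
      show "(\<Oplus>\<^bsub>?T\<^esub>m\<in>S. tens torus_module V (tmon m) (hcomp V m Y)) = Y"
        using S2 S by simp
    qed
    finally show ?thesis .
  qed
  then show ?case using S1 S2 by (intro exI[of _ "S1 \<union> S2"]) blast
qed

text \<open>Both elements are recovered from their components over one common finite set. Through
  this lemma, questions about equality in H \<otimes> V become questions in V.\<close>

lemma hcomp_ext:
  assumes V: "vspace V" and X: "X \<in> carrier (tensor torus_module V)" and Y: "Y \<in> carrier (tensor
      torus_module V)"
    and eq: "\<And>m. hcomp V m X = hcomp V m Y"
  shows "X = Y"
proof -
  obtain S1 where S1: "finite S1 \<and> (\<forall>S. finite S \<longrightarrow> S1 \<subseteq> S \<longrightarrow> (\<Oplus>\<^bsub>tensor torus_module V\<^esub>m\<in>S. tens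
      torus_module V (tmon m) (hcomp V m X)) = X)"
    using hcomp_expand[OF V X] by (rule exE)
  obtain S2 where S2: "finite S2 \<and> (\<forall>S. finite S \<longrightarrow> S2 \<subseteq> S \<longrightarrow> (\<Oplus>\<^bsub>tensor torus_module V\<^esub>m\<in>S. tens
      torus_module V (tmon m) (hcomp V m Y)) = Y)"
    using hcomp_expand[OF V Y] by (rule exE)
  have "X = (\<Oplus>\<^bsub>tensor torus_module V\<^esub>m\<in>S1 \<union> S2. tens torus_module V (tmon m) (hcomp V m X))"
    using S1 S2 by simp
  also have "\<dots> = Y"
    unfolding eq using S1 S2 by simp
  finally show ?thesis .
qed

section \<open>Braided algebras and their morphisms\<close>

lemma braided_algebraD:
  assumes "braided_algebra R A"
  shows "vspace A" "ring A"
    "linear_map A (tensor torus_module A) (coact A)"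
    "\<And>a. a \<in> carrier A \<Longrightarrow> tlift A (\<lambda>h w. torus_counit h \<odot>\<^bsub>A\<^esub> w) (coact A a) = a"
    "\<And>c a b. a \<in> carrier A \<Longrightarrow> b \<in> carrier A \<Longrightarrow> (c \<odot>\<^bsub>A\<^esub> a) \<otimes>\<^bsub>A\<^esub> b = c \<odot>\<^bsub>A\<^esub> (a \<otimes>\<^bsub>A\<^esub> b)"
    "\<And>c a b. a \<in> carrier A \<Longrightarrow> b \<in> carrier A \<Longrightarrow> a \<otimes>\<^bsub>A\<^esub> (c \<odot>\<^bsub>A\<^esub> b) = c \<odot>\<^bsub>A\<^esub> (a \<otimes>\<^bsub>A\<^esub> b)"
    "\<And>a a'. a \<in> carrier A \<Longrightarrow> a' \<in> carrier A \<Longrightarrow>  a \<otimes>\<^bsub>A\<^esub> a' =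
        tlift A (\<lambda>h' a0'. tlift A (\<lambda>h a0. rmat R h' h \<odot>\<^bsub>A\<^esub> (a0' \<otimes>\<^bsub>A\<^esub> a0)) (coact A a)) (coact A a')"
  using assms unfolding braided_algebra_def comodule_algebra_def comodule_def by blast+

lemma coact_closed:
  "braided_algebra R A \<Longrightarrow> a \<in> carrier A \<Longrightarrow> coact A a \<in> carrier (tensor torus_module A)"
  using linear_mapD(1)[OF braided_algebraD(3)] .

lemma alg_morphismD:
  assumes "alg_morphism A B f"
  shows "linear_map A B f" "f \<in> ring_hom A B"
    "\<And>a. a \<in> carrier A \<Longrightarrow> coact B (f a) = hmap B f (coact A a)"
  using assms unfolding alg_morphism_def by auto

text \<open>Arrows of the category are maps restricted to the carrier; this carries the morphism
  property across the restriction. For the coaction it uses that \<open>hmap\<close> sees its map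
  only on the carrier.\<close>

lemma alg_morphism_cong:
  assumes A: "braided_algebra R A" and B: "braided_algebra R B" and f: "alg_morphism A B f"
    and eq: "\<And>a. a \<in> carrier A \<Longrightarrow> f' a = f a"
  shows "alg_morphism A B f'"
  unfolding alg_morphism_def
proof (intro conjI ballI)
  interpret A: ring A by (rule braided_algebraD) fact
  note fD = alg_morphismD[OF f]
  show "linear_map A B f'" by (rule linear_map_cong[OF braided_algebraD(1)[OF A] fD(1) eq])
  show "f' \<in> ring_hom A B" using fD(2) by (auto simp: ring_hom_def eq)
  fix a assume a: "a \<in> carrier A"
  show "coact B (f' a) = hmap B f' (coact A a)"
    unfolding eq[OF a] fD(3)[OF a]
    by (rule hmap_cong[OF braided_algebraD(1)[OF A] braided_algebraD(1)[OF B] fD(1)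
        coact_closed[OF A a] eq, symmetric])
qed

lemma alg_morphism_id: "braided_algebra R A \<Longrightarrow> alg_morphism A A (\<lambda>a. a)"
  unfolding alg_morphism_def
  by (auto simp: linear_map_id ring_hom_def hmap_id braided_algebraD coact_closed)

lemma alg_morphism_compose:
  assumes A: "braided_algebra R A" and B: "braided_algebra R B" and C: "braided_algebra R C"
    and f: "alg_morphism A B f" and g: "alg_morphism B C g"
  shows "alg_morphism A C (\<lambda>a. g (f a))"
  unfolding alg_morphism_def
proof (intro conjI ballI)
  note fD = alg_morphismD[OF f] and gD = alg_morphismD[OF g]
  note v = braided_algebraD(1)[OF A] braided_algebraD(1)[OF B] braided_algebraD(1)[OF C]
  show "linear_map A C (\<lambda>a. g (f a))" by (rule linear_map_compose[OF fD(1) gD(1)])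
  show "(\<lambda>a. g (f a)) \<in> ring_hom A C" using ring_hom_trans[OF fD(2) gD(2)] by (simp add: comp_def)
  fix a assume a: "a \<in> carrier A"
  show "coact C (g (f a)) = hmap C (\<lambda>a. g (f a)) (coact A a)"
    by (simp add: fD(3)[OF a] gD(3) linear_mapD[OF fD(1)] a hmap_hmap[OF v fD(1) gD(1)
        coact_closed[OF A a]])
qed

lemma alg_category_simps [simp]:
  "obj (alg_category R) = {A. braided_algebra R A}"
  "(A, \<phi>, B) \<in> arr (alg_category R) \<longleftrightarrow> braided_algebra R A \<and> braided_algebra R B
      \<and> alg_morphism A B \<phi> \<and> \<phi> \<in> extensional (carrier A)"
  "src (alg_category R) = fst" "tgt (alg_category R) = snd \<circ> snd"
  "ident (alg_category R) A = (A, \<lambda>a\<in>carrier A. a, A)"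
  "cmp (alg_category R) (B', \<psi>, C) (A, \<phi>, B) = (A, compose (carrier A) \<psi> \<phi>, C)"
  by (simp_all add: alg_category_def)

lemma alg_category_category:
  fixes R :: "('k::field, 'n::finite) torus_form"
  shows "is_category (alg_category R :: (('k, 'n, 'u) comod_alg, ('k, 'n, 'u) alg_arrow) category)"
proof -
  have i: "alg_morphism A A (\<lambda>a\<in>carrier A. a)" if "braided_algebra R A" for A :: "('k, 'n, 'u)
      comod_alg"
    by (rule alg_morphism_cong[OF that that alg_morphism_id[OF that]]) simp
  have c: "alg_morphism A C (\<lambda>a\<in>carrier A. g (f a))"
    if "braided_algebra R A" "braided_algebra R B" "braided_algebra R C" "alg_morphism A B f"
        "alg_morphism B C g"
    for A B C :: "('k, 'n, 'u) comod_alg" and f g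
    by (rule alg_morphism_cong[OF that(1,3) alg_morphism_compose[OF that]]) simp
  have cl: "f a \<in> carrier B" if "alg_morphism A B f" "a \<in> carrier A"
    for A B :: "('k, 'n, 'u) comod_alg" and f a
    using alg_morphismD(1)[OF that(1)] that(2) by (rule linear_mapD)
  show ?thesis
    unfolding is_category_def homset_def
    by (auto simp: i c compose_def fun_eq_iff extensional_def cl)
qed

lemma space_category_category: "is_category (space_category R)"
  unfolding space_category_def fp_alg_category_def
  by (intro opp_category full_subcategory_category alg_category_category)

lemma space_category_arr:
  "(A, \<phi>, B) \<in> arr (space_category R) \<longleftrightarrow> braided_algebra R A \<and> braided_algebra R B
     \<and> finitely_presented R A \<and> finitely_presented R B
     \<and> alg_morphism A B \<phi> \<and> \<phi> \<in> extensional (carrier A)"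
  by (auto simp: space_category_def fp_alg_category_def)

lemma space_category_simps:
  "obj (space_category R) = {A. braided_algebra R A \<and> finitely_presented R A}"
  "src (space_category R) (A, \<phi>, B) = B" "tgt (space_category R) (A, \<phi>, B) = A"
  "cmp (space_category R) (A, \<phi>, B) (B', \<psi>, C) = (A, compose (carrier A) \<psi> \<phi>, C)"
  by (auto simp: space_category_def fp_alg_category_def)

section \<open>Gluing over localizations at central elements\<close>

definition central :: "('a, 'm) ring_scheme \<Rightarrow> 'a \<Rightarrow> bool" where
  "central A s \<longleftrightarrow> s \<in> carrier A \<and> (\<forall>a\<in>carrier A. a \<otimes>\<^bsub>A\<^esub> s = s \<otimes>\<^bsub>A\<^esub> a)"

section \<open>Central elements and unimodular families\<close>

context ring
begin

lemma centralD: "central R s \<Longrightarrow> s \<in> carrier R" "central R s \<Longrightarrow> a \<in> carrier R \<Longrightarrow> a \<otimes> s = s \<otimes> a"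
  by (simp_all add: central_def)

lemma central_lcomm:
  assumes "central R s" "a \<in> carrier R" "b \<in> carrier R"
  shows "a \<otimes> (s \<otimes> b) = s \<otimes> (a \<otimes> b)"
proof -
  have "a \<otimes> (s \<otimes> b) = (a \<otimes> s) \<otimes> b" using assms centralD(1)[OF assms(1)] by (simp add: m_assoc)
  also have "\<dots> = s \<otimes> (a \<otimes> b)"
    unfolding centralD(2)[OF assms(1,2)] using assms centralD(1)[OF assms(1)] by (simp add: m_assoc)
  finally show ?thesis .
qed

lemma central_mult: "central R s \<Longrightarrow> central R t \<Longrightarrow> central R (s \<otimes> t)"
  unfolding central_def[of _ "s \<otimes> t"]
proof (intro conjI ballI)
  assume s: "central R s" and t: "central R t"
  note c = centralD(1)[OF s] centralD(1)[OF t]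
  then show "s \<otimes> t \<in> carrier R" by simp
  fix a assume a: "a \<in> carrier R"
  have "a \<otimes> (s \<otimes> t) = s \<otimes> (a \<otimes> t)" by (rule central_lcomm[OF s a c(2)])
  then show "a \<otimes> (s \<otimes> t) = (s \<otimes> t) \<otimes> a"
    unfolding centralD(2)[OF t a] using a c by (simp add: m_assoc)
qed

lemma central_pow: "central R s \<Longrightarrow> central R (s [^] (n::nat))"
proof (induction n)
  case 0 then show ?case by (simp add: central_def)
next
  case (Suc n) then show ?case by (simp add: central_mult)
qed

text \<open>One exponent is raised at a time. In \<one> = \<Sum> c i t i the summand c j t j is
  multiplied by the relation already found for the exponent n, and centrality of t j gathers one
  more power of it. All coefficients stay on the left, since they need not commute with each
  other.\<close>

lemma unimodular_pow_one:
  assumes I: "finite I" "j \<in> I" and t: "\<And>i. i \<in> I \<Longrightarrow> central R (t i)"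
    and c: "c \<in> I \<rightarrow> carrier R" and one: "(\<Oplus>i\<in>I. c i \<otimes> t i) = \<one>"
  shows "\<exists>d \<in> I \<rightarrow> carrier R. (\<Oplus>i\<in>I - {j}. d i \<otimes> t i) \<oplus> d j \<otimes> t j [^] (n::nat) = \<one>"
proof (induction n)
  case 0
  \<comment> \<open>For exponent 0 the power of t j is \<one>, so the coefficient \<one> at j and
    \<zero> elsewhere will do.\<close>
  have "(\<Oplus>i\<in>I - {j}. (if i = j then \<one> else \<zero>) \<otimes> t i) = (\<Oplus>i\<in>I - {j}. \<zero>)"
    by (rule finsum_cong') (use t centralD in auto)
  then show ?case by (intro bexI[of _ "\<lambda>i. if i = j then \<one> else \<zero>"]) auto
next
  case (Suc n)
  then obtain d where d: "d \<in> I \<rightarrow> carrier R"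
    and dn: "(\<Oplus>i\<in>I - {j}. d i \<otimes> t i) \<oplus> d j \<otimes> t j [^] n = \<one>" by blast
  have tc: "t i \<in> carrier R" if "i \<in> I" for i using t that centralD by blast
  have cc: "c i \<in> carrier R" "d i \<in> carrier R" if "i \<in> I" for i using that c d by auto
  note [simp] = tc cc I
  \<comment> \<open>These are the coefficients of t i and of the new power of t j after expanding
    \<Sum>(i \<noteq> j) c i t i + c j t j (\<Sum>(i \<noteq> j) d i t i + d j t j ^ n).\<close>
  let ?e = "\<lambda>i. if i = j then c j \<otimes> d j else c i \<oplus> c j \<otimes> t j \<otimes> d i"
  let ?l = "\<Oplus>i\<in>I - {j}. c i \<otimes> t i" and ?l' = "\<Oplus>i\<in>I - {j}. d i \<otimes> t i"
  have lc: "?l \<in> carrier R" "?l' \<in> carrier R" by (auto intro!: finsum_closed)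
  have "I = insert j (I - {j})" using I by auto
  then have "(\<Oplus>i\<in>I. c i \<otimes> t i) = (\<Oplus>i\<in>insert j (I - {j}). c i \<otimes> t i)" by simp
  also have "\<dots> = c j \<otimes> t j \<oplus> ?l" by (rule finsum_insert) auto
  finally have one': "?l \<oplus> c j \<otimes> t j = \<one>" using one lc by (simp add: a_comm)
  have "(\<Oplus>i\<in>I - {j}. ?e i \<otimes> t i) = (\<Oplus>i\<in>I - {j}. c i \<otimes> t i \<oplus> (c j \<otimes> t j) \<otimes> (d i \<otimes> t i))"
    by (rule finsum_cong') (auto simp: l_distr m_assoc)
  also have "\<dots> = ?l \<oplus> (\<Oplus>i\<in>I - {j}. (c j \<otimes> t j) \<otimes> (d i \<otimes> t i))"
    by (rule finsum_addf) auto
  also have "\<dots> = ?l \<oplus> (c j \<otimes> t j) \<otimes> ?l'"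
    by (subst finsum_rdistr) auto
  finally have e1: "(\<Oplus>i\<in>I - {j}. ?e i \<otimes> t i) = ?l \<oplus> (c j \<otimes> t j) \<otimes> ?l'" .
  have "?e j \<otimes> t j [^] Suc n = c j \<otimes> (d j \<otimes> t j [^] n \<otimes> t j)"
    by (simp add: m_assoc)
  also have "d j \<otimes> t j [^] n \<otimes> t j = t j \<otimes> (d j \<otimes> t j [^] n)"
    by (rule centralD(2)[OF t]) auto
  finally have e2: "?e j \<otimes> t j [^] Suc n = (c j \<otimes> t j) \<otimes> (d j \<otimes> t j [^] n)"
    by (simp add: m_assoc)
  have "(\<Oplus>i\<in>I - {j}. ?e i \<otimes> t i) \<oplus> ?e j \<otimes> t j [^] Suc n
      = ?l \<oplus> (c j \<otimes> t j) \<otimes> (?l' \<oplus> d j \<otimes> t j [^] n)"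
    unfolding e1 e2 using lc by (simp add: r_distr a_assoc)
  also have "\<dots> = \<one>" by (simp add: dn one')
  finally show ?case by (intro bexI[of _ ?e]) auto
qed

text \<open>Induction over the set T of indices whose exponent has already been raised. The
  intermediate families mix t i ^ n and t i, and they remain central, so the previous lemma applies
  to the next index.\<close>

lemma unimodular_pow:
  assumes I: "finite I" and t: "\<And>i. i \<in> I \<Longrightarrow> central R (t i)"
    and c: "c \<in> I \<rightarrow> carrier R" and one: "(\<Oplus>i\<in>I. c i \<otimes> t i) = \<one>"
  shows "\<exists>d \<in> I \<rightarrow> carrier R. (\<Oplus>i\<in>I. d i \<otimes> t i [^] (n::nat)) = \<one>"
proof -
  have "\<exists>d \<in> I \<rightarrow> carrier R. (\<Oplus>i\<in>I. d i \<otimes> (if i \<in> T then t i [^] n else t i)) = \<one>"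
    if "finite T" "T \<subseteq> I" for T
    using that
  proof (induction T rule: finite_induct)
    case empty then show ?case using c one by auto
  next
    case (insert j T)
    let ?u = "\<lambda>i. if i \<in> T then t i [^] n else t i"
    let ?v = "\<lambda>i. if i \<in> insert j T then t i [^] n else t i"
    from insert obtain d where d: "d \<in> I \<rightarrow> carrier R" "(\<Oplus>i\<in>I. d i \<otimes> ?u i) = \<one>" by auto
    have j: "j \<in> I" using insert by auto
    have u: "central R (?u i)" if "i \<in> I" for i using t that central_pow by auto
    from unimodular_pow_one[OF I j u d] obtain e where e: "e \<in> I \<rightarrow> carrier R"
      and one: "(\<Oplus>i\<in>I - {j}. e i \<otimes> ?u i) \<oplus> e j \<otimes> ?u j [^] n = \<one>" by blast
    have uc: "?u i \<in> carrier R" if "i \<in> I" for i using u[OF that] centralD by blast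
    have vc: "?v i \<in> carrier R" if "i \<in> I" for i using t[OF that] centralD by auto
    have ec: "e i \<in> carrier R" if "i \<in> I" for i using e that by auto
    have evc: "e i \<otimes> ?v i \<in> carrier R" if "i \<in> I" for i
      by (rule m_closed[OF ec[OF that] vc[OF that]])
    have tj: "e j \<otimes> ?u j [^] n \<in> carrier R" using ec[OF j] uc[OF j] by (intro m_closed
        nat_pow_closed)
    have "I = insert j (I - {j})" using j by auto
    then have "(\<Oplus>i\<in>I. e i \<otimes> ?v i) = (\<Oplus>i\<in>insert j (I - {j}). e i \<otimes> ?v i)" by simp
    also have "\<dots> = e j \<otimes> ?v j \<oplus> (\<Oplus>i\<in>I - {j}. e i \<otimes> ?v i)"
      by (rule finsum_insert) (use I j evc in \<open>blast+\<close>)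
    also have "(\<Oplus>i\<in>I - {j}. e i \<otimes> ?v i) = (\<Oplus>i\<in>I - {j}. e i \<otimes> ?u i)"
      by (rule finsum_cong') (use ec uc in auto)
    also have "e j \<otimes> ?v j = e j \<otimes> ?u j [^] n" using insert by simp
    also have "e j \<otimes> ?u j [^] n \<oplus> (\<Oplus>i\<in>I - {j}. e i \<otimes> ?u i) = \<one>"
      unfolding one[symmetric] by (rule a_comm[OF tj finsum_closed]) (use ec uc in auto)
    finally show ?case using e by blast
  qed
  from this[OF I order_refl] obtain d where d: "d \<in> I \<rightarrow> carrier R"
    and one: "(\<Oplus>i\<in>I. d i \<otimes> (if i \<in> I then t i [^] n else t i)) = \<one>" by blast
  have "(\<Oplus>i\<in>I. d i \<otimes> t i [^] n) = (\<Oplus>i\<in>I. d i \<otimes> (if i \<in> I then t i [^] n else t i))"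
    by (rule finsum_cong') (use d t centralD in auto)
  then show ?thesis using d one by auto
qed

end

text \<open>The features of a classical localization on which gluing rests: elements of the kernel
  are killed by powers of s, every element of B becomes an image after multiplication by a power of
  f s, and f s has a left inverse. Only ring operations are mentioned, so an isomorphic copy of
  A[s^-1] qualifies directly.\<close>

definition is_loc :: "('a, 'm) ring_scheme \<Rightarrow> ('b, 'n) ring_scheme \<Rightarrow> ('a \<Rightarrow> 'b) \<Rightarrow> 'a \<Rightarrow> bool" where
  "is_loc A B f s \<longleftrightarrow> ring A \<and> ring B \<and> f \<in> ring_hom A B \<and> central A s
    \<and> (\<forall>a\<in>carrier A. f a = \<zero>\<^bsub>B\<^esub> \<longrightarrow> (\<exists>n::nat. s [^]\<^bsub>A\<^esub> n \<otimes>\<^bsub>A\<^esub> a = \<zero>\<^bsub>A\<^esub>))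
    \<and> (\<forall>b\<in>carrier B. \<exists>n::nat. \<exists>a\<in>carrier A. f s [^]\<^bsub>B\<^esub> n \<otimes>\<^bsub>B\<^esub> b = f a)
    \<and> (\<exists>y\<in>carrier B. y \<otimes>\<^bsub>B\<^esub> f s = \<one>\<^bsub>B\<^esub>)"

lemma is_locD:
  assumes "is_loc A B f s"
  shows "ring A" "ring B" "f \<in> ring_hom A B" "central A s"
    and "\<And>a. a \<in> carrier A \<Longrightarrow> f a = \<zero>\<^bsub>B\<^esub> \<Longrightarrow> \<exists>n::nat. s [^]\<^bsub>A\<^esub> n \<otimes>\<^bsub>A\<^esub> a = \<zero>\<^bsub>A\<^esub>"
    and "\<And>b. b \<in> carrier B \<Longrightarrow> \<exists>n::nat. \<exists>a\<in>carrier A. f s [^]\<^bsub>B\<^esub> n \<otimes>\<^bsub>B\<^esub> b = f a"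
  using assms by (auto simp: is_loc_def)

text \<open>Powers are taken off from the inside: one factor f s is moved to b, the induction
  hypothesis removes the rest, and the left inverse removes that factor. Hence the induction runs
  over all b, b' at once.\<close>

lemma is_loc_cancel:
  assumes l: "is_loc A B f s" and b: "b \<in> carrier B" "b' \<in> carrier B"
    and eq: "f s [^]\<^bsub>B\<^esub> (n::nat) \<otimes>\<^bsub>B\<^esub> b = f s [^]\<^bsub>B\<^esub> n \<otimes>\<^bsub>B\<^esub> b'"
  shows "b = b'"
proof -
  interpret B: ring B by (rule is_locD[OF l])
  have fs: "f s \<in> carrier B"
    using is_locD(3,4)[OF l] by (auto simp: central_def ring_hom_def)
  obtain y where y: "y \<in> carrier B" "y \<otimes>\<^bsub>B\<^esub> f s = \<one>\<^bsub>B\<^esub>" using l by (auto simp: is_loc_def)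
  show ?thesis using b eq
  proof (induction n arbitrary: b b')
    case 0 then show ?case by simp
  next
    case (Suc n)
    have "f s [^]\<^bsub>B\<^esub> n \<otimes>\<^bsub>B\<^esub> (f s \<otimes>\<^bsub>B\<^esub> x) = f s [^]\<^bsub>B\<^esub> Suc n \<otimes>\<^bsub>B\<^esub> x" if "x \<in> carrier B" for x
      using fs that by (simp add: B.m_assoc)
    then have "f s [^]\<^bsub>B\<^esub> n \<otimes>\<^bsub>B\<^esub> (f s \<otimes>\<^bsub>B\<^esub> b) = f s [^]\<^bsub>B\<^esub> n \<otimes>\<^bsub>B\<^esub> (f s \<otimes>\<^bsub>B\<^esub> b')"
      using Suc.prems by metis
    then have "f s \<otimes>\<^bsub>B\<^esub> b = f s \<otimes>\<^bsub>B\<^esub> b'"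
      by (rule Suc.IH[OF B.m_closed[OF fs Suc.prems(1)] B.m_closed[OF fs Suc.prems(2)]])
    moreover have "y \<otimes>\<^bsub>B\<^esub> (f s \<otimes>\<^bsub>B\<^esub> x) = x" if "x \<in> carrier B" for x
      using fs y that by (simp flip: B.m_assoc)
    ultimately show ?case using Suc.prems(1,2) by metis
  qed
qed

text \<open>The new exponent is the sum of those found so far rather than their maximum, which fits
  a closure condition of the form m + n.\<close>

lemma uniform_exponent:
  assumes "finite I" and "\<And>i. i \<in> I \<Longrightarrow> \<exists>n::nat. P i n"
    and "\<And>i m n. i \<in> I \<Longrightarrow> P i m \<Longrightarrow> P i (m + n)"
  shows "\<exists>n. \<forall>i\<in>I. P i n"
  using assms
proof (induction I rule: finite_induct)
  case (insert x F)
  have "\<exists>n. \<forall>i\<in>F. P i n"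
  proof (rule insert.IH)
    show "\<exists>n. P i n" if "i \<in> F" for i by (rule insert.prems(1)) (simp add: that)
    show "P i (m + n)" if "i \<in> F" "P i m" for i m n by (rule insert.prems(2)) (simp_all add: that)
  qed
  then obtain n where n: "\<forall>i\<in>F. P i n" by blast
  obtain m where m: "P x m" using insert.prems(1)[of x] by blast
  have "P x (m + n)" by (rule insert.prems(2)) (simp_all add: m)
  then have "P x (n + m)" by (simp only: add.commute)
  moreover have "P i (n + m)" if "i \<in> F" for i
    by (rule insert.prems(2)) (simp_all add: that n)
  ultimately show ?case by blast
qed simp

lemma ring_hom_pow:
  assumes "ring A" "ring B" "f \<in> ring_hom A B" "s \<in> carrier A"
  shows "f (s [^]\<^bsub>A\<^esub> (n::nat)) = f s [^]\<^bsub>B\<^esub> n"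
proof -
  interpret A: ring A by fact
  interpret B: ring B by fact
  show ?thesis using assms(3,4) by (induction n) (simp_all add: ring_hom_one ring_hom_mult)
qed

lemma ring_hom_diff:
  assumes "ring A" "ring B" "f \<in> ring_hom A B" "a \<in> carrier A" "b \<in> carrier A"
  shows "f (a \<ominus>\<^bsub>A\<^esub> b) = f a \<ominus>\<^bsub>B\<^esub> f b"
proof -
  interpret ring_hom_ring A B f using assms by (intro ring_hom_ringI2)
  show ?thesis using assms by (simp add: a_minus_def)
qed

text \<open>The difference of a and a' is killed by one common power of all the s i. These powers
  still generate the unit ideal, so the difference is killed by \<one>. In the empty case this reads
  \<one> = \<zero>.\<close>

lemma jointly_injective:
  fixes A (structure) and s :: "'i \<Rightarrow> 'a"
  assumes A: "ring A" and I: "finite I" and loc: "\<And>i. i \<in> I \<Longrightarrow> is_loc A (B i) (f i) (s i)"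
    and c: "c \<in> I \<rightarrow> carrier A" and one: "(\<Oplus>i\<in>I. c i \<otimes> s i) = \<one>"
    and a: "a \<in> carrier A" "a' \<in> carrier A" and eq: "\<And>i. i \<in> I \<Longrightarrow> f i a = f i a'"
  shows "a = a'"
proof -
  interpret A: ring A by fact
  have cs: "central A (s i)" if "i \<in> I" for i using is_locD(4)[OF loc[OF that]] .
  have sc: "s i \<in> carrier A" if "i \<in> I" for i using cs[OF that] A.centralD by blast
  let ?d = "a \<ominus> a'"
  have d: "?d \<in> carrier A" using a by simp
  have "\<exists>n::nat. s i [^] n \<otimes> ?d = \<zero>" if i: "i \<in> I" for i
  proof (rule is_locD(5)[OF loc[OF i] d])
    interpret B: ring "B i" by (rule is_locD[OF loc[OF i]])
    have "f i a' \<in> carrier (B i)" using is_locD(3)[OF loc[OF i]] a by (simp add: ring_hom_closed)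
    then show "f i ?d = \<zero>\<^bsub>B i\<^esub>"
      by (simp add: ring_hom_diff[OF A B.ring_axioms is_locD(3)[OF loc[OF i]]] a eq[OF i]
          B.r_right_minus_eq)
  qed
  then have "\<exists>n::nat. \<forall>i\<in>I. s i [^] n \<otimes> ?d = \<zero>"
  proof (intro uniform_exponent I)
    fix i and m n :: nat assume i: "i \<in> I" and z: "s i [^] m \<otimes> ?d = \<zero>"
    have "s i [^] (m + n) \<otimes> ?d = s i [^] n \<otimes> (s i [^] m \<otimes> ?d)"
      using sc[OF i] d by (simp add: A.nat_pow_mult add.commute flip: A.m_assoc)
    then show "s i [^] (m + n) \<otimes> ?d = \<zero>" using sc[OF i] z by simp
  qed
  then obtain n :: nat where n: "\<And>i. i \<in> I \<Longrightarrow> s i [^] n \<otimes> ?d = \<zero>" by blast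
  obtain e where e: "e \<in> I \<rightarrow> carrier A" "(\<Oplus>i\<in>I. e i \<otimes> s i [^] n) = \<one>"
    using A.unimodular_pow[OF I cs c one] by blast
  have ec: "e i \<in> carrier A" if "i \<in> I" for i using e that by auto
  have "?d = (\<Oplus>i\<in>I. e i \<otimes> s i [^] n) \<otimes> ?d" using d e by simp
  also have "\<dots> = (\<Oplus>i\<in>I. (e i \<otimes> s i [^] n) \<otimes> ?d)"
    by (rule A.finsum_ldistr) (use I d ec sc in auto)
  also have "\<dots> = (\<Oplus>i\<in>I. \<zero>)"
    by (rule A.finsum_cong') (use ec sc n d in \<open>auto simp: A.m_assoc\<close>)
  finally have "?d = \<zero>" by simp
  then show ?thesis using a by (simp add: A.r_right_minus_eq)
qed

text \<open>Write b i = x i / s i ^ n. On the overlap of i and j the cross products of the fractions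
  agree, hence they agree in A up to powers of s i and s j. After enlarging numerators and
  denominators by such powers they agree exactly, and combining the numerators with a partition of
  unity for the denominators gives the element. The maps h enter as homomorphisms that agree with g
  on what comes from A.\<close>

lemma glue_exists:
  fixes A (structure) and s :: "'i \<Rightarrow> 'a"
  assumes A: "ring A" and I: "finite I" and loc: "\<And>i. i \<in> I \<Longrightarrow> is_loc A (B i) (f i) (s i)"
    and c: "c \<in> I \<rightarrow> carrier A" and one: "(\<Oplus>i\<in>I. c i \<otimes> s i) = \<one>"
    and locg: "\<And>i j. i \<in> I \<Longrightarrow> j \<in> I \<Longrightarrow> is_loc (B i) (C i j) (g i j) (f i (s j))"
    and h: "\<And>i j. i \<in> I \<Longrightarrow> j \<in> I \<Longrightarrow> h i j \<in> ring_hom (B j) (C i j)"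
    and gh: "\<And>i j a. i \<in> I \<Longrightarrow> j \<in> I \<Longrightarrow> a \<in> carrier A \<Longrightarrow> g i j (f i a) = h i j (f j a)"
    and b: "\<And>i. i \<in> I \<Longrightarrow> b i \<in> carrier (B i)"
    and eq: "\<And>i j. i \<in> I \<Longrightarrow> j \<in> I \<Longrightarrow> g i j (b i) = h i j (b j)"
  shows "\<exists>a\<in>carrier A. \<forall>i\<in>I. f i a = b i"
proof -
  interpret A: ring A by fact
  have cs: "central A (s i)" if "i \<in> I" for i using is_locD(4)[OF loc[OF that]] .
  have sc [simp]: "s i \<in> carrier A" if "i \<in> I" for i using cs[OF that] A.centralD by blast
  note csp = A.central_pow[OF cs]
  have comm: "s i [^] m \<otimes> (s j [^] n \<otimes> x) = s j [^] n \<otimes> (s i [^] m \<otimes> x)"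
    if "i \<in> I" "j \<in> I" "x \<in> carrier A" for i j x and m n :: nat
    using that by (intro A.central_lcomm csp) auto
  have padd: "s i [^] (m + n) \<otimes> x = s i [^] m \<otimes> (s i [^] n \<otimes> x)"
    if "i \<in> I" "x \<in> carrier A" for i x and m n :: nat
    using that by (simp add: A.nat_pow_mult flip: A.m_assoc)
  have fr: "ring (B i)" "f i \<in> ring_hom A (B i)" if "i \<in> I" for i
    using is_locD[OF loc[OF that]] by auto
  have gr: "ring (C i j)" "g i j \<in> ring_hom (B i) (C i j)" if "i \<in> I" "j \<in> I" for i j
    using is_locD[OF locg[OF that]] by auto
  have fcl [simp]: "f i x \<in> carrier (B i)" if "i \<in> I" "x \<in> carrier A" for i x
    using fr(2)[OF that(1)] that(2) by (rule ring_hom_closed)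
  have fpow: "f i (s j [^] n) = f i (s j) [^]\<^bsub>B i\<^esub> n" if "i \<in> I" "j \<in> I" for i j and n :: nat
    using that by (intro ring_hom_pow A fr) auto

  \<comment> \<open>A common exponent for all denominators; a larger exponent is always possible
    because the numerator can be multiplied by the missing power of s i.\<close>
  have "\<exists>n::nat. \<forall>i\<in>I. \<exists>a\<in>carrier A. f i (s i [^] n) \<otimes>\<^bsub>B i\<^esub> b i = f i a"
  proof (rule uniform_exponent[OF I])
    fix i assume i: "i \<in> I"
    show "\<exists>n::nat. \<exists>a\<in>carrier A. f i (s i [^] n) \<otimes>\<^bsub>B i\<^esub> b i = f i a"
      using is_locD(6)[OF loc[OF i] b[OF i]] by (simp add: fpow i)
    fix m n :: nat assume "\<exists>a\<in>carrier A. f i (s i [^] m) \<otimes>\<^bsub>B i\<^esub> b i = f i a"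
    then obtain a where a: "a \<in> carrier A" "f i (s i [^] m) \<otimes>\<^bsub>B i\<^esub> b i = f i a" by blast
    interpret B: ring "B i" using fr[OF i] by simp
    have "f i (s i [^] (n + m)) \<otimes>\<^bsub>B i\<^esub> b i = f i (s i [^] n) \<otimes>\<^bsub>B i\<^esub> (f i (s i [^] m) \<otimes>\<^bsub>B i\<^esub> b i)"
      using i b by (simp add: A.nat_pow_mult[symmetric] ring_hom_mult[OF fr(2)[OF i]] B.m_assoc)
    also have "\<dots> = f i (s i [^] n \<otimes> a)"
      unfolding a(2) using i a by (simp add: ring_hom_mult[OF fr(2)[OF i]])
    finally show "\<exists>a\<in>carrier A. f i (s i [^] (m + n)) \<otimes>\<^bsub>B i\<^esub> b i = f i a"
      using i a by (intro bexI[of _ "s i [^] n \<otimes> a"]) (auto simp: add.commute)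
  qed
  then obtain n :: nat and x where x: "\<And>i. i \<in> I \<Longrightarrow> x i \<in> carrier A"
    and fx: "\<And>i. i \<in> I \<Longrightarrow> f i (s i [^] n) \<otimes>\<^bsub>B i\<^esub> b i = f i (x i)" by metis

  \<comment> \<open>With b i read as x i / s i ^ n, the terms \<open>?p i j\<close> and
    \<open>?p j i\<close> are the two cross products of the fractions at i and j. The predicate
    \<open>?E\<close> says that they agree after multiplication by the k-th powers of s i and s
    j.\<close>
  let ?p = "\<lambda>i j. s j [^] n \<otimes> x i"
  let ?E = "\<lambda>(i, j) (k::nat). s i [^] k \<otimes> (s j [^] k \<otimes> ?p i j) = s i [^] k \<otimes> (s j [^] k \<otimes> ?p j i)"
  have Emono: "?E (i, j) (m + k)" if "i \<in> I" "j \<in> I" "?E (i, j) m" for i j and m k :: nat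
  proof -
    have "s i [^] (m + k) \<otimes> (s j [^] (m + k) \<otimes> y) = s i [^] k \<otimes> (s j [^] k \<otimes> (s i [^] m \<otimes> (s j [^]
        m \<otimes> y)))"
      if "y \<in> carrier A" for y
      using that \<open>i \<in> I\<close> \<open>j \<in> I\<close> by (simp add: add.commute[of m] padd comm[of i j])
    then show ?thesis using that x by simp
  qed
  have "\<exists>k. \<forall>ij\<in>I \<times> I. ?E ij k"
  proof (rule uniform_exponent[where P = ?E])
    fix ij :: "'i \<times> 'i" assume "ij \<in> I \<times> I"
    then obtain i j where ij: "ij = (i, j)" "i \<in> I" "j \<in> I" by auto
    let ?d = "?p i j \<ominus> ?p j i"
    interpret Bi: ring "B i" using fr[OF ij(2)] by simp
    interpret Bj: ring "B j" using fr[OF ij(3)] by simp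
    interpret Cij: ring "C i j" using gr[OF ij(2,3)] by simp
    \<comment> \<open>By \<open>gh\<close> this map factors through B i as well as through B j, so
      both x i and x j can be expressed in C i j by the single element
      \<open>g i j (b i)\<close>.\<close>
    define G where "G = (\<lambda>a. g i j (f i a))"
    have Gh: "G a = h i j (f j a)" if "a \<in> carrier A" for a unfolding G_def using gh ij that by
        blast
    have G: "G \<in> ring_hom A (C i j)"
      using ring_hom_trans[OF fr(2)[OF ij(2)] gr(2)[OF ij(2,3)]] by (simp add: G_def comp_def)
    note Gm = ring_hom_mult[OF G] and Gc = ring_hom_closed[OF G]
    have gb: "g i j (b i) \<in> carrier (C i j)" using gr(2)[OF ij(2,3)] b[OF ij(2)] by (rule
        ring_hom_closed)
    have G1: "G (x i) = G (s i [^] n) \<otimes>\<^bsub>C i j\<^esub> g i j (b i)"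
      unfolding G_def fx[OF ij(2), symmetric] using ij b
      by (intro ring_hom_mult[OF gr(2)]) auto
    have G2: "G (x j) = G (s j [^] n) \<otimes>\<^bsub>C i j\<^esub> g i j (b i)"
    proof -
      have "G (x j) = h i j (f j (s j [^] n) \<otimes>\<^bsub>B j\<^esub> b j)"
        using Gh[OF x[OF ij(3)]] fx[OF ij(3)] by simp
      also have "\<dots> = h i j (f j (s j [^] n)) \<otimes>\<^bsub>C i j\<^esub> h i j (b j)"
        using ij b by (intro ring_hom_mult[OF h]) auto
      finally show ?thesis using Gh[of "s j [^] n"] eq[OF ij(2,3)] ij by simp
    qed
    have "G (?p i j) = G (?p j i)"
    proof -
      have "G (?p i j) = G (s j [^] n \<otimes> s i [^] n) \<otimes>\<^bsub>C i j\<^esub> g i j (b i)"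
        using ij x gb by (simp add: Gm G1 Gc Cij.m_assoc)
      also have "s j [^] n \<otimes> s i [^] n = s i [^] n \<otimes> s j [^] n"
        by (rule A.centralD(2)[OF csp]) (use ij in auto)
      also have "G (s i [^] n \<otimes> s j [^] n) \<otimes>\<^bsub>C i j\<^esub> g i j (b i) = G (?p j i)"
        using ij x gb by (simp add: Gm G2 Gc Cij.m_assoc)
      finally show ?thesis .
    qed
    then have "g i j (f i ?d) = \<zero>\<^bsub>C i j\<^esub>"
      using ring_hom_diff[OF A Cij.ring_axioms G, of "?p i j" "?p j i"] ij x Gc[of "?p j i"]
      by (simp add: G_def Cij.r_right_minus_eq)
    \<comment> \<open>Vanishing in C i j is traced back to A in two stages: a power of s j suffices
      to get zero in B i, and then a power of s i to get zero in A.\<close>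
    then obtain k :: nat where "f i (s j) [^]\<^bsub>B i\<^esub> k \<otimes>\<^bsub>B i\<^esub> f i ?d = \<zero>\<^bsub>B i\<^esub>"
      using is_locD(5)[OF locg[OF ij(2,3)], of "f i ?d"] ij x by auto
    then have "f i (s j [^] k \<otimes> ?d) = \<zero>\<^bsub>B i\<^esub>"
      using ij x by (simp add: ring_hom_mult[OF fr(2)[OF ij(2)]] fpow)
    then obtain l :: nat where l: "s i [^] l \<otimes> (s j [^] k \<otimes> ?d) = \<zero>"
      using is_locD(5)[OF loc[OF ij(2)], of "s j [^] k \<otimes> ?d"] ij x by auto
    \<comment> \<open>Both exponents are raised to k + l, because \<open>?E\<close> has one exponent
      for the two factors.\<close>
    have "s i [^] (k + l) \<otimes> (s j [^] (l + k) \<otimes> ?d)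
      = s i [^] k \<otimes> (s j [^] l \<otimes> (s i [^] l \<otimes> (s j [^] k \<otimes> ?d)))"
      using ij x by (simp add: padd comm[of i j])
    also have "\<dots> = \<zero>" using ij unfolding l by simp
    finally have z: "s i [^] (k + l) \<otimes> (s j [^] (k + l) \<otimes> ?d) = \<zero>" by (simp add: add.commute)
    have dist: "u \<otimes> (v \<ominus> w) = u \<otimes> v \<ominus> u \<otimes> w"
      if "u \<in> carrier A" "v \<in> carrier A" "w \<in> carrier A" for u v w
      using that by (simp add: a_minus_def A.r_distr A.r_minus)
    have "?E ij (k + l)" using z ij x by (simp add: dist A.r_right_minus_eq)
    then show "\<exists>k. ?E ij k" by blast
  next
    show "?E ij (m + k)" if "ij \<in> I \<times> I" "?E ij m" for ij m k
      using Emono that by (cases ij) blast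
  qed (use I in simp)
  then obtain k :: nat where k: "\<And>i j. i \<in> I \<Longrightarrow> j \<in> I \<Longrightarrow> ?E (i, j) k" by blast

  \<comment> \<open>The fraction b i is expanded by s i ^ k, so that its denominator becomes s i ^
    (n + k). For the new numerators the cross products agree in A without further factors.\<close>
  define y where "y i = s i [^] k \<otimes> x i" for i
  have y [simp]: "y i \<in> carrier A" if "i \<in> I" for i using that x by (simp add: y_def)
  have fy: "f i (s i [^] (n + k)) \<otimes>\<^bsub>B i\<^esub> b i = f i (y i)" if i: "i \<in> I" for i
  proof -
    interpret B: ring "B i" using fr[OF i] by simp
    have "f i (s i [^] (k + n)) \<otimes>\<^bsub>B i\<^esub> b i = f i (s i [^] k) \<otimes>\<^bsub>B i\<^esub> (f i (s i [^] n) \<otimes>\<^bsub>B i\<^esub> b i)"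
      using i b by (simp add: A.nat_pow_mult[symmetric] ring_hom_mult[OF fr(2)[OF i]] B.m_assoc)
    also have "\<dots> = f i (y i)"
      unfolding fx[OF i] y_def using i x by (simp add: ring_hom_mult[OF fr(2)[OF i]])
    finally show ?thesis by (simp add: add.commute)
  qed
  have yy: "s j [^] (n + k) \<otimes> y i = s i [^] (n + k) \<otimes> y j" if ij: "i \<in> I" "j \<in> I" for i j
  proof -
    have "s j [^] (n + k) \<otimes> y i = s i [^] k \<otimes> (s j [^] k \<otimes> ?p i j)"
      using ij x by (simp add: y_def padd add.commute[of n] comm[of i j])
    also have "\<dots> = s i [^] k \<otimes> (s j [^] k \<otimes> ?p j i)"
      using k[OF ij] by simp
    also have "\<dots> = s i [^] (n + k) \<otimes> y j"
      using ij x by (simp add: y_def padd add.commute[of n] comm[of j i])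
    finally show ?thesis .
  qed
  obtain e where e: "e \<in> I \<rightarrow> carrier A" "(\<Oplus>i\<in>I. e i \<otimes> s i [^] (n + k)) = \<one>"
    using A.unimodular_pow[OF I cs c one] by blast
  have ec [simp]: "e i \<in> carrier A" if "i \<in> I" for i using e that by auto
  \<comment> \<open>A solution a must satisfy s i ^ (n + k) a = y i at least locally; weighting with
    e i and summing against \<one> = \<Sum> e i s i ^ (n + k) suggests this element.\<close>
  define a where "a = (\<Oplus>i\<in>I. e i \<otimes> y i)"
  have a: "a \<in> carrier A" unfolding a_def by (rule A.finsum_closed) auto
  \<comment> \<open>By agreement of the cross products, s j ^ (n + k) y i can be replaced by s i ^
    (n + k) y j, and then y j factors out of the partition of unity.\<close>
  have "s j [^] (n + k) \<otimes> a = y j" if j: "j \<in> I" for j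
  proof -
    have "s j [^] (n + k) \<otimes> a = (\<Oplus>i\<in>I. s j [^] (n + k) \<otimes> (e i \<otimes> y i))"
      unfolding a_def by (rule A.finsum_rdistr) (use I j in auto)
    also have "\<dots> = (\<Oplus>i\<in>I. (e i \<otimes> s i [^] (n + k)) \<otimes> y j)"
    proof (rule A.finsum_cong')
      fix i assume i: "i \<in> I"
      have "s j [^] (n + k) \<otimes> (e i \<otimes> y i) = e i \<otimes> (s j [^] (n + k) \<otimes> y i)"
        by (rule A.central_lcomm[OF csp, symmetric]) (use i j in auto)
      then show "s j [^] (n + k) \<otimes> (e i \<otimes> y i) = (e i \<otimes> s i [^] (n + k)) \<otimes> y j"
        unfolding yy[OF i j] using i j by (simp add: A.m_assoc)
    qed (use j in auto)
    also have "\<dots> = (\<Oplus>i\<in>I. e i \<otimes> s i [^] (n + k)) \<otimes> y j"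
      by (rule A.finsum_ldistr[symmetric]) (use I j in auto)
    finally show ?thesis using e j by simp
  qed
  then have sa: "f j (s j [^] (n + k) \<otimes> a) = f j (y j)" if "j \<in> I" for j
    using that by simp
  have "f j a = b j" if j: "j \<in> I" for j
  proof (rule is_loc_cancel[OF loc[OF j] fcl[OF j a] b[OF j]])
    have "f j (s j [^] (n + k)) \<otimes>\<^bsub>B j\<^esub> f j a = f j (s j [^] (n + k) \<otimes> a)"
      by (rule ring_hom_mult[OF fr(2)[OF j], symmetric]) (use a j in auto)
    also have "\<dots> = f j (s j [^] (n + k)) \<otimes>\<^bsub>B j\<^esub> b j"
      unfolding sa[OF j] by (rule fy[OF j, symmetric])
    finally show "f j (s j) [^]\<^bsub>B j\<^esub> (n + k) \<otimes>\<^bsub>B j\<^esub> f j a = f j (s j) [^]\<^bsub>B j\<^esub> (n + k) \<otimes>\<^bsub>B j\<^esub> b j"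
      unfolding fpow[OF j j] .
  qed
  then show ?thesis using a by blast
qed

section \<open>Central elements and coproducts\<close>

lemma linear_map_add:
  assumes U: "vspace U" and F: "linear_map V U F" and G: "linear_map V U G"
  shows "linear_map V U (\<lambda>x. F x \<oplus>\<^bsub>U\<^esub> G x)"
proof -
  interpret U: abelian_group U by (rule vspaceD) fact
  show ?thesis
    by (rule linear_mapI)
      (simp_all add: linear_mapD[OF F] linear_mapD[OF G] vspaceD[OF U] U.a_ac)
qed

lemma linear_map_smult:
  assumes U: "vspace U" and F: "linear_map V U F"
  shows "linear_map V U (\<lambda>x. c \<odot>\<^bsub>U\<^esub> F x)"
  by (rule linear_mapI)
    (simp_all add: linear_mapD[OF F] vspaceD[OF U] mult.commute flip: vspaceD(5)[OF U])

section \<open>Linear maps out of H\<close>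

lemma torus_linear_eqI:
  fixes h :: "('k::field, 'n::finite) torus"
  assumes U: "vspace U" and f: "linear_map torus_module U f" and g: "linear_map torus_module U g"
    and eq: "\<And>m :: int ^ 'n. f (tmon m) = g (tmon m)"
  shows "f h = g h"
proof -
  interpret U: abelian_group U by (rule vspaceD) fact
  let ?K = "Poly_Mapping.keys h" and ?c = "\<lambda>m. pscale (Poly_Mapping.lookup h m) (tmon m)"
  have h: "h = finsum torus_module ?c ?K"
    by (simp add: finsum_torus tmon_def poly_mapping_expand)
  have "f (?c m) = g (?c m)" for m
    using linear_mapD(3)[OF f, of "tmon m"] linear_mapD(3)[OF g, of "tmon m"] by (simp add: eq)
  then have "(\<Oplus>\<^bsub>U\<^esub>m\<in>?K. f (?c m)) = (\<Oplus>\<^bsub>U\<^esub>m\<in>?K. g (?c m))" by simp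
  then show ?thesis
    using linear_map_finsum[OF torus_vspace U f, of ?c ?K] linear_map_finsum[OF torus_vspace U g,
        of ?c ?K] h
    by simp
qed

lemma torus_counit_superset:
  assumes "finite S" "Poly_Mapping.keys h \<subseteq> S"
  shows "torus_counit h = (\<Sum>m\<in>S. Poly_Mapping.lookup h m)"
  unfolding torus_counit_def using assms by (intro sum.mono_neutral_left) (auto simp: in_keys_iff)

lemma torus_counit_linear:
  "linear_map (torus_module :: ('k::field, ('k, 'n::finite) torus) module) field_module
      torus_counit"
proof (rule linear_mapI)
  fix h g :: "('k, 'n) torus"
  let ?S = "Poly_Mapping.keys h \<union> Poly_Mapping.keys g"
  have "torus_counit (h + g) = (\<Sum>m\<in>?S. Poly_Mapping.lookup h m + Poly_Mapping.lookup g m)"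
    by (subst torus_counit_superset[of ?S]) (use keys_add[of h g] in \<open>auto simp: lookup_add\<close>)
  then show "torus_counit (h \<oplus>\<^bsub>torus_module\<^esub> g) = torus_counit h \<oplus>\<^bsub>field_module\<^esub> torus_counit g"
    by (simp add: sum.distrib torus_counit_superset[of ?S])
  show "torus_counit (c \<odot>\<^bsub>torus_module\<^esub> h) = c \<odot>\<^bsub>field_module\<^esub> torus_counit h" for c
    unfolding torus_module_simps field_module_simps torus_counit_superset[OF finite_keys
        keys_pscale]
    by (simp add: sum_distrib_left torus_counit_def)
qed simp

text \<open>The contraction of the H-factor by \<epsilon>. By the counit axiom it returns v from the
  coaction of v, which is how coactions disappear from the products below.\<close>

lemma counit_contraction:
  assumes V: "vspace V"
  shows counit_linear: "linear_map (tensor torus_module V) V (tlift V (\<lambda>h v. torus_counit h \<odot>\<^bsub>V\<^esub>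
      v))"
    and counit_tens: "\<And>h v. v \<in> carrier V \<Longrightarrow>
      tlift V (\<lambda>h v. torus_counit h \<odot>\<^bsub>V\<^esub> v) (tens torus_module V h v) = torus_counit h \<odot>\<^bsub>V\<^esub> v"
proof -
  have b: "bilin torus_module V V (\<lambda>h v. torus_counit h \<odot>\<^bsub>V\<^esub> v)"
    by (intro bilinI linear_mapI)
      (simp_all add: linear_mapD(2,3)[OF torus_counit_linear, simplified] vspaceD[OF V] mult.commute
        flip: vspaceD(5)[OF V])
  show "linear_map (tensor torus_module V) V (tlift V (\<lambda>h v. torus_counit h \<odot>\<^bsub>V\<^esub> v))"
    by (rule tlift_linear[OF torus_vspace V V b])
  show "tlift V (\<lambda>h v. torus_counit h \<odot>\<^bsub>V\<^esub> v) (tens torus_module V h v) = torus_counit h \<odot>\<^bsub>V\<^esub> v"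
    if "v \<in> carrier V" for h v
    by (rule tlift_tens[OF torus_vspace V V b]) (use that in auto)
qed

lemma torus_counit_tmon [simp]: "torus_counit (tmon m) = 1"
  by (simp add: torus_counit_def tmon_def)

lemma torus_comult_tmon: "torus_comult (tmon m) = tens torus_module torus_module (tmon m) (tmon m)"
  by (simp add: torus_comult_def tens_def tmon_def)

lemma tmon_zero: "tmon 0 = 1"
  by (simp add: tmon_def)

section \<open>Values of R at the unit\<close>

locale cotriangular_form =
  fixes R :: "('k::field, 'n::finite) torus_form"
  assumes cotriangular: "cotriangular R"
begin

lemma rmat_bilin: "bilin torus_module torus_module field_module (rmat R)"
proof -
  have R: "linear_map (tensor torus_module torus_module) field_module R"
    using cotriangular by (simp add: cotriangular_def)
  show ?thesis
    by (intro bilinI linear_map_compose[OF _ R] bilinD[OF tens_bilin])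
qed

lemma rmat_linear: "linear_map torus_module field_module (rmat R h)"
  "linear_map torus_module field_module (\<lambda>h. rmat R h g)"
  using bilinD[OF rmat_bilin] by simp_all

lemma rmat_simps:
  "rmat R h (g + g') = rmat R h g + rmat R h g'" "rmat R (h + h') g = rmat R h g + rmat R h' g"
  "rmat R h (pscale c g) = c * rmat R h g" "rmat R (pscale c h) g = c * rmat R h g"
  by (simp_all add: linear_mapD(2,3)[OF rmat_linear(1), simplified]
      linear_mapD(2,3)[OF rmat_linear(2), simplified])

text \<open>Since t_m is grouplike, a Sweedler sum over its coproduct has a single term.\<close>

lemma tlift_comult_tmon:
  assumes "bilin torus_module torus_module field_module \<beta>"
  shows "tlift field_module \<beta> (torus_comult (tmon m)) = \<beta> (tmon m) (tmon m)"
  unfolding torus_comult_tmon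
  by (rule tlift_tens[OF torus_vspace torus_vspace field_module_vspace assms]) simp_all

lemma field_bilin:
  assumes "linear_map torus_module field_module f" "linear_map torus_module field_module g"
  shows "bilin torus_module torus_module field_module (\<lambda>h1 h2. f h1 * g h2)"
  using linear_mapD[OF assms(1)] linear_mapD[OF assms(2)]
  by (intro bilinI linear_mapI) (simp_all add: algebra_simps)

text \<open>Both values are idempotents of the field, because 1 = 1 1 and t_m is grouplike. The
  third axiom for the pair t_m, 1 makes their product 1, so neither is 0 and both equal 1.\<close>

lemma rmat_one_tmon: "rmat R 1 (tmon m) = 1" "rmat R (tmon m) 1 = 1"
proof -
  let ?r = "rmat R 1 (tmon m)" and ?s = "rmat R (tmon m) 1"
  have "rmat R (1 * 1) (tmon m) = tlift field_module (\<lambda>h1 h2. rmat R 1 h1 * rmat R 1 h2)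
      (torus_comult (tmon m))"
    using cotriangular unfolding cotriangular_def by blast
  also have "\<dots> = ?r * ?r" by (intro tlift_comult_tmon field_bilin rmat_linear)
  finally have r: "?r = ?r * ?r" by simp
  have "rmat R (tmon m) (1 * 1) = tlift field_module (\<lambda>h1 h2. rmat R h1 1 * rmat R h2 1)
      (torus_comult (tmon m))"
    using cotriangular unfolding cotriangular_def by blast
  also have "\<dots> = ?s * ?s" by (intro tlift_comult_tmon field_bilin rmat_linear)
  finally have s: "?s = ?s * ?s" by simp
  \<comment> \<open>The unit is read as t_0, which makes its coproduct that of a grouplike
    element.\<close>
  have i: "tlift field_module (\<lambda>g1 g2. rmat R h1 g1 * rmat R g2 h2) (torus_comult (tmon 0)) = rmat
      R h1 1 * rmat R 1 h2"
    for h1 h2 unfolding tmon_zero[symmetric] by (intro tlift_comult_tmon field_bilin rmat_linear)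
  have "torus_counit (tmon m) * torus_counit (tmon 0 :: ('k, 'n) torus) = tlift field_module (\<lambda>h1
      h2.
          tlift field_module (\<lambda>g1 g2. rmat R h1 g1 * rmat R g2 h2) (torus_comult (tmon 0)))
        (torus_comult (tmon m))"
    using cotriangular unfolding cotriangular_def by blast
  also have "\<dots> = ?s * ?r" unfolding i by (intro tlift_comult_tmon field_bilin rmat_linear)
  finally have "?s * ?r = 1" by simp
  then have "?s \<noteq> 0" "?r \<noteq> 0" by auto
  with r s show "?r = 1" "?s = 1" by simp_all
qed

lemma rmat_one: "rmat R 1 h = torus_counit h" "rmat R h 1 = torus_counit h"
  by (rule torus_linear_eqI[OF field_module_vspace rmat_linear(1) torus_counit_linear] 
      torus_linear_eqI[OF field_module_vspace rmat_linear(2) torus_counit_linear],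
      simp add: rmat_one_tmon)+

lemma coinvariant_central:
  assumes A: "braided_algebra R A" and s: "coinvariant A s"
  shows "central A s"
  unfolding central_def
proof (intro conjI ballI)
  note AD = braided_algebraD[OF A]
  note lD = linear_mapD[OF AD(3)]
  interpret A: ring A by (rule AD)
  show sc: "s \<in> carrier A" using s by (simp add: coinvariant_def)
  fix a assume a: "a \<in> carrier A"
  have r: "linear_map A A (\<lambda>x. y \<otimes>\<^bsub>A\<^esub> x)" "linear_map A A (\<lambda>x. x \<otimes>\<^bsub>A\<^esub> y)" if "y \<in> carrier A" for y
    using that by (auto intro!: linear_mapI simp: A.r_distr A.l_distr AD(5,6))
  have bi: "bilin torus_module A A (\<lambda>h a0. rmat R h' h \<odot>\<^bsub>A\<^esub> (a0' \<otimes>\<^bsub>A\<^esub> a0))"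
    if "a0' \<in> carrier A" for h' a0'
    using that
    by (intro bilinI linear_mapI)
      (simp_all add: rmat_simps vspaceD[OF AD(1)] A.r_distr AD(6) mult.commute flip: vspaceD(5)[OF
          AD(1)])
  \<comment> \<open>The inner sum as a function of the outer variables. To evaluate the outer sum at
    the pure tensor 1 \<otimes> s, this function has to be bilinear; each of the identities needed
    compares two linear maps at the coaction of a, hence may be checked on pure tensors.\<close>
  let ?\<beta> = "\<lambda>h' a0'. tlift A (\<lambda>h a0. rmat R h' h \<odot>\<^bsub>A\<^esub> (a0' \<otimes>\<^bsub>A\<^esub> a0)) (coact A a)"
  have in1: "tlift A (\<lambda>h a0. rmat R h' h \<odot>\<^bsub>A\<^esub> (a0' \<otimes>\<^bsub>A\<^esub> a0)) (tens torus_module A h a0)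
     = rmat R h' h \<odot>\<^bsub>A\<^esub> (a0' \<otimes>\<^bsub>A\<^esub> a0)" if "a0' \<in> carrier A" "a0 \<in> carrier A" for h' h a0' a0
    by (rule tlift_tens[OF torus_vspace AD(1) AD(1) bi[OF that(1)]]) (use that in auto)
  have lin: "linear_map (tensor torus_module A) A (tlift A (\<lambda>h a0. rmat R h' h \<odot>\<^bsub>A\<^esub> (a0' \<otimes>\<^bsub>A\<^esub> a0)))"
    if "a0' \<in> carrier A" for h' a0'
    by (rule tlift_linear[OF torus_vspace AD(1) AD(1) bi[OF that]])
  have \<beta>: "bilin torus_module A A ?\<beta>"
  proof (intro bilinI linear_mapI)
    fix h' :: "('k, 'n) torus" and a0' assume a0': "a0' \<in> carrier A"
    show "?\<beta> h' a0' \<in> carrier A" "?\<beta> h' a0' \<in> carrier A"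
      using linear_mapD(1)[OF lin[OF a0']] lD(1)[OF a] by blast+
    show "?\<beta> h' (a0' \<oplus>\<^bsub>A\<^esub> a1') = ?\<beta> h' a0' \<oplus>\<^bsub>A\<^esub> ?\<beta> h' a1'" if a1': "a1' \<in> carrier A" for a1'
      by (rule tensor_linear_eqI[OF torus_vspace AD(1) lin linear_map_add[OF AD(1) lin lin]
          lD(1)[OF a]])
        (use a0' a1' in \<open>simp_all add: in1 A.l_distr vspaceD[OF AD(1)]\<close>)
    show "?\<beta> h' (c \<odot>\<^bsub>A\<^esub> a0') = c \<odot>\<^bsub>A\<^esub> ?\<beta> h' a0'" for c
      by (rule tensor_linear_eqI[OF torus_vspace AD(1) lin linear_map_smult[OF AD(1) lin] lD(1)[OF
          a]])
        (use a0' in \<open>simp_all add: in1 AD(5) vspaceD[OF AD(1)] mult.commute flip: vspaceD(5)[OF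
            AD(1)]\<close>)
    show "?\<beta> (h' \<oplus>\<^bsub>torus_module\<^esub> g') a0' = ?\<beta> h' a0' \<oplus>\<^bsub>A\<^esub> ?\<beta> g' a0'" for g'
      by (rule tensor_linear_eqI[OF torus_vspace AD(1) lin linear_map_add[OF AD(1) lin lin]
          lD(1)[OF a]])
        (use a0' in \<open>simp_all add: in1\<close>, simp_all add: rmat_simps vspaceD[OF AD(1)] a0')
    show "?\<beta> (c \<odot>\<^bsub>torus_module\<^esub> h') a0' = c \<odot>\<^bsub>A\<^esub> ?\<beta> h' a0'" for c
      by (rule tensor_linear_eqI[OF torus_vspace AD(1) lin linear_map_smult[OF AD(1) lin] lD(1)[OF
          a]])
        (use a0' in \<open>simp_all add: in1\<close>, simp_all add: rmat_simps vspaceD[OF AD(1)] a0')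
  qed
  note cl = counit_linear[OF AD(1)] and ct = counit_tens[OF AD(1)]
  \<comment> \<open>The element s is taken as the right factor, so that its coaction supplies the
    first argument of R. The remaining sum over the coaction of a is then a contraction by
    \<epsilon>.\<close>
  have "a \<otimes>\<^bsub>A\<^esub> s = tlift A ?\<beta> (coact A s)" by (rule AD(7)[OF a sc])
  also have "coact A s = tens torus_module A 1 s" using s by (simp add: coinvariant_def)
  also have "tlift A ?\<beta> \<dots> = ?\<beta> 1 s"
    by (rule tlift_tens[OF torus_vspace AD(1) AD(1) \<beta>]) (use sc in auto)
  also have "\<dots> = s \<otimes>\<^bsub>A\<^esub> tlift A (\<lambda>h w. torus_counit h \<odot>\<^bsub>A\<^esub> w) (coact A a)"
    by (rule tensor_linear_eqI[OF torus_vspace AD(1) lin[OF sc] linear_map_compose[OF cl r(1)[OF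
        sc]] lD(1)[OF a]])
      (use sc in \<open>simp add: in1 ct, simp add: rmat_one AD(6)\<close>)
  also have "\<dots> = s \<otimes>\<^bsub>A\<^esub> a" by (simp add: AD(4)[OF a])
  finally show "a \<otimes>\<^bsub>A\<^esub> s = s \<otimes>\<^bsub>A\<^esub> a" .
qed

end

text \<open>Guarantees that the image of s_j in A[s_i^-1] can be inverted in its turn.\<close>

lemma coinvariant_hom:
  assumes "braided_algebra R A" "braided_algebra R B" "alg_morphism A B f" "coinvariant A s"
  shows "coinvariant B (f s)"
  using assms linear_mapD(1)[OF alg_morphismD(1)[OF assms(3)]] alg_morphismD(3)[OF assms(3)]
  by (simp add: coinvariant_def hmap_tens[OF braided_algebraD(1)[OF assms(1)]
        braided_algebraD(1)[OF assms(2)] alg_morphismD(1)[OF assms(3)]])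

lemma linear_map_minus:
  assumes V: "vspace V" and W: "vspace W" and f: "linear_map V W f"
    and x: "x \<in> carrier V" and y: "y \<in> carrier V"
  shows "f (x \<ominus>\<^bsub>V\<^esub> y) = f x \<ominus>\<^bsub>W\<^esub> f y"
proof -
  interpret V: abelian_group V by (rule vspaceD) fact
  interpret W: abelian_group W by (rule vspaceD) fact
  have "f (\<ominus>\<^bsub>V\<^esub> y) \<oplus>\<^bsub>W\<^esub> f y = f (\<ominus>\<^bsub>V\<^esub> y \<oplus>\<^bsub>V\<^esub> y)" using y by (simp add: linear_mapD[OF f])
  then have "f (\<ominus>\<^bsub>V\<^esub> y) \<oplus>\<^bsub>W\<^esub> f y = \<zero>\<^bsub>W\<^esub>" using y by (simp add: V.l_neg linear_map_zero[OF V W f])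
  then have "\<ominus>\<^bsub>W\<^esub> (f y) = f (\<ominus>\<^bsub>V\<^esub> y)"
    by (rule W.minus_equality) (use y linear_mapD(1)[OF f] in auto)
  then show ?thesis using x y by (simp add: a_minus_def linear_mapD[OF f])
qed

text \<open>Only the vector space operations are compared, so the structure passes between records
  that have different products, coactions or further fields.\<close>

lemma vspace_eqI:
  fixes V :: "('k::field, 'v, 'm) module_scheme" and W :: "('k, 'v, 'l) module_scheme"
  assumes V: "vspace V" and eq: "carrier W = carrier V" "add W = add V" "zero W = zero V" "smult W
      = smult V"
  shows "vspace W"
proof -
  interpret V: abelian_group V by (rule vspaceD) fact
  show ?thesis
    by (intro vspaceI abelian_groupI)
      (auto simp: eq vspaceD[OF V] V.a_ac intro: bexI[of _ "\<ominus>\<^bsub>V\<^esub> x" for x] V.l_neg)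
qed

lemma tens_simps:
  assumes "v \<in> carrier V" "w \<in> carrier W"
  shows "v' \<in> carrier V \<Longrightarrow> tens V W (v \<oplus>\<^bsub>V\<^esub> v') w = tens V W v w \<oplus>\<^bsub>tensor V W\<^esub> tens V W v' w"
    and "w' \<in> carrier W \<Longrightarrow> tens V W v (w \<oplus>\<^bsub>W\<^esub> w') = tens V W v w \<oplus>\<^bsub>tensor V W\<^esub> tens V W v w'"
    and "tens V W (c \<odot>\<^bsub>V\<^esub> v) w = c \<odot>\<^bsub>tensor V W\<^esub> tens V W v w"
    and "tens V W v (c \<odot>\<^bsub>W\<^esub> w) = c \<odot>\<^bsub>tensor V W\<^esub> tens V W v w"
  using assms linear_mapD(2,3)[OF bilinD(1)[OF tens_bilin[of V W] assms(1)]]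
    linear_mapD(2,3)[OF bilinD(2)[OF tens_bilin[of V W] assms(2)]]
  by simp_all

text \<open>Here L stands for F_0. Of this algebra only its trivial coaction matters for the product
  on A \<otimes> L, so words and cosets are kept out of the computation.\<close>

locale trivial_coproduct = cotriangular_form R
  for R :: "('k::field, 'n::finite) torus_form" +
  fixes A :: "('k, 'n, 'a) comod_alg" and L :: "('k, 'n, 'b) comod_alg"
  assumes A: "braided_algebra R A" and Lv: "vspace L" and Lr: "ring L"
    and Ls: "\<And>c a b. a \<in> carrier L \<Longrightarrow> b \<in> carrier L \<Longrightarrow> (c \<odot>\<^bsub>L\<^esub> a) \<otimes>\<^bsub>L\<^esub> b = c \<odot>\<^bsub>L\<^esub> (a \<otimes>\<^bsub>L\<^esub> b)"
      "\<And>c a b. a \<in> carrier L \<Longrightarrow> b \<in> carrier L \<Longrightarrow> a \<otimes>\<^bsub>L\<^esub> (c \<odot>\<^bsub>L\<^esub> b) = c \<odot>\<^bsub>L\<^esub> (a \<otimes>\<^bsub>L\<^esub> b)"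
    and Lc: "\<And>b. b \<in> carrier L \<Longrightarrow> coact L b = tens torus_module L 1 b"
begin

abbreviation "T \<equiv> tensor A L"
abbreviation "P \<equiv> coproduct_alg R A L"

lemmas AD = braided_algebraD[OF A]

sublocale A: ring A by (rule AD)
sublocale L: ring L by (rule Lr)

lemma T_vspace: "vspace T" by (rule tensor_vspace)

lemma P_simps [simp]: "carrier P = carrier T" "add P = add T" "zero P = zero T" "smult P = smult T"
  "one P = tens A L \<one>\<^bsub>A\<^esub> \<one>\<^bsub>L\<^esub>"
  by (simp_all add: coproduct_alg_def)

lemma P_vspace: "vspace P"
  by (rule vspace_eqI[OF T_vspace]) simp_all

text \<open>As the coaction of b is 1 \<otimes> b, the braiding factor is R(g \<otimes> 1) =
  \<epsilon>(g), and the counit axiom of A restores a'. The coproduct thus carries the ordinary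
  product of a tensor product of algebras.\<close>

lemma braided_product:
  assumes a: "a \<in> carrier A" "a' \<in> carrier A" and b: "b \<in> carrier L" "b' \<in> carrier L"
  shows "tlift T (\<lambda>g a0'. tlift T (\<lambda>h b0. rmat R g h \<odot>\<^bsub>T\<^esub> tens A L (a \<otimes>\<^bsub>A\<^esub> a0') (b0 \<otimes>\<^bsub>L\<^esub> b'))
      (coact L b)) (coact A a') = tens A L (a \<otimes>\<^bsub>A\<^esub> a') (b \<otimes>\<^bsub>L\<^esub> b')"
proof -
  have inner: "tlift T (\<lambda>h b0. rmat R g h \<odot>\<^bsub>T\<^esub> tens A L (a \<otimes>\<^bsub>A\<^esub> x) (b0 \<otimes>\<^bsub>L\<^esub> b')) (coact L b)
      = torus_counit g \<odot>\<^bsub>T\<^esub> tens A L (a \<otimes>\<^bsub>A\<^esub> x) (b \<otimes>\<^bsub>L\<^esub> b')" if x: "x \<in> carrier A" for g x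
  proof -
    have "bilin torus_module L T (\<lambda>h b0. rmat R g h \<odot>\<^bsub>T\<^esub> tens A L (a \<otimes>\<^bsub>A\<^esub> x) (b0 \<otimes>\<^bsub>L\<^esub> b'))"
      using x a b
      by (intro bilinI linear_mapI)
        (simp_all add: tens_carrier vspaceD[OF T_vspace] rmat_simps tens_simps L.l_distr Ls
            mult.commute
          flip: vspaceD(5)[OF T_vspace])
    from tlift_tens[OF torus_vspace Lv T_vspace this, of 1 b] show ?thesis
      using b by (simp add: Lc rmat_one)
  qed
  note cl = counit_linear[OF AD(1)] and ct = counit_tens[OF AD(1)]
  have tb: "bilin torus_module A T (\<lambda>g x. torus_counit g \<odot>\<^bsub>T\<^esub> tens A L (a \<otimes>\<^bsub>A\<^esub> x) (b \<otimes>\<^bsub>L\<^esub> b'))"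
    using a b
    by (intro bilinI linear_mapI)
      (simp_all add: linear_mapD(2,3)[OF torus_counit_linear, simplified] tens_carrier vspaceD[OF
          T_vspace]
        tens_simps A.r_distr AD(6) mult.commute flip: vspaceD(5)[OF T_vspace])
  have tt: "tlift T (\<lambda>g x. torus_counit g \<odot>\<^bsub>T\<^esub> tens A L (a \<otimes>\<^bsub>A\<^esub> x) (b \<otimes>\<^bsub>L\<^esub> b')) (tens torus_module
      A h w)
     = torus_counit h \<odot>\<^bsub>T\<^esub> tens A L (a \<otimes>\<^bsub>A\<^esub> w) (b \<otimes>\<^bsub>L\<^esub> b')"
    if "w \<in> carrier A" for h w
    by (rule tlift_tens[OF torus_vspace AD(1) T_vspace tb]) (use that in auto)
  have F: "linear_map A T (\<lambda>x. tens A L (a \<otimes>\<^bsub>A\<^esub> x) (b \<otimes>\<^bsub>L\<^esub> b'))"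
    using a b by (intro linear_mapI) (simp_all add: tens_carrier tens_simps A.r_distr AD(6))
  have c: "coact A a' \<in> carrier (tensor torus_module A)" by (rule coact_closed[OF A a(2)])
  have "tlift T (\<lambda>g a0'. tlift T (\<lambda>h b0. rmat R g h \<odot>\<^bsub>T\<^esub> tens A L (a \<otimes>\<^bsub>A\<^esub> a0') (b0 \<otimes>\<^bsub>L\<^esub> b'))
      (coact L b)) (coact A a')
    = tlift T (\<lambda>g x. torus_counit g \<odot>\<^bsub>T\<^esub> tens A L (a \<otimes>\<^bsub>A\<^esub> x) (b \<otimes>\<^bsub>L\<^esub> b')) (coact A a')"
    by (rule tlift_cong[OF torus_vspace AD(1) T_vspace c])
      (use a b in \<open>simp_all add: inner tens_carrier vspaceD[OF T_vspace]\<close>)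
  also have "\<dots> = tens A L (a \<otimes>\<^bsub>A\<^esub> tlift A (\<lambda>h w. torus_counit h \<odot>\<^bsub>A\<^esub> w) (coact A a')) (b \<otimes>\<^bsub>L\<^esub> b')"
    by (rule tensor_linear_eqI[OF torus_vspace AD(1) tlift_linear[OF torus_vspace AD(1) T_vspace tb]
          linear_map_compose[OF cl F] c])
      (use a b in \<open>simp add: ct tt AD(6) tens_simps\<close>)
  also have "\<dots> = tens A L (a \<otimes>\<^bsub>A\<^esub> a') (b \<otimes>\<^bsub>L\<^esub> b')" by (simp add: AD(4) a)
  finally show ?thesis .
qed

lemma pure_bilin:
  assumes "a \<in> carrier A" "b \<in> carrier L"
  shows "bilin A L T (\<lambda>a' b'. tens A L (a \<otimes>\<^bsub>A\<^esub> a') (b \<otimes>\<^bsub>L\<^esub> b'))"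
  using assms
  by (intro bilinI linear_mapI)
    (simp_all add: tens_carrier tens_simps A.r_distr L.r_distr AD(6) Ls)

text \<open>Left multiplication by a \<otimes> b. The product is a lift inside a lift; this is the
  inner one, and it allows the two arguments to be treated one after the other.\<close>

abbreviation "lmult a b \<equiv> tlift T (\<lambda>a' b'. tens A L (a \<otimes>\<^bsub>A\<^esub> a') (b \<otimes>\<^bsub>L\<^esub> b'))"

lemma lmult_linear: "a \<in> carrier A \<Longrightarrow> b \<in> carrier L \<Longrightarrow> linear_map T T (lmult a b)"
  by (rule tlift_linear[OF AD(1) Lv T_vspace pure_bilin])

lemma lmult_tens:
  "a \<in> carrier A \<Longrightarrow> b \<in> carrier L \<Longrightarrow> a' \<in> carrier A \<Longrightarrow> b' \<in> carrier L
    \<Longrightarrow> lmult a b (tens A L a' b') = tens A L (a \<otimes>\<^bsub>A\<^esub> a') (b \<otimes>\<^bsub>L\<^esub> b')"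
  by (rule tlift_tens[OF AD(1) Lv T_vspace pure_bilin])

lemma mult_eq:
  assumes X: "X \<in> carrier T" and Y: "Y \<in> carrier T"
  shows "X \<otimes>\<^bsub>P\<^esub> Y = tlift T (\<lambda>a b. lmult a b Y) X"
proof -
  have "X \<otimes>\<^bsub>P\<^esub> Y = tlift T (\<lambda>a b.
          tlift T (\<lambda>a' b'.
            tlift T (\<lambda>g a0'.
              tlift T (\<lambda>h b0.
                rmat R g h \<odot>\<^bsub>T\<^esub> tens A L (a \<otimes>\<^bsub>A\<^esub> a0') (b0 \<otimes>\<^bsub>L\<^esub> b'))
              (coact L b)) (coact A a')) Y) X"
    by (simp add: coproduct_alg_def)
  also have "\<dots> = tlift T (\<lambda>a b. lmult a b Y) X"
  proof (rule tlift_cong[OF AD(1) Lv T_vspace X])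
    fix a b assume ab: "a \<in> carrier A" "b \<in> carrier L"
    show "lmult a b Y \<in> carrier T" using linear_mapD(1)[OF lmult_linear[OF ab] Y] .
    show "tlift T (\<lambda>a' b'.
            tlift T (\<lambda>g a0'.
              tlift T (\<lambda>h b0.
                rmat R g h \<odot>\<^bsub>T\<^esub> tens A L (a \<otimes>\<^bsub>A\<^esub> a0') (b0 \<otimes>\<^bsub>L\<^esub> b'))
              (coact L b)) (coact A a')) Y = lmult a b Y"
      by (rule tlift_cong[OF AD(1) Lv T_vspace Y]) (use ab in \<open>simp_all add: braided_product
          tens_carrier\<close>)
  qed
  finally show ?thesis .
qed

text \<open>Makes the outer lift computable for an arbitrary Y. Each identity is between linear maps
  of Y, so it suffices to take Y pure.\<close>

lemma mult_bilin:
  assumes Y: "Y \<in> carrier T"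
  shows "bilin A L T (\<lambda>a b. lmult a b Y)"
proof (intro bilinI linear_mapI)
  fix a b assume ab: "a \<in> carrier A" "b \<in> carrier L"
  note l = lmult_linear
  show "lmult a b Y \<in> carrier T" "lmult a b Y \<in> carrier T" using linear_mapD(1)[OF l[OF ab] Y] by
      auto
  show "lmult a (b \<oplus>\<^bsub>L\<^esub> b') Y = lmult a b Y \<oplus>\<^bsub>T\<^esub> lmult a b' Y" if "b' \<in> carrier L" for b'
    by (rule tensor_linear_eqI[OF AD(1) Lv l linear_map_add[OF T_vspace l l] Y])
      (use ab that in \<open>simp_all add: lmult_tens L.l_distr tens_simps\<close>)
  show "lmult a (c \<odot>\<^bsub>L\<^esub> b) Y = c \<odot>\<^bsub>T\<^esub> lmult a b Y" for c
    by (rule tensor_linear_eqI[OF AD(1) Lv l linear_map_smult[OF T_vspace l] Y])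
      (use ab in \<open>simp_all add: vspaceD[OF Lv] lmult_tens Ls tens_simps\<close>)
  show "lmult (a \<oplus>\<^bsub>A\<^esub> a') b Y = lmult a b Y \<oplus>\<^bsub>T\<^esub> lmult a' b Y" if "a' \<in> carrier A" for a'
    by (rule tensor_linear_eqI[OF AD(1) Lv l linear_map_add[OF T_vspace l l] Y])
      (use ab that in \<open>simp_all add: lmult_tens A.l_distr tens_simps\<close>)
  show "lmult (c \<odot>\<^bsub>A\<^esub> a) b Y = c \<odot>\<^bsub>T\<^esub> lmult a b Y" for c
    by (rule tensor_linear_eqI[OF AD(1) Lv l linear_map_smult[OF T_vspace l] Y])
      (use ab in \<open>simp_all add: vspaceD[OF AD(1)] lmult_tens AD(5) tens_simps\<close>)
qed

lemma mult_linear_left: "Y \<in> carrier T \<Longrightarrow> linear_map T T (\<lambda>X. X \<otimes>\<^bsub>P\<^esub> Y)"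
  by (rule linear_map_cong[OF T_vspace tlift_linear[OF AD(1) Lv T_vspace mult_bilin]]) (simp_all
      add: mult_eq)

lemma mult_tens_left:
  "a \<in> carrier A \<Longrightarrow> b \<in> carrier L \<Longrightarrow> Y \<in> carrier T \<Longrightarrow> tens A L a b \<otimes>\<^bsub>P\<^esub> Y = lmult a b Y"
  by (simp add: mult_eq tens_carrier tlift_tens[OF AD(1) Lv T_vspace mult_bilin])

lemma mult_tens:
  "a \<in> carrier A \<Longrightarrow> b \<in> carrier L \<Longrightarrow> a' \<in> carrier A \<Longrightarrow> b' \<in> carrier L
    \<Longrightarrow> tens A L a b \<otimes>\<^bsub>P\<^esub> tens A L a' b' = tens A L (a \<otimes>\<^bsub>A\<^esub> a') (b \<otimes>\<^bsub>L\<^esub> b')"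
  by (simp add: mult_tens_left tens_carrier lmult_tens)

text \<open>For pure X the product is \<open>lmult\<close>, which is linear in Y by construction.
  For general X the product is a lift whose integrand depends on Y, so linearity is obtained by
  induction on X.\<close>

lemma mult_linear_right:
  assumes X: "X \<in> carrier T"
  shows "linear_map T T (\<lambda>Y. X \<otimes>\<^bsub>P\<^esub> Y)"
  using AD(1) Lv X
proof (induction X rule: tensor_induct)
  case (tens v w)
  then show ?case by (intro linear_map_cong[OF T_vspace lmult_linear[OF tens]]) (simp add:
      mult_tens_left)
next
  case (add X Y)
  show ?case
    by (rule linear_map_cong[OF T_vspace linear_map_add[OF T_vspace add(3,4)]])
      (use add(1,2) in \<open>simp add: linear_mapD(2)[OF mult_linear_left]\<close>)
qed

lemma P_closed: "X \<in> carrier T \<Longrightarrow> Y \<in> carrier T \<Longrightarrow> X \<otimes>\<^bsub>P\<^esub> Y \<in> carrier T"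
  using linear_mapD(1)[OF mult_linear_right] .

text \<open>Both sides are linear in each factor; X, Y and Z are reduced to pure tensors one at a
  time, and then associativity in A and in L applies.\<close>

lemma P_assoc:
  assumes X: "X \<in> carrier T" and Y: "Y \<in> carrier T" and Z: "Z \<in> carrier T"
  shows "(X \<otimes>\<^bsub>P\<^esub> Y) \<otimes>\<^bsub>P\<^esub> Z = X \<otimes>\<^bsub>P\<^esub> (Y \<otimes>\<^bsub>P\<^esub> Z)"
proof (rule tensor_linear_eqI[OF AD(1) Lv linear_map_compose[OF mult_linear_left[OF Y]
    mult_linear_left[OF Z]]
      mult_linear_left[OF P_closed[OF Y Z]] X])
  fix a b assume ab: "a \<in> carrier A" "b \<in> carrier L"
  note t = tens_carrier[OF ab]
  show "(tens A L a b \<otimes>\<^bsub>P\<^esub> Y) \<otimes>\<^bsub>P\<^esub> Z = tens A L a b \<otimes>\<^bsub>P\<^esub> (Y \<otimes>\<^bsub>P\<^esub> Z)"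
  proof (rule tensor_linear_eqI[OF AD(1) Lv linear_map_compose[OF mult_linear_right[OF t]
      mult_linear_left[OF Z]]
        linear_map_compose[OF mult_linear_left[OF Z] mult_linear_right[OF t]] Y])
    fix a' b' assume ab': "a' \<in> carrier A" "b' \<in> carrier L"
    note t' = tens_carrier[OF ab']
    show "(tens A L a b \<otimes>\<^bsub>P\<^esub> tens A L a' b') \<otimes>\<^bsub>P\<^esub> Z = tens A L a b \<otimes>\<^bsub>P\<^esub> (tens A L a' b' \<otimes>\<^bsub>P\<^esub> Z)"
      by (rule tensor_linear_eqI[OF AD(1) Lv mult_linear_right[OF P_closed[OF t t']]
            linear_map_compose[OF mult_linear_right[OF t'] mult_linear_right[OF t]] Z])
        (use ab ab' in \<open>simp add: mult_tens A.m_assoc L.m_assoc\<close>)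
  qed
qed

lemma P_ring: "ring P"
proof (rule ringI)
  show "abelian_group P" by (rule vspaceD[OF P_vspace])
  show "Group.monoid P"
  proof (rule monoidI)
    show "\<one>\<^bsub>P\<^esub> \<otimes>\<^bsub>P\<^esub> X = X" if X: "X \<in> carrier P" for X
      unfolding P_simps
      by (rule tensor_linear_eqI[OF AD(1) Lv mult_linear_right linear_map_id X[unfolded P_simps]])
        (simp_all add: mult_tens tens_carrier)
    show "X \<otimes>\<^bsub>P\<^esub> \<one>\<^bsub>P\<^esub> = X" if X: "X \<in> carrier P" for X
      unfolding P_simps
      by (rule tensor_linear_eqI[OF AD(1) Lv mult_linear_left linear_map_id X[unfolded P_simps]])
        (simp_all add: mult_tens tens_carrier)
  qed (simp_all add: P_closed P_assoc tens_carrier)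
qed (simp_all add: linear_mapD(2)[OF mult_linear_left] linear_mapD(2)[OF mult_linear_right])

end

section \<open>The algebra on one coinvariant generator\<close>

lemma words_alg_simps [simp]:
  "carrier (words_alg ms) = {p. \<forall>w\<in>Poly_Mapping.keys p. set (letters w) \<subseteq> {..<length ms}}"
  "mult (words_alg ms) = (*)" "one (words_alg ms) = 1" "zero (words_alg ms) = 0"
  "add (words_alg ms) = (+)" "smult (words_alg ms) = pscale"
  by (simp_all add: words_alg_def words_module_def module.defs comod_alg.defs)

lemma words_module_simps [simp]:
  "carrier (words_module N) = {p. \<forall>w\<in>Poly_Mapping.keys p. set (letters w) \<subseteq> {..<N}}"
  "zero (words_module N) = 0" "add (words_module N) = (+)" "smult (words_module N) = pscale"
  by (simp_all add: words_module_def)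

lemma words_module_vspace: "vspace (words_module N :: ('k::field, word \<Rightarrow>\<^sub>0 'k) module)"
proof (rule vspaceI)
  show "abelian_group (words_module N :: ('k, word \<Rightarrow>\<^sub>0 'k) module)"
  proof (rule abelian_groupI)
    fix p :: "word \<Rightarrow>\<^sub>0 'k" assume "p \<in> carrier (words_module N)"
    then show "\<exists>q\<in>carrier (words_module N). q \<oplus>\<^bsub>words_module N\<^esub> p = \<zero>\<^bsub>words_module N\<^esub>"
      by (intro bexI[of _ "- p"]) auto
  qed (use keys_add in \<open>fastforce simp: algebra_simps\<close>)+
qed (use keys_pscale in \<open>fastforce simp: pspace.scale_left_distrib pspace.scale_right_distrib\<close>)+

lemma letters_zero [simp]: "letters 0 = []"
  by (simp add: zero_word_def)

lemma letters_plus [simp]: "letters (u + v) = letters u @ letters v"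
  by (simp add: plus_word_def)

lemma words_alg_ring: "ring (words_alg ms :: ('k::field, 'n::finite, word \<Rightarrow>\<^sub>0 'k) comod_alg)"
proof (rule ringI)
  have "vspace (words_alg ms :: ('k, 'n, word \<Rightarrow>\<^sub>0 'k) comod_alg)"
    by (rule vspace_eqI[OF words_module_vspace[of "length ms"]]) simp_all
  then show "abelian_group (words_alg ms :: ('k, 'n, word \<Rightarrow>\<^sub>0 'k) comod_alg)" by (rule vspaceD)
  have cl: "p * q \<in> carrier (words_alg ms :: ('k, 'n, word \<Rightarrow>\<^sub>0 'k) comod_alg)"
    if "p \<in> carrier (words_alg ms :: ('k, 'n, word \<Rightarrow>\<^sub>0 'k) comod_alg)"
      "q \<in> carrier (words_alg ms :: ('k, 'n, word \<Rightarrow>\<^sub>0 'k) comod_alg)" for p q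
  proof -
    have "set (letters w) \<subseteq> {..<length ms}" if w: "w \<in> Poly_Mapping.keys (p * q)" for w
    proof -
      obtain u v where "w = u + v" "u \<in> Poly_Mapping.keys p" "v \<in> Poly_Mapping.keys q"
        using keys_mult[of p q] w by blast
      then show ?thesis using \<open>p \<in> _\<close> \<open>q \<in> _\<close> by simp
    qed
    then show ?thesis by simp
  qed
  show "Group.monoid (words_alg ms :: ('k, 'n, word \<Rightarrow>\<^sub>0 'k) comod_alg)"
    by (rule monoidI; unfold words_alg_simps(2,3); (rule cl)?) (simp_all add: mult.assoc)
qed (simp_all only: words_alg_simps(2,5) distrib_right distrib_left)

text \<open>The coaction of a combination of words in which every word has the same degree: all
  summands share the factor h, and bilinearity collects them into one pure tensor. The induction
  also records that partial sums stay in the carrier, since additivity of \<open>tens\<close> holds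
  only there.\<close>

lemma tens_words_one:
  fixes p :: "word \<Rightarrow>\<^sub>0 'k::field" and h :: "('k, 'n::finite) torus"
  assumes p: "p \<in> carrier (words_module N)"
  shows "tcls torus_module (words_module N)
      (\<Sum>w\<in>Poly_Mapping.keys p. Poly_Mapping.single (h, Poly_Mapping.single w 1)
          (Poly_Mapping.lookup p w))
    = tens torus_module (words_module N) h p"
proof -
  let ?W = "words_module N :: ('k, word \<Rightarrow>\<^sub>0 'k) module"
  let ?H = "torus_module :: ('k, ('k, 'n) torus) module"
  have "tcls ?H ?W (\<Sum>w\<in>S. Poly_Mapping.single (h, Poly_Mapping.single w 1) (Poly_Mapping.lookup p
      w))
      = tens ?H ?W h (\<Sum>w\<in>S. Poly_Mapping.single w (Poly_Mapping.lookup p w))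
      \<and> (\<Sum>w\<in>S. Poly_Mapping.single w (Poly_Mapping.lookup p w)) \<in> carrier ?W"
    if "finite S" "S \<subseteq> Poly_Mapping.keys p" for S
    using that
  proof (induction S rule: finite_induct)
    case empty
    have "tens ?H ?W h (pscale 0 0) = 0 \<odot>\<^bsub>tensor ?H ?W\<^esub> tens ?H ?W h 0"
      using tens_simps(4)[of h ?H 0 ?W 0] by simp
    then show ?case by (simp add: tens_def tensor_smult_tcls)
  next
    case (insert w S)
    let ?c = "Poly_Mapping.lookup p w"
    have w: "Poly_Mapping.single w 1 \<in> carrier ?W" "Poly_Mapping.single w ?c \<in> carrier ?W"
      using insert p by auto
    have "tens ?H ?W h (pscale ?c (Poly_Mapping.single w 1)) = ?c \<odot>\<^bsub>tensor ?H ?W\<^esub> tens ?H ?W h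
        (Poly_Mapping.single w 1)"
      using tens_simps(4)[of h ?H "Poly_Mapping.single w 1" ?W ?c] w by simp
    then have "tcls ?H ?W (Poly_Mapping.single (h, Poly_Mapping.single w 1) ?c) = tens ?H ?W h
        (Poly_Mapping.single w ?c)"
      by (simp add: tens_def tensor_smult_tcls)
    moreover have "Poly_Mapping.single w ?c + (\<Sum>w\<in>S. Poly_Mapping.single w (Poly_Mapping.lookup p
        w)) \<in> carrier ?W"
      using insert w abelian_monoid.a_closed[OF abelian_group.axioms(1)[OF vspaceD(1)[OF
          words_module_vspace]]]
      by (metis (no_types, lifting) insert_subset words_module_simps(3))
    ultimately show ?case
      using insert w
        tens_simps(2)[of h ?H "Poly_Mapping.single w ?c" ?W "\<Sum>w\<in>S. Poly_Mapping.single w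
            (Poly_Mapping.lookup p w)"]
      by (simp add: tensor_add_tcls[symmetric])
  qed
  from this[of "Poly_Mapping.keys p"] show ?thesis by (simp add: poly_mapping_expand)
qed

text \<open>Scalars are the multiples of the empty word. These are central although the monoid of
  words is not commutative.\<close>

lemma pscale_mult:
  fixes p q :: "word \<Rightarrow>\<^sub>0 'k::field"
  shows "pscale c p * q = pscale c (p * q)" "p * pscale c q = pscale c (p * q)"
proof -
  have s: "pscale c r = Poly_Mapping.single 0 c * r" for r :: "word \<Rightarrow>\<^sub>0 'k"
    by (simp add: pscale_def mult_map_scale_conv_mult)
  then show "pscale c p * q = pscale c (p * q)" by (simp add: mult.assoc)
  have "p * Poly_Mapping.single 0 c = Poly_Mapping.single 0 c * p"
  proof (induction p rule: update_induct)
    case (update f z d)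
    have "Poly_Mapping.update z d f = Poly_Mapping.single z d + f"
      by (rule update_eq_add) (use update in simp)
    then show ?case using update by (simp add: algebra_simps mult_single)
  qed simp
  then show "p * pscale c q = pscale c (p * q)" by (simp add: s flip: mult.assoc)
qed

lemma coset_zero: 
  assumes "ring A" "a \<in> carrier A" shows "{\<zero>\<^bsub>A\<^esub>} +>\<^bsub>A\<^esub> a = {a}"
proof -
  interpret ring A by fact
  show ?thesis using assms by (simp add: a_r_coset_def')
qed

lemma quotient_alg_simps [simp]:
  "carrier (quotient_alg A I) = a_rcosets\<^bsub>A\<^esub> I" "mult (quotient_alg A I) = rcoset_mult A I"
  "one (quotient_alg A I) = I +>\<^bsub>A\<^esub> \<one>\<^bsub>A\<^esub>" "zero (quotient_alg A I) = I" "add (quotient_alg A I) =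
      set_add A"
  "smult (quotient_alg A I) = (\<lambda>c X. \<Union>x\<in>X. I +>\<^bsub>A\<^esub> (c \<odot>\<^bsub>A\<^esub> x))"
  by (simp_all add: quotient_alg_def quotient_module_def FactRing_def ring.defs module.defs
      comod_alg.defs)

lemma quotient_module_simps [simp]:
  "carrier (quotient_module A I) = a_rcosets\<^bsub>A\<^esub> I"
  "zero (quotient_module A I) = I" "add (quotient_module A I) = set_add A"
  "smult (quotient_module A I) = (\<lambda>c X. \<Union>x\<in>X. I +>\<^bsub>A\<^esub> (c \<odot>\<^bsub>A\<^esub> x))"
  by (simp_all add: quotient_module_def FactRing_def ring.defs module.defs)

text \<open>The coaction of a quotient is formed over the bare \<open>quotient_module\<close>; this
  identifies its values with tensors over the full algebra record.\<close>

lemma tens_cong: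
  fixes W :: "('k::field, 'w, 'm) module_scheme" and W' :: "('k, 'w, 'l) module_scheme"
  assumes "carrier W' = carrier W" "add W' = add W" "smult W' = smult W"
  shows "tens V W' = tens V W"
  by (simp add: tens_def[abs_def] tcls_def tnull_def assms)

section \<open>The algebra F_0 as a polynomial ring\<close>

context cotriangular_form
begin

abbreviation "W \<equiv> words_alg [0 :: int ^ 'n] :: ('k, 'n, word \<Rightarrow>\<^sub>0 'k) comod_alg"
abbreviation "\<Lambda> \<equiv> line_alg R"

sublocale W: ring W by (rule words_alg_ring)

text \<open>With one generator of degree 0 the only relation is x x = R(1 \<otimes> 1) x x, and R(1
  \<otimes> 1) = 1. Consequently the elements of F_0 are singleton cosets, which is the form in
  which they are handled from here on.\<close>

lemma braid_ideal_line: "braid_ideal R [0] = {0}"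
proof -
  have "rmat R 1 1 = 1" using rmat_one_tmon(1)[of 0] by (simp add: tmon_zero)
  then have "{gen i * gen j - pscale (rmat R (tmon ([0] ! j)) (tmon ([0] ! i))) (gen j * gen i) |
      i j.
        i < length [0 :: int ^ 'n] \<and> j < length [0 :: int ^ 'n]} = {\<zero>\<^bsub>W\<^esub>}"
    by (auto simp: tmon_zero)
  then show ?thesis unfolding braid_ideal_def using W.genideal_zero by simp
qed

lemma W_coset: "p \<in> carrier W \<Longrightarrow> {0} +>\<^bsub>W\<^esub> p = {p}"
  using coset_zero[OF W.ring_axioms, of p] by simp

lemma line_carrier: "carrier \<Lambda> = (\<lambda>p. {p}) ` carrier W"
proof -
  have "carrier \<Lambda> = (\<Union>p\<in>carrier W. {{0} +>\<^bsub>W\<^esub> p})"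
    unfolding free_alg_def braid_ideal_line quotient_alg_simps A_RCOSETS_def' ..
  also have "\<dots> = (\<Union>p\<in>carrier W. {{p}})" by (rule SUP_cong) (simp_all only: W_coset)
  finally show ?thesis by blast
qed

lemma line_simps:
  "p \<in> carrier W \<Longrightarrow> q \<in> carrier W \<Longrightarrow> {p} \<otimes>\<^bsub>\<Lambda>\<^esub> {q} = {p * q}"
  "\<one>\<^bsub>\<Lambda>\<^esub> = {1}" "\<zero>\<^bsub>\<Lambda>\<^esub> = {0}"
  "{p} \<oplus>\<^bsub>\<Lambda>\<^esub> {q} = {p + q}"
  "p \<in> carrier W \<Longrightarrow> c \<odot>\<^bsub>\<Lambda>\<^esub> {p} = {pscale c p}"
proof -
  note d = free_alg_def[of R "[0]"] braid_ideal_line quotient_alg_simps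
  show "{p} \<otimes>\<^bsub>\<Lambda>\<^esub> {q} = {p * q}" if "p \<in> carrier W" "q \<in> carrier W"
    unfolding d rcoset_mult_def using W_coset[OF W.m_closed[OF that]] by simp
  show "\<one>\<^bsub>\<Lambda>\<^esub> = {1}" unfolding d using W_coset[OF W.one_closed] by simp
  show "\<zero>\<^bsub>\<Lambda>\<^esub> = {0}" unfolding d ..
  show "{p} \<oplus>\<^bsub>\<Lambda>\<^esub> {q} = {p + q}" unfolding d set_add_def' by simp
  show "c \<odot>\<^bsub>\<Lambda>\<^esub> {p} = {pscale c p}" if "p \<in> carrier W"
  proof -
    have "pscale c p \<in> carrier W" using that keys_pscale[of c p] by auto
    from W_coset[OF this] show ?thesis unfolding d by simp
  qed
qed

lemma W_closed: "p \<in> carrier W \<Longrightarrow> pscale c p \<in> carrier W"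
  using keys_pscale[of c p] by auto

lemma line_algebra:
  shows line_vspace: "vspace \<Lambda>" and line_ring: "ring \<Lambda>"
    and line_smult: "\<And>c a b. a \<in> carrier \<Lambda> \<Longrightarrow> b \<in> carrier \<Lambda> \<Longrightarrow> (c \<odot>\<^bsub>\<Lambda>\<^esub> a) \<otimes>\<^bsub>\<Lambda>\<^esub> b = c \<odot>\<^bsub>\<Lambda>\<^esub> (a \<otimes>\<^bsub>\<Lambda>\<^esub> b)"
      "\<And>c a b. a \<in> carrier \<Lambda> \<Longrightarrow> b \<in> carrier \<Lambda> \<Longrightarrow> a \<otimes>\<^bsub>\<Lambda>\<^esub> (c \<odot>\<^bsub>\<Lambda>\<^esub> b) = c \<odot>\<^bsub>\<Lambda>\<^esub> (a \<otimes>\<^bsub>\<Lambda>\<^esub> b)"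
proof -
  have ab: "abelian_group \<Lambda>"
  proof (rule abelian_groupI)
    fix x assume "x \<in> carrier \<Lambda>"
    then obtain p where p: "x = {p}" "p \<in> carrier W" by (auto simp: line_carrier simp del:
        words_alg_simps)
    have "- p \<in> carrier W" using p by simp
    then have "{- p} \<in> carrier \<Lambda>" unfolding line_carrier by blast
    then show "\<exists>y\<in>carrier \<Lambda>. y \<oplus>\<^bsub>\<Lambda>\<^esub> x = \<zero>\<^bsub>\<Lambda>\<^esub>" by (intro bexI[of _ "{- p}"]) (simp_all add:
        line_simps p(1))
  next
    fix x y assume "x \<in> carrier \<Lambda>" "y \<in> carrier \<Lambda>"
    then obtain p q where p: "x = {p}" "p \<in> carrier W" "y = {q}" "q \<in> carrier W"
      unfolding line_carrier by blast
    have "p + q \<in> carrier W" using W.a_closed[OF p(2,4)] by simp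
    then have "{p + q} \<in> carrier \<Lambda>" unfolding line_carrier by blast
    then show "x \<oplus>\<^bsub>\<Lambda>\<^esub> y \<in> carrier \<Lambda>" "x \<oplus>\<^bsub>\<Lambda>\<^esub> y = y \<oplus>\<^bsub>\<Lambda>\<^esub> x" by (simp_all add: p line_simps
        add.commute)
  next
    have "0 \<in> carrier W" by simp
    then show "\<zero>\<^bsub>\<Lambda>\<^esub> \<in> carrier \<Lambda>" unfolding line_carrier line_simps by blast
  qed (unfold line_carrier, auto simp: line_simps add.assoc simp del: words_alg_simps)
  show "vspace \<Lambda>"
  proof (rule vspaceI[OF ab])
    fix c x assume "x \<in> carrier \<Lambda>"
    then obtain p where p: "x = {p}" "p \<in> carrier W" unfolding line_carrier by blast
    show "c \<odot>\<^bsub>\<Lambda>\<^esub> x \<in> carrier \<Lambda>" unfolding p(1) line_simps(5)[OF p(2)] line_carrier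
      using W_closed[OF p(2)] by blast
    show "1 \<odot>\<^bsub>\<Lambda>\<^esub> x = x" unfolding p(1) line_simps(5)[OF p(2)] by simp
    show "(a * b) \<odot>\<^bsub>\<Lambda>\<^esub> x = a \<odot>\<^bsub>\<Lambda>\<^esub> (b \<odot>\<^bsub>\<Lambda>\<^esub> x)" "(a + b) \<odot>\<^bsub>\<Lambda>\<^esub> x = a \<odot>\<^bsub>\<Lambda>\<^esub> x \<oplus>\<^bsub>\<Lambda>\<^esub> b \<odot>\<^bsub>\<Lambda>\<^esub> x" for a b
      unfolding p(1) line_simps(5)[OF p(2)] line_simps(5)[OF W_closed[OF p(2)]] line_simps(4)
      by (simp_all add: pspace.scale_left_distrib)
    fix y assume "y \<in> carrier \<Lambda>"
    then obtain q where q: "y = {q}" "q \<in> carrier W" unfolding line_carrier by blast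
    have pq: "p + q \<in> carrier W" using W.a_closed[OF p(2) q(2)] by simp
    show "c \<odot>\<^bsub>\<Lambda>\<^esub> (x \<oplus>\<^bsub>\<Lambda>\<^esub> y) = c \<odot>\<^bsub>\<Lambda>\<^esub> x \<oplus>\<^bsub>\<Lambda>\<^esub> c \<odot>\<^bsub>\<Lambda>\<^esub> y"
      unfolding p(1) q(1) line_simps(4) line_simps(5)[OF p(2)] line_simps(5)[OF q(2)]
          line_simps(5)[OF pq]
      by (simp add: pspace.scale_right_distrib)
  qed
  have mc: "{p} \<otimes>\<^bsub>\<Lambda>\<^esub> {q} = {p * q} \<and> p * q \<in> carrier W \<and> p + q \<in> carrier W" if "p \<in> carrier W" "q
      \<in> carrier W" for p q
    using line_simps(1)[OF that] W.m_closed[OF that] W.a_closed[OF that] by (simp del: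
        words_alg_simps(1))
  show "ring \<Lambda>"
  proof (rule ringI[OF ab])
    show "Group.monoid \<Lambda>"
      by (rule monoidI; unfold line_carrier line_simps(2))
        (use mc W.one_closed in \<open>auto simp del: words_alg_simps(1) simp: mult.assoc\<close>)
  qed (unfold line_carrier, use mc in \<open>auto simp del: words_alg_simps(1) simp: line_simps(4)
      algebra_simps\<close>)
  show "(c \<odot>\<^bsub>\<Lambda>\<^esub> a) \<otimes>\<^bsub>\<Lambda>\<^esub> b = c \<odot>\<^bsub>\<Lambda>\<^esub> (a \<otimes>\<^bsub>\<Lambda>\<^esub> b)" "a \<otimes>\<^bsub>\<Lambda>\<^esub> (c \<odot>\<^bsub>\<Lambda>\<^esub> b) = c \<odot>\<^bsub>\<Lambda>\<^esub> (a \<otimes>\<^bsub>\<Lambda>\<^esub> b)"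
    if ab: "a \<in> carrier \<Lambda>" "b \<in> carrier \<Lambda>" for c a b
  proof -
    obtain p q where p: "a = {p}" "p \<in> carrier W" "b = {q}" "q \<in> carrier W"
      using ab unfolding line_carrier by blast
    have "pscale c p * q = pscale c (p * q)" "p * pscale c q = pscale c (p * q)"
      by (rule pscale_mult)+
    then show "(c \<odot>\<^bsub>\<Lambda>\<^esub> a) \<otimes>\<^bsub>\<Lambda>\<^esub> b = c \<odot>\<^bsub>\<Lambda>\<^esub> (a \<otimes>\<^bsub>\<Lambda>\<^esub> b)" "a \<otimes>\<^bsub>\<Lambda>\<^esub> (c \<odot>\<^bsub>\<Lambda>\<^esub> b) = c \<odot>\<^bsub>\<Lambda>\<^esub> (a \<otimes>\<^bsub>\<Lambda>\<^esub> b)"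
      using line_simps(5)[of "p * q" c] mc[OF p(2,4)] mc[OF W_closed[OF p(2)] p(4)] mc[OF p(2)
          W_closed[OF p(4)]]
      unfolding p(1,3) line_simps(5)[OF p(2)] line_simps(5)[OF p(4)]
      by (simp_all del: words_alg_simps(1))
  qed
qed

text \<open>Every word in the letter of degree 0 has degree 0, so the coaction is trivial already
  before passing to the quotient. Since the coset is a singleton, the choice of representative in
  \<open>quotient_alg\<close> is forced.\<close>

lemma line_coact:
  assumes "b \<in> carrier \<Lambda>"
  shows "coact \<Lambda> b = tens torus_module \<Lambda> 1 b"
proof -
  obtain p where p: "b = {p}" "p \<in> carrier W" using assms unfolding line_carrier by blast
  let ?Q = "quotient_module W {0}"
  have c: "carrier ?Q = carrier \<Lambda>" "add ?Q = add \<Lambda>" "smult ?Q = smult \<Lambda>" "zero ?Q = zero \<Lambda>"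
    by (simp_all add: free_alg_def braid_ideal_line)
  have Q: "vspace ?Q" by (rule vspace_eqI[OF line_vspace]) (simp_all only: c)
  let ?N = "words_module (length [0 :: int ^ 'n]) :: ('k, word \<Rightarrow>\<^sub>0 'k) module"
  have N: "carrier ?N = carrier W" by simp
  have sub: "carrier W = {p. \<forall>w\<in>Poly_Mapping.keys p. set (letters w) \<subseteq> {0}}" by auto
  have deg: "word_degree [0 :: int ^ 'n] w = 0" if "w \<in> Poly_Mapping.keys p" for w
  proof -
    have "\<forall>i\<in>set (letters w). i = 0" using that p(2) unfolding sub by auto
    then have m: "map (\<lambda>i. [0 :: int ^ 'n] ! i) (letters w) = map (\<lambda>i. 0) (letters w)"
      by (intro map_cong refl) (metis nth_Cons_0)
    show ?thesis unfolding word_degree_def m by simp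
  qed
  have "coact W p = tcls torus_module ?N
      (\<Sum>w\<in>Poly_Mapping.keys p. Poly_Mapping.single (1 :: ('k, 'n) torus, Poly_Mapping.single w 1)
          (Poly_Mapping.lookup p w))"
    by (simp add: words_alg_def comod_alg.defs module.defs deg tmon_zero)
  also have "\<dots> = tens torus_module ?N 1 p" by (rule tens_words_one) (use p in simp)
  finally have cp: "coact W p = tens torus_module ?N 1 p" .
  have lin: "linear_map ?N ?Q (\<lambda>a. {0} +>\<^bsub>W\<^esub> a)"
  proof (rule linear_map_cong[OF words_module_vspace, where f = "\<lambda>a. {a}"])
    show "linear_map ?N ?Q (\<lambda>a. {a})"
      by (rule linear_mapI) (unfold c N line_carrier, auto simp: line_simps simp del:
          words_alg_simps)
  qed (unfold N, rule W_coset)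
  have "hmap ?Q (\<lambda>a. {0} +>\<^bsub>W\<^esub> a) (coact W p) = tens torus_module ?Q 1 ({0} +>\<^bsub>W\<^esub> p)"
    unfolding cp by (rule hmap_tens[OF words_module_vspace Q lin]) (use p in simp)
  also have "\<dots> = tens torus_module \<Lambda> 1 b"
    unfolding W_coset[OF p(2)] p(1) by (simp only: tens_cong[OF c(1-3)])
  finally show ?thesis
    unfolding p(1) by (simp add: free_alg_def braid_ideal_line quotient_alg_def comod_alg.defs
        module.defs)
qed

end

section \<open>Localization\<close>

lemma lin_fun_add:
  fixes U (structure)
  assumes U: "vspace U" and f: "\<And>z. f z \<in> carrier U" and g: "\<And>z. g z \<in> carrier U"
  shows "lin U (\<lambda>z. f z \<oplus> g z) p = lin U f p \<oplus> lin U g p"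
proof -
  interpret U: abelian_group U by (rule vspaceD) fact
  show ?thesis
    unfolding lin_def by (simp add: vspaceD(2,4)[OF U] f g U.finsum_addf Pi_iff)
qed

lemma lin_fun_smult:
  fixes U (structure)
  assumes U: "vspace U" and f: "\<And>z. f z \<in> carrier U"
  shows "lin U (\<lambda>z. c \<odot> f z) p = c \<odot> lin U f p"
proof -
  have "lin U (\<lambda>z. c \<odot> f z) p = (\<Oplus>z\<in>Poly_Mapping.keys p. c \<odot> (Poly_Mapping.lookup p z \<odot> f z))"
    unfolding lin_def by (simp add: f mult.commute flip: vspaceD(5)[OF U])
  also have "\<dots> = c \<odot> lin U f p"
    unfolding lin_def
    by (rule linear_map_finsum[OF U U linear_map_smult[OF U linear_map_id], symmetric])
      (simp add: f vspaceD[OF U])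
  finally show ?thesis .
qed

locale localization = cotriangular_form R
  for R :: "('k::field, 'n::finite) torus_form" +
  fixes A :: "('k, 'n, 'a) comod_alg" and s :: 'a
  assumes braided: "braided_algebra R A" and coinvariant: "coinvariant A s"
begin

sublocale trivial_coproduct R A "line_alg R"
  by (intro trivial_coproduct.intro cotriangular_form_axioms trivial_coproduct_axioms.intro
      braided line_vspace line_ring line_smult line_coact)

sublocale P: ring P by (rule P_ring)

lemma s_central: "central A s"
  by (rule coinvariant_central[OF braided coinvariant])

lemma s_closed [simp]: "s \<in> carrier A"
  by (rule A.centralD(1)[OF s_central])

text \<open>A word in the letter 0 alone is determined by its length, so for such w this is the
  power of the generator x with exponent \<open>length (letters w)\<close>, as a singleton
  coset.\<close>

definition xmon :: "word \<Rightarrow> (word \<Rightarrow>\<^sub>0 'k) set" where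
  "xmon w = {Poly_Mapping.single w 1}"

definition xwords :: "word set" where
  "xwords = {w. set (letters w) \<subseteq> {..<1}}"

lemma xwords_W: "w \<in> xwords \<Longrightarrow> Poly_Mapping.single w c \<in> carrier W"
  by (simp add: xwords_def)

lemma xmon_closed [simp]: "w \<in> xwords \<Longrightarrow> xmon w \<in> carrier \<Lambda>"
  unfolding xmon_def line_carrier using xwords_W by blast

lemma xwords_zero [simp]: "0 \<in> xwords"
  by (simp add: xwords_def)

lemma xwords_plus [simp]: "u + v \<in> xwords \<longleftrightarrow> u \<in> xwords \<and> v \<in> xwords"
  by (auto simp: xwords_def)

lemma xmon_mult: "u \<in> xwords \<Longrightarrow> v \<in> xwords \<Longrightarrow> xmon u \<otimes>\<^bsub>\<Lambda>\<^esub> xmon v = xmon (u + v)"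
  unfolding xmon_def by (simp only: line_simps(1)[OF xwords_W xwords_W] mult_single mult_1)

lemma xmon_zero: "xmon 0 = \<one>\<^bsub>\<Lambda>\<^esub>"
  by (simp add: xmon_def line_simps(2))

lemma line_gen_xmon: "line_gen R = xmon (Word [0])" "Word [0] \<in> xwords"
proof -
  have "gen 0 \<in> carrier W" by (simp add: gen_def)
  then show "line_gen R = xmon (Word [0])"
    unfolding line_gen_def braid_ideal_line xmon_def by (simp only: W_coset gen_def)
qed (simp add: xwords_def)

text \<open>Elements of A[x] are sums of monomials a x^k. The scalar coefficients of an element of
  F_0 are moved into A, so that no separate scalars remain.\<close>

lemma xmon_induct [consumes 1, case_names mon add]:
  assumes X: "X \<in> carrier T"
    and mon: "\<And>a w. a \<in> carrier A \<Longrightarrow> w \<in> xwords \<Longrightarrow> Q (tens A \<Lambda> a (xmon w))"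
    and add: "\<And>X Y. X \<in> carrier T \<Longrightarrow> Y \<in> carrier T \<Longrightarrow> Q X \<Longrightarrow> Q Y \<Longrightarrow> Q (X \<oplus>\<^bsub>T\<^esub> Y)"
  shows "Q X"
  using AD(1) line_vspace X
proof (induction X rule: tensor_induct)
  case (tens a b)
  obtain p where p: "b = {p}" "p \<in> carrier W" using tens(2) unfolding line_carrier by blast
  have m: "tens A \<Lambda> a {Poly_Mapping.single w c} = tens A \<Lambda> (c \<odot>\<^bsub>A\<^esub> a) (xmon w)" if w: "w \<in> xwords"
      for w c
  proof -
    have "{Poly_Mapping.single w c} = c \<odot>\<^bsub>\<Lambda>\<^esub> xmon w"
      unfolding xmon_def line_simps(5)[OF xwords_W[OF w]] by simp
    then show ?thesis using tens(1) w by (simp add: tens_simps)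
  qed
  have "{p} \<in> carrier \<Lambda> \<and> Q (tens A \<Lambda> a {p})" using p(2)
  proof (induction p rule: update_induct)
    case const
    then have "{0} \<in> carrier \<Lambda>" unfolding line_carrier by blast
    moreover have "Q (tens A \<Lambda> a {Poly_Mapping.single 0 0})"
      unfolding m[OF xwords_zero] by (rule mon) (simp_all add: vspaceD[OF AD(1)] tens(1))
    ultimately show ?case by simp
  next
    case (update f z c)
    have z: "z \<in> xwords" and f: "f \<in> carrier W"
      using update by (auto simp: keys_update xwords_def)
    have zc: "{Poly_Mapping.single z c} \<in> carrier \<Lambda>" unfolding line_carrier using xwords_W[OF z]
        by blast
    have e: "{Poly_Mapping.update z c f} = {Poly_Mapping.single z c} \<oplus>\<^bsub>\<Lambda>\<^esub> {f}"
      unfolding line_simps update_eq_add[OF update(1)] ..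
    have IH: "{f} \<in> carrier \<Lambda>" "Q (tens A \<Lambda> a {f})" using update.IH f by auto
    have "Q (tens A \<Lambda> a {Poly_Mapping.single z c})"
      unfolding m[OF z] by (rule mon) (simp_all add: vspaceD[OF AD(1)] tens(1) z)
    then have "Q (tens A \<Lambda> a {Poly_Mapping.single z c} \<oplus>\<^bsub>T\<^esub> tens A \<Lambda> a {f})"
      using IH zc tens(1) by (intro add tens_carrier)
    then show ?case unfolding e using IH zc tens(1) by (simp add: tens_simps L.a_closed)
  qed
  then show ?case by (simp add: p(1))
next
  case (add X Y)
  then show ?case by (rule assms(3))
qed

text \<open>
  For \<open>M\<close> at least the degree of \<open>p = \<Sum> a\<^sub>i x\<^sup>i\<close>, \<open>hev M p\<close> is \<open>s\<^sup>M p(s\<^sup>-\<^sup>1) = \<Sum> a\<^sub>i s\<^sup>M\<^sup>-\<^sup>i\<close>.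
  The exponent is truncated, so smaller \<open>M\<close> have no meaning. The polynomials on which \<open>hev M\<close>
  eventually vanishes form the kernel of evaluation at \<open>s\<^sup>-\<^sup>1\<close>, described without that inverse.
\<close>

definition hev :: "nat \<Rightarrow> ('k, 'a, (word \<Rightarrow>\<^sub>0 'k) set) tensors \<Rightarrow> 'a" where
  "hev M = tlift A (\<lambda>a q. lin A (\<lambda>w. a \<otimes>\<^bsub>A\<^esub> s [^]\<^bsub>A\<^esub> (M - length (letters w))) (the_elem q))"

text \<open>Linearity in q is that of \<open>lin\<close> in the formal combination, and linearity in
  a is that of \<open>lin\<close> in the function being extended.\<close>

lemma hev_bilin: "bilin A \<Lambda> A (\<lambda>a q. lin A (\<lambda>w. a \<otimes>\<^bsub>A\<^esub> s [^]\<^bsub>A\<^esub> (M - length (letters w)))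
    (the_elem q))"
proof (rule bilinI)
  fix a assume a: "a \<in> carrier A"
  let ?g = "\<lambda>w. a \<otimes>\<^bsub>A\<^esub> s [^]\<^bsub>A\<^esub> (M - length (letters w))"
  have g: "?g \<in> UNIV \<rightarrow> carrier A" using a by simp
  show "linear_map \<Lambda> A (\<lambda>q. lin A ?g (the_elem q))"
  proof (rule linear_mapI)
    fix q assume "q \<in> carrier \<Lambda>"
    then obtain p where p: "q = {p}" "p \<in> carrier W" unfolding line_carrier by blast
    show "lin A ?g (the_elem q) \<in> carrier A" by (rule lin_closed[OF AD(1)]) (use a in simp)
    show "lin A ?g (the_elem (c \<odot>\<^bsub>\<Lambda>\<^esub> q)) = c \<odot>\<^bsub>A\<^esub> lin A ?g (the_elem q)" for c
      unfolding p(1) line_simps(5)[OF p(2)] the_elem_eq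
      by (rule lin_pscale[OF AD(1)]) (use a in simp)
    fix q' assume "q' \<in> carrier \<Lambda>"
    then obtain p' where p': "q' = {p'}" unfolding line_carrier by blast
    show "lin A ?g (the_elem (q \<oplus>\<^bsub>\<Lambda>\<^esub> q')) = lin A ?g (the_elem q) \<oplus>\<^bsub>A\<^esub> lin A ?g (the_elem q')"
      unfolding p(1) p' line_simps(4) the_elem_eq
      by (rule lin_add[OF AD(1) g]) simp_all
  qed
next
  fix q
  show "linear_map A A (\<lambda>a. lin A (\<lambda>w. a \<otimes>\<^bsub>A\<^esub> s [^]\<^bsub>A\<^esub> (M - length (letters w))) (the_elem q))"
    by (rule linear_mapI)
      (simp_all add: lin_closed[OF AD(1)] A.l_distr AD(5) lin_fun_add[OF AD(1)] lin_fun_smult[OF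
          AD(1)])
qed

lemma hev_linear_T: "linear_map T A (hev M)"
  unfolding hev_def by (rule tlift_linear[OF AD(1) line_vspace AD(1) hev_bilin])

lemma hev_linear: "linear_map P A (hev M)"
  using hev_linear_T[of M] by (simp add: linear_map_def)

lemma hev_mon:
  assumes "a \<in> carrier A" "w \<in> xwords"
  shows "hev M (tens A \<Lambda> a (xmon w)) = a \<otimes>\<^bsub>A\<^esub> s [^]\<^bsub>A\<^esub> (M - length (letters w))"
proof -
  have "hev M (tens A \<Lambda> a (xmon w)) =
      lin A (\<lambda>w. a \<otimes>\<^bsub>A\<^esub> s [^]\<^bsub>A\<^esub> (M - length (letters w))) (the_elem (xmon w))"
    unfolding hev_def by (rule tlift_tens[OF AD(1) line_vspace AD(1) hev_bilin]) (use assms in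
        simp_all)
  also have "\<dots> = a \<otimes>\<^bsub>A\<^esub> s [^]\<^bsub>A\<^esub> (M - length (letters w))"
    unfolding xmon_def the_elem_eq
    by (subst lin_single[OF AD(1)]) (simp_all add: assms vspaceD[OF AD(1)])
  finally show ?thesis .
qed

text \<open>Multiplication by b x^k adds k to all degrees, which is compensated by raising M by k.
  Both orders of multiplication are covered because two-sided ideals are at stake; b passes the
  powers of s because s is central.\<close>

lemma hev_mult:
  assumes X: "X \<in> carrier T" and b: "b \<in> carrier A" and w: "w \<in> xwords"
  shows "eventually (\<lambda>M. hev (M + length (letters w)) (X \<otimes>\<^bsub>P\<^esub> tens A \<Lambda> b (xmon w)) = hev M X \<otimes>\<^bsub>A\<^esub> b
      \<and> hev (M + length (letters w)) (tens A \<Lambda> b (xmon w) \<otimes>\<^bsub>P\<^esub> X) = b \<otimes>\<^bsub>A\<^esub> hev M X) sequentially"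
  using X
proof (induction X rule: xmon_induct)
  case (mon a v)
  show ?case
  proof (rule eventually_mono[OF eventually_ge_at_top])
    fix M assume M: "length (letters v) \<le> M"
    have e: "M + length (letters w) - (length (letters v) + length (letters w)) = M - length
        (letters v)"
      "M + length (letters w) - (length (letters w) + length (letters v)) = M - length (letters
          v)" by simp_all
    have c: "b \<otimes>\<^bsub>A\<^esub> s [^]\<^bsub>A\<^esub> (M - length (letters v)) = s [^]\<^bsub>A\<^esub> (M - length (letters v)) \<otimes>\<^bsub>A\<^esub> b"
      by (rule A.centralD(2)[OF A.central_pow[OF s_central] b])
    show "hev (M + length (letters w)) (tens A \<Lambda> a (xmon v) \<otimes>\<^bsub>P\<^esub> tens A \<Lambda> b (xmon w)) = hev M
        (tens A \<Lambda> a (xmon v)) \<otimes>\<^bsub>A\<^esub> b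
      \<and> hev (M + length (letters w)) (tens A \<Lambda> b (xmon w) \<otimes>\<^bsub>P\<^esub> tens A \<Lambda> a (xmon v)) = b \<otimes>\<^bsub>A\<^esub> hev M
          (tens A \<Lambda> a (xmon v))"
      using mon b w by (simp add: mult_tens xmon_mult hev_mon e A.m_assoc c)
  qed
next
  case (add X Y)
  let ?t = "tens A \<Lambda> b (xmon w)"
  have t: "?t \<in> carrier T" using b w by (simp add: tens_carrier)
  from add(3,4) show ?case
  proof (rule eventually_elim2)
    fix M
    show "hev (M + length (letters w)) ((X \<oplus>\<^bsub>T\<^esub> Y) \<otimes>\<^bsub>P\<^esub> ?t) = hev M (X \<oplus>\<^bsub>T\<^esub> Y) \<otimes>\<^bsub>A\<^esub> b
      \<and> hev (M + length (letters w)) (?t \<otimes>\<^bsub>P\<^esub> (X \<oplus>\<^bsub>T\<^esub> Y)) = b \<otimes>\<^bsub>A\<^esub> hev M (X \<oplus>\<^bsub>T\<^esub> Y)"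
      if "hev (M + length (letters w)) (X \<otimes>\<^bsub>P\<^esub> ?t) = hev M X \<otimes>\<^bsub>A\<^esub> b
      \<and> hev (M + length (letters w)) (?t \<otimes>\<^bsub>P\<^esub> X) = b \<otimes>\<^bsub>A\<^esub> hev M X"
      "hev (M + length (letters w)) (Y \<otimes>\<^bsub>P\<^esub> ?t) = hev M Y \<otimes>\<^bsub>A\<^esub> b
      \<and> hev (M + length (letters w)) (?t \<otimes>\<^bsub>P\<^esub> Y) = b \<otimes>\<^bsub>A\<^esub> hev M Y"
      using that add(1,2) t b
      by (simp add: linear_mapD(2)[OF mult_linear_left] linear_mapD(2)[OF mult_linear_right]
          linear_mapD(1,2)[OF hev_linear_T] P_closed A.l_distr A.r_distr)
  qed
qed

definition evnull :: "('k, 'a, (word \<Rightarrow>\<^sub>0 'k) set) tensors set" where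
  "evnull = {X \<in> carrier T. eventually (\<lambda>M. hev M X = \<zero>\<^bsub>A\<^esub>) sequentially}"

lemma evnull_add:
  assumes X: "X \<in> evnull" and Y: "Y \<in> evnull"
  shows "X \<oplus>\<^bsub>P\<^esub> Y \<in> evnull"
proof -
  have c: "X \<in> carrier P" "Y \<in> carrier P" using X Y by (simp_all add: evnull_def)
  have "eventually (\<lambda>M. hev M X = \<zero>\<^bsub>A\<^esub>) sequentially" "eventually (\<lambda>M. hev M Y = \<zero>\<^bsub>A\<^esub>) sequentially"
    using X Y by (simp_all add: evnull_def)
  then have "eventually (\<lambda>M. hev M (X \<oplus>\<^bsub>P\<^esub> Y) = \<zero>\<^bsub>A\<^esub>) sequentially"
    by (rule eventually_elim2) (simp add: linear_mapD(2)[OF hev_linear c] del: P_simps)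
  then show ?thesis using P.a_closed[OF c] by (simp add: evnull_def)
qed

text \<open>Absorption is checked for monomials b x^k, where \<open>hev_mult\<close> yields it up to
  a shift of M by k; a shift does not affect what happens for all large M. Sums of monomials follow
  by additivity.\<close>

lemma evnull_ideal: "ideal evnull P"
proof (rule idealI[OF P.ring_axioms])
  have zero: "hev M \<zero>\<^bsub>P\<^esub> = \<zero>\<^bsub>A\<^esub>" for M
    using linear_map_zero[OF P_vspace AD(1) hev_linear] .
  show "subgroup evnull (add_monoid P)"
  proof (rule P.add.subgroupI)
    show "evnull \<subseteq> carrier P" by (auto simp: evnull_def)
    show "evnull \<noteq> {}" using zero P.zero_closed by (auto simp: evnull_def)
    show "X \<oplus>\<^bsub>P\<^esub> Y \<in> evnull" if "X \<in> evnull" "Y \<in> evnull" for X Y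
      by (rule evnull_add[OF that])
    show "\<ominus>\<^bsub>P\<^esub> X \<in> evnull" if X: "X \<in> evnull" for X
    proof -
      have c: "X \<in> carrier P" using X by (simp add: evnull_def)
      have "hev M (\<ominus>\<^bsub>P\<^esub> X) = \<ominus>\<^bsub>A\<^esub> hev M X" for M
        using linear_map_minus[OF P_vspace AD(1) hev_linear P.zero_closed c, of M]
          linear_mapD(1)[OF hev_linear c] c zero
        by (simp add: a_minus_def del: P_simps)
      then show ?thesis using X P.a_inv_closed[OF c] by (auto simp: evnull_def elim!:
          eventually_mono)
    qed
  qed
  have "X \<otimes>\<^bsub>P\<^esub> Y \<in> evnull \<and> Y \<otimes>\<^bsub>P\<^esub> X \<in> evnull" if X: "X \<in> evnull" and Y: "Y \<in> carrier T" for X Y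
    using Y
  proof (induction Y rule: xmon_induct)
    case (mon b w)
    let ?t = "tens A \<Lambda> b (xmon w)"
    have t: "?t \<in> carrier T" using mon by (simp add: tens_carrier)
    have Xc: "X \<in> carrier T" and "eventually (\<lambda>M. hev M X = \<zero>\<^bsub>A\<^esub>) sequentially"
      using X by (simp_all add: evnull_def)
    from hev_mult[OF Xc mon] this(2)
    have "eventually (\<lambda>M. hev (M + length (letters w)) (X \<otimes>\<^bsub>P\<^esub> ?t) = \<zero>\<^bsub>A\<^esub>
        \<and> hev (M + length (letters w)) (?t \<otimes>\<^bsub>P\<^esub> X) = \<zero>\<^bsub>A\<^esub>) sequentially"
      by (rule eventually_elim2) (use mon in simp)
    then show ?case
      using Xc t unfolding evnull_def
      by (simp add: P_closed eventually_conj_iff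
          eventually_sequentially_seg[of "\<lambda>M. hev M (X \<otimes>\<^bsub>P\<^esub> ?t) = \<zero>\<^bsub>A\<^esub>"]
          eventually_sequentially_seg[of "\<lambda>M. hev M (?t \<otimes>\<^bsub>P\<^esub> X) = \<zero>\<^bsub>A\<^esub>"])
  next
    case (add Y Z)
    have Xc: "X \<in> carrier T" using X by (simp add: evnull_def)
    show ?case
      using add Xc evnull_add[of "X \<otimes>\<^bsub>P\<^esub> Y" "X \<otimes>\<^bsub>P\<^esub> Z"] evnull_add[of "Y \<otimes>\<^bsub>P\<^esub> X" "Z \<otimes>\<^bsub>P\<^esub> X"]
      by (simp add: linear_mapD(2)[OF mult_linear_left] linear_mapD(2)[OF mult_linear_right])
  qed
  then show "Y \<otimes>\<^bsub>P\<^esub> X \<in> evnull" "X \<otimes>\<^bsub>P\<^esub> Y \<in> evnull" if "X \<in> evnull" "Y \<in> carrier P" for X Y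
    using that by simp_all
qed

section \<open>The ideal generated by s x - 1 and its quotient\<close>

abbreviation "sx \<equiv> tens A \<Lambda> s (line_gen R)"

lemma sx_closed: "sx \<in> carrier P"
  by (simp add: tens_carrier line_gen_xmon)

lemma relation_evnull: "sx \<ominus>\<^bsub>P\<^esub> \<one>\<^bsub>P\<^esub> \<in> evnull"
proof -
  have "eventually (\<lambda>M. hev M (sx \<ominus>\<^bsub>P\<^esub> \<one>\<^bsub>P\<^esub>) = \<zero>\<^bsub>A\<^esub>) sequentially"
  proof (rule eventually_mono[OF eventually_ge_at_top])
    \<comment> \<open>For M = 0 the truncated exponent would give s for the monomial s x but \<one>
      for the constant 1.\<close>
    fix M :: nat assume M: "1 \<le> M"
    have "hev M sx = s \<otimes>\<^bsub>A\<^esub> s [^]\<^bsub>A\<^esub> (M - 1)" by (simp add: line_gen_xmon hev_mon)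
    also have "\<dots> = s [^]\<^bsub>A\<^esub> Suc (M - 1)" by (rule A.nat_pow_Suc2[OF s_closed, symmetric])
    also have "\<dots> = s [^]\<^bsub>A\<^esub> M"
      by (rule arg_cong[where f = "\<lambda>n. s [^]\<^bsub>A\<^esub> n"]) (use M in simp)
    also have "\<dots> = hev M \<one>\<^bsub>P\<^esub>" unfolding P_simps xmon_zero[symmetric] by (simp add: hev_mon)
    finally show "hev M (sx \<ominus>\<^bsub>P\<^esub> \<one>\<^bsub>P\<^esub>) = \<zero>\<^bsub>A\<^esub>"
      unfolding linear_map_minus[OF P_vspace AD(1) hev_linear sx_closed P.one_closed]
      using linear_mapD(1)[OF hev_linear P.one_closed, of M] by simp
  qed
  then show ?thesis using P.minus_closed[OF sx_closed P.one_closed] by (simp add: evnull_def)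
qed

abbreviation "I \<equiv> loc_ideal R A s"

lemma loc_ideal_eq: "I = genideal P {sx \<ominus>\<^bsub>P\<^esub> \<one>\<^bsub>P\<^esub>}"
  by (simp add: loc_ideal_def Let_def)

sublocale I: ideal I P
  unfolding loc_ideal_eq by (rule P.genideal_ideal) (use P.minus_closed[OF sx_closed P.one_closed]
      in blast)

lemma relation_mem: "sx \<ominus>\<^bsub>P\<^esub> \<one>\<^bsub>P\<^esub> \<in> I"
  unfolding loc_ideal_eq by (rule P.genideal_self'[OF P.minus_closed[OF sx_closed P.one_closed]])

text \<open>The ideal I is bounded from above by \<open>evnull\<close>, an ideal that contains its
  generator. On a constant a the value of \<open>hev M\<close> is a s^M, whose vanishing for a
  single M is all that is needed.\<close>

lemma kernel_power:
  assumes a: "a \<in> carrier A" and "tens A \<Lambda> a \<one>\<^bsub>\<Lambda>\<^esub> \<in> I"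
  shows "\<exists>n::nat. s [^]\<^bsub>A\<^esub> n \<otimes>\<^bsub>A\<^esub> a = \<zero>\<^bsub>A\<^esub>"
proof -
  have "I \<subseteq> evnull"
    unfolding loc_ideal_eq by (rule P.genideal_minimal[OF evnull_ideal]) (use relation_evnull in
        simp)
  then have "eventually (\<lambda>M. hev M (tens A \<Lambda> a (xmon 0)) = \<zero>\<^bsub>A\<^esub>) sequentially"
    using assms by (auto simp: evnull_def xmon_zero)
  then obtain M where "a \<otimes>\<^bsub>A\<^esub> s [^]\<^bsub>A\<^esub> (M::nat) = \<zero>\<^bsub>A\<^esub>"
    using eventually_happens[of _ sequentially] a by (auto simp: hev_mon)
  then show ?thesis using A.centralD(2)[OF A.central_pow[OF s_central] a] by auto
qed

text \<open>The quotient is an ordinary quotient ring of A[x], transported along \<psi>. The kernel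
  condition is \<open>kernel_power\<close>; denominators are cleared by pairing each x with an s,
  because s x becomes \<one>.\<close>

lemma is_loc_loc_alg:
  assumes B: "ring B" and \<psi>: "\<psi> \<in> ring_hom (loc_alg R A s) B" "bij_betw \<psi> (carrier (loc_alg R A
      s)) (carrier B)"
    and f: "f \<in> ring_hom A B" "\<And>a. a \<in> carrier A \<Longrightarrow> f a = \<psi> (loc_map R A s a)"
  shows "is_loc A B f s"
proof -
  interpret B: ring B by fact
  \<comment> \<open>The projection of A[x] to its quotient followed by the identification with B. It
    is surjective with kernel I, so the rest can be argued with polynomials instead of
    cosets.\<close>
  define h where "h X = \<psi> (I +>\<^bsub>P\<^esub> X)" for X
  have q: "carrier (loc_alg R A s) = carrier (P Quot I)" "mult (loc_alg R A s) = mult (P Quot I)"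
    "one (loc_alg R A s) = one (P Quot I)" "add (loc_alg R A s) = add (P Quot I)"
    unfolding loc_alg_def quotient_alg_simps by (simp_all add: FactRing_def)
  have \<psi>': "\<psi> \<in> ring_hom (P Quot I) B" using \<psi>(1) unfolding ring_hom_def q by simp
  have h: "h \<in> ring_hom P B"
    using ring_hom_trans[OF I.rcos_ring_hom \<psi>'] by (simp add: h_def[abs_def] comp_def)
  interpret h: ring_hom_ring P B h by (rule ring_hom_ringI2[OF P.ring_axioms B h])
  have carr: "carrier (P Quot I) = (+>\<^bsub>P\<^esub>) I ` carrier P"
    by (auto simp: FactRing_def A_RCOSETS_def')
  have surj: "\<exists>X\<in>carrier P. b = h X" if "b \<in> carrier B" for b
    using \<psi>(2) that unfolding bij_betw_def q carr h_def by blast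
  have I0: "I +>\<^bsub>P\<^esub> \<zero>\<^bsub>P\<^esub> = I"
    by (rule P.a_rcos_zero[OF I.is_ideal I.zero_closed])
  have ker: "X \<in> I" if X: "X \<in> carrier P" and "h X = \<zero>\<^bsub>B\<^esub>" for X
  proof -
    have "\<psi> (I +>\<^bsub>P\<^esub> X) = \<psi> (I +>\<^bsub>P\<^esub> \<zero>\<^bsub>P\<^esub>)"
      using that(2) h.hom_zero unfolding h_def by simp
    moreover have "inj_on \<psi> ((+>\<^bsub>P\<^esub>) I ` carrier P)"
      using \<psi>(2) unfolding bij_betw_def q carr by simp
    ultimately have "I +>\<^bsub>P\<^esub> X = I +>\<^bsub>P\<^esub> \<zero>\<^bsub>P\<^esub>"
      using X P.zero_closed by (meson imageI inj_onD)
    then have "X \<in> I +>\<^bsub>P\<^esub> \<zero>\<^bsub>P\<^esub>" using I.a_rcos_self[OF X] by simp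
    then show ?thesis by (simp only: I0)
  qed
  have ker': "h X = \<zero>\<^bsub>B\<^esub>" if "X \<in> I" for X
  proof -
    have "h X = h \<zero>\<^bsub>P\<^esub>" unfolding h_def I0 P.a_rcos_zero[OF I.is_ideal that] ..
    then show ?thesis using h.hom_zero by (simp only:)
  qed
  have fh: "f a = h (tens A \<Lambda> a \<one>\<^bsub>\<Lambda>\<^esub>)" if "a \<in> carrier A" for a
    using f(2)[OF that] by (simp add: loc_map_def h_def)
  have hsx: "h sx = \<one>\<^bsub>B\<^esub>"
  proof -
    have "h sx \<ominus>\<^bsub>B\<^esub> h \<one>\<^bsub>P\<^esub> = h (sx \<ominus>\<^bsub>P\<^esub> \<one>\<^bsub>P\<^esub>)"
      using sx_closed P.one_closed by (simp add: a_minus_def del: P_simps)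
    also have "\<dots> = \<zero>\<^bsub>B\<^esub>" by (rule ker'[OF relation_mem])
    finally show ?thesis using h.hom_closed[OF sx_closed] h.hom_one by (simp del: P_simps)
  qed
  \<comment> \<open>Each letter of w takes up one factor s: since s x is sent to \<one>, the
    monomials s^k a x^k and a have the same image.\<close>
  have hmon: "h (tens A \<Lambda> (s [^]\<^bsub>A\<^esub> length (letters w) \<otimes>\<^bsub>A\<^esub> a) (xmon w)) = f a"
    if a: "a \<in> carrier A" and w: "w \<in> xwords" for a w
    using w
  proof (induction "letters w" arbitrary: w)
    case Nil
    then have "w = 0" by (cases w) (simp add: zero_word_def)
    then show ?case using a by (simp add: xmon_zero fh)
  next
    case (Cons i l)
    have l: "letters w = i # l" by (rule Cons(2)[symmetric])
    have il: "i = 0" "Word l \<in> xwords" using Cons(3) unfolding xwords_def mem_Collect_eq l by auto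
    have "w = Word (i # l)" unfolding l[symmetric] by simp
    then have w: "w = Word [0] + Word l" "Word l \<in> xwords"
      unfolding plus_word_def using il by simp_all
    let ?c = "s [^]\<^bsub>A\<^esub> length l \<otimes>\<^bsub>A\<^esub> a"
    have c: "?c \<in> carrier A" using a by simp
    have t: "tens A \<Lambda> ?c (xmon (Word l)) \<in> carrier P" using c w(2) by (simp add: tens_carrier)
    have "s [^]\<^bsub>A\<^esub> length (letters w) \<otimes>\<^bsub>A\<^esub> a = s \<otimes>\<^bsub>A\<^esub> ?c"
      unfolding w(1) using a by (simp add: A.m_assoc A.central_lcomm[OF s_central])
    then have "tens A \<Lambda> (s [^]\<^bsub>A\<^esub> length (letters w) \<otimes>\<^bsub>A\<^esub> a) (xmon w)
        = tens A \<Lambda> (s \<otimes>\<^bsub>A\<^esub> ?c) (xmon (Word [0]) \<otimes>\<^bsub>\<Lambda>\<^esub> xmon (Word l))"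
      unfolding xmon_mult[OF line_gen_xmon(2) w(2)] by (simp only: w(1))
    also have "\<dots> = sx \<otimes>\<^bsub>P\<^esub> tens A \<Lambda> ?c (xmon (Word l))"
      unfolding line_gen_xmon(1)
      by (rule mult_tens[symmetric]) (use c w(2) line_gen_xmon(2) in simp_all)
    finally have "h (tens A \<Lambda> (s [^]\<^bsub>A\<^esub> length (letters w) \<otimes>\<^bsub>A\<^esub> a) (xmon w))
        = h sx \<otimes>\<^bsub>B\<^esub> h (tens A \<Lambda> ?c (xmon (Word l)))"
      by (simp only: h.hom_mult[OF sx_closed t])
    also have "h (tens A \<Lambda> ?c (xmon (Word l))) = f a"
      using Cons(1)[of "Word l"] w(2) by simp
    also have "h sx \<otimes>\<^bsub>B\<^esub> f a = f a"
      unfolding hsx by (rule B.l_one[OF ring_hom_closed[OF f(1) a]])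
    finally show ?case .
  qed
  have fs: "f s \<in> carrier B" using f(1) by (simp add: ring_hom_closed)
  have fpow: "f s [^]\<^bsub>B\<^esub> n = h (tens A \<Lambda> (s [^]\<^bsub>A\<^esub> n) \<one>\<^bsub>\<Lambda>\<^esub>)" for n :: nat
    using ring_hom_pow[OF A.ring_axioms B f(1) s_closed, of n] by (simp add: fh)
  \<comment> \<open>For a monomial a x^k the k-th power of s clears the denominator; a sum is
    brought to a common denominator.\<close>
  have gen: "\<exists>n::nat. \<exists>a\<in>carrier A. f s [^]\<^bsub>B\<^esub> n \<otimes>\<^bsub>B\<^esub> h X = f a" if X: "X \<in> carrier T" for X
    using X
  proof (induction X rule: xmon_induct)
    case (mon a w)
    have "f s [^]\<^bsub>B\<^esub> length (letters w) \<otimes>\<^bsub>B\<^esub> h (tens A \<Lambda> a (xmon w))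
        = h (tens A \<Lambda> (s [^]\<^bsub>A\<^esub> length (letters w)) \<one>\<^bsub>\<Lambda>\<^esub> \<otimes>\<^bsub>P\<^esub> tens A \<Lambda> a (xmon w))"
      unfolding fpow by (rule h.hom_mult[symmetric]) (use mon in \<open>simp_all add: tens_carrier\<close>)
    also have "\<dots> = f a"
      using mon hmon by (simp add: mult_tens)
    finally show ?case using mon by blast
  next
    case (add X Y)
    then obtain m n :: nat and a b where ab: "a \<in> carrier A" "b \<in> carrier A"
      and e: "f s [^]\<^bsub>B\<^esub> m \<otimes>\<^bsub>B\<^esub> h X = f a" "f s [^]\<^bsub>B\<^esub> n \<otimes>\<^bsub>B\<^esub> h Y = f b" by blast
    have hc: "h X \<in> carrier B" "h Y \<in> carrier B" using add(1,2) h.hom_closed by simp_all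
    \<comment> \<open>Enlarging the exponent by i multiplies the numerator by s^i; used with the two
      exponents exchanged, this gives X and Y the same denominator.\<close>
    have p: "f s [^]\<^bsub>B\<^esub> (i + j) \<otimes>\<^bsub>B\<^esub> h Z = f (s [^]\<^bsub>A\<^esub> i \<otimes>\<^bsub>A\<^esub> c)"
      if "f s [^]\<^bsub>B\<^esub> j \<otimes>\<^bsub>B\<^esub> h Z = f c" "c \<in> carrier A" "h Z \<in> carrier B" for i j :: nat and Z c
      using that fs ring_hom_pow[OF A.ring_axioms B f(1) s_closed, of i]
      by (simp add: B.nat_pow_mult[symmetric] B.m_assoc ring_hom_mult[OF f(1)])
    have "f s [^]\<^bsub>B\<^esub> (n + m) \<otimes>\<^bsub>B\<^esub> h (X \<oplus>\<^bsub>T\<^esub> Y)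
        = f s [^]\<^bsub>B\<^esub> (n + m) \<otimes>\<^bsub>B\<^esub> h X \<oplus>\<^bsub>B\<^esub> f s [^]\<^bsub>B\<^esub> (m + n) \<otimes>\<^bsub>B\<^esub> h Y"
      using h.hom_add[of X Y] add(1,2) hc fs by (simp add: B.r_distr add.commute)
    also have "\<dots> = f (s [^]\<^bsub>A\<^esub> n \<otimes>\<^bsub>A\<^esub> a \<oplus>\<^bsub>A\<^esub> s [^]\<^bsub>A\<^esub> m \<otimes>\<^bsub>A\<^esub> b)"
      unfolding p[OF e(1) ab(1) hc(1)] p[OF e(2) ab(2) hc(2)] using ab by (simp add:
          ring_hom_add[OF f(1)])
    finally have "f s [^]\<^bsub>B\<^esub> (n + m) \<otimes>\<^bsub>B\<^esub> h (X \<oplus>\<^bsub>T\<^esub> Y)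
        = f (s [^]\<^bsub>A\<^esub> n \<otimes>\<^bsub>A\<^esub> a \<oplus>\<^bsub>A\<^esub> s [^]\<^bsub>A\<^esub> m \<otimes>\<^bsub>A\<^esub> b)" .
    moreover have "s [^]\<^bsub>A\<^esub> n \<otimes>\<^bsub>A\<^esub> a \<oplus>\<^bsub>A\<^esub> s [^]\<^bsub>A\<^esub> m \<otimes>\<^bsub>A\<^esub> b \<in> carrier A" using ab by simp
    ultimately show ?case by (intro exI bexI)
  qed
  \<comment> \<open>The image of x is the left inverse of f s.\<close>
  have "\<exists>y\<in>carrier B. y \<otimes>\<^bsub>B\<^esub> f s = \<one>\<^bsub>B\<^esub>"
  proof (intro bexI)
    let ?y = "tens A \<Lambda> \<one>\<^bsub>A\<^esub> (line_gen R)"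
    have y: "?y \<in> carrier P" by (simp add: tens_carrier line_gen_xmon)
    then show "h ?y \<in> carrier B" by (rule h.hom_closed)
    have "h ?y \<otimes>\<^bsub>B\<^esub> f s = h (?y \<otimes>\<^bsub>P\<^esub> tens A \<Lambda> s \<one>\<^bsub>\<Lambda>\<^esub>)"
      unfolding fh[OF s_closed] by (rule h.hom_mult[symmetric]) (use y in \<open>simp_all add:
          tens_carrier\<close>)
    also have "?y \<otimes>\<^bsub>P\<^esub> tens A \<Lambda> s \<one>\<^bsub>\<Lambda>\<^esub> = sx" by (simp add: mult_tens line_gen_xmon)
    finally show "h ?y \<otimes>\<^bsub>B\<^esub> f s = \<one>\<^bsub>B\<^esub>" by (simp add: hsx)
  qed
  moreover have "\<exists>n::nat. s [^]\<^bsub>A\<^esub> n \<otimes>\<^bsub>A\<^esub> a = \<zero>\<^bsub>A\<^esub>" if "a \<in> carrier A" "f a = \<zero>\<^bsub>B\<^esub>" for a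
    using that by (intro kernel_power ker) (simp_all add: fh tens_carrier)
  moreover have "\<exists>n::nat. \<exists>a\<in>carrier A. f s [^]\<^bsub>B\<^esub> n \<otimes>\<^bsub>B\<^esub> b = f a" if b: "b \<in> carrier B" for b
    using surj[OF b] gen by auto
  ultimately show ?thesis
    unfolding is_loc_def using A.ring_axioms B f(1) s_central by blast
qed

end

section \<open>Sheaves\<close>

text \<open>Leads from the site to ring theory. Afterwards the concrete presentation of A[s^-1] no
  longer enters.\<close>

lemma (in cotriangular_form) is_loc_localization_at:
  assumes l: "localization_at R s (A, \<phi>, B)" and s: "coinvariant A s"
  shows "is_loc A B \<phi> s"
proof -
  have arr: "(A, \<phi>, B) \<in> arr (space_category R)" using l by (simp add: localization_at_def)
  obtain \<psi> where iso: "alg_iso (loc_alg R A s) B \<psi>" and eq: "\<And>a. a \<in> carrier A \<Longrightarrow> \<phi> a = \<psi> (loc_map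
      R A s a)"
    using l by (auto simp: localization_at_def space_category_simps)
  have A: "braided_algebra R A" and B: "braided_algebra R B" and \<phi>: "alg_morphism A B \<phi>"
    using arr by (simp_all add: space_category_arr)
  interpret localization R A s
    by (intro localization.intro cotriangular_form_axioms localization_axioms.intro A s)
  show ?thesis
    by (rule is_loc_loc_alg[OF braided_algebraD(2)[OF B] _ _ alg_morphismD(2)[OF \<phi>] eq])
      (use iso in \<open>simp_all add: alg_iso_def alg_morphism_def\<close>)
qed

text \<open>Each identity required of \<mu> holds after applying every \<phi> i, because there it is
  an identity for the morphism \<upsilon> i, and joint injectivity brings it back to A. Thus \<mu>
  may be constructed as a mere function.\<close>

lemma alg_morphism_descent:
  assumes X: "braided_algebra R X" and A: "braided_algebra R A" and B: "\<And>i. i \<in> I \<Longrightarrow>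
      braided_algebra R (B i)"
    and \<phi>: "\<And>i. i \<in> I \<Longrightarrow> alg_morphism A (B i) (\<phi> i)" and \<upsilon>: "\<And>i. i \<in> I \<Longrightarrow> alg_morphism X (B i) (\<upsilon> i)"
    and inj: "\<And>a a'. a \<in> carrier A \<Longrightarrow> a' \<in> carrier A \<Longrightarrow> (\<And>i. i \<in> I \<Longrightarrow> \<phi> i a = \<phi> i a') \<Longrightarrow> a = a'"
    and \<mu>: "\<And>c. c \<in> carrier X \<Longrightarrow> \<mu> c \<in> carrier A"
    and eq: "\<And>i c. i \<in> I \<Longrightarrow> c \<in> carrier X \<Longrightarrow> \<phi> i (\<mu> c) = \<upsilon> i c"
  shows "alg_morphism X A \<mu>"
  unfolding alg_morphism_def
proof (intro conjI ballI)
  interpret X: ring X by (rule braided_algebraD[OF X])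
  interpret A: ring A by (rule braided_algebraD[OF A])
  note v = braided_algebraD(1)
  note \<phi>l = linear_mapD[OF alg_morphismD(1)[OF \<phi>]] and \<upsilon>l = linear_mapD[OF alg_morphismD(1)[OF \<upsilon>]]
  note \<phi>r = alg_morphismD(2)[OF \<phi>] and \<upsilon>r = alg_morphismD(2)[OF \<upsilon>]
  note [simp] = \<mu> eq vspaceD(2)[OF v[OF X]] vspaceD(2)[OF v[OF A]]
  show lin: "linear_map X A \<mu>"
    by (rule linear_mapI; (rule inj)?) (simp_all add: \<phi>l \<upsilon>l)
  show "\<mu> \<in> ring_hom X A"
    by (rule ring_hom_memI; (rule inj)?)
      (simp_all add: \<phi>l \<upsilon>l ring_hom_mult[OF \<phi>r] ring_hom_mult[OF \<upsilon>r] ring_hom_one[OF \<phi>r]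
          ring_hom_one[OF \<upsilon>r])
  fix c assume c: "c \<in> carrier X"
  let ?x = "coact X c"
  have x: "?x \<in> carrier (tensor torus_module X)" by (rule coact_closed[OF X c])
  have cl: "coact A (\<mu> c) \<in> carrier (tensor torus_module A)" "hmap A \<mu> ?x \<in> carrier (tensor
      torus_module A)"
    using coact_closed[OF A \<mu>[OF c]] linear_mapD(1)[OF hmap_linear[OF v[OF X] v[OF A] lin] x] by
        auto
  show "coact A (\<mu> c) = hmap A \<mu> ?x"
  \<comment> \<open>Equivariance is an equation in H \<otimes> A, whereas injectivity is given on A.
    Since \<open>hcomp\<close> commutes with \<phi> i, \<upsilon> i and \<mu>, the equation can be
    tested on the components in A.\<close>
  proof (rule hcomp_ext[OF v[OF A] cl])
    fix m
    have h: "hcomp X m ?x \<in> carrier X" using linear_mapD(1)[OF hcomp_linear[OF v[OF X]] x] .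
    show "hcomp A m (coact A (\<mu> c)) = hcomp A m (hmap A \<mu> ?x)"
    proof (rule inj)
      show "hcomp A m (coact A (\<mu> c)) \<in> carrier A" "hcomp A m (hmap A \<mu> ?x) \<in> carrier A"
        using linear_mapD(1)[OF hcomp_linear[OF v[OF A]]] cl by blast+
      fix i assume i: "i \<in> I"
      note Bi = v[OF B[OF i]]
      have "\<phi> i (hcomp A m (coact A (\<mu> c))) = hcomp (B i) m (hmap (B i) (\<phi> i) (coact A (\<mu> c)))"
        by (rule hcomp_hmap[OF v[OF A] Bi alg_morphismD(1)[OF \<phi>[OF i]] cl(1), symmetric])
      also have "\<dots> = hcomp (B i) m (coact (B i) (\<phi> i (\<mu> c)))"
        by (simp only: alg_morphismD(3)[OF \<phi>[OF i] \<mu>[OF c]])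
      also have "\<dots> = hcomp (B i) m (hmap (B i) (\<upsilon> i) ?x)"
        unfolding eq[OF i c] alg_morphismD(3)[OF \<upsilon>[OF i] c] ..
      also have "\<dots> = \<upsilon> i (hcomp X m ?x)"
        by (rule hcomp_hmap[OF v[OF X] Bi alg_morphismD(1)[OF \<upsilon>[OF i]] x])
      also have "\<dots> = \<phi> i (\<mu> (hcomp X m ?x))" by (rule eq[OF i h, symmetric])
      also have "\<mu> (hcomp X m ?x) = hcomp A m (hmap A \<mu> ?x)"
        by (rule hcomp_hmap[OF v[OF X] v[OF A] lin x, symmetric])
      finally show "\<phi> i (hcomp A m (coact A (\<mu> c))) = \<phi> i (hcomp A m (hmap A \<mu> ?x))" .
    qed
  qed
qed

text \<open>Arrows from X_B to the space of the algebra X are algebra morphisms X -> B. The claim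
  therefore says that morphisms X -> A[s_i^-1] which agree on the overlaps come from exactly one
  morphism X -> A.\<close>

lemma (in cotriangular_form) hom_presheaf_equalizer:
  fixes X A :: "('k, 'n, 'u) comod_alg"
  defines "S \<equiv> space_category R :: (('k, 'n, 'u) comod_alg, ('k, 'n, 'u) alg_arrow) category"
  defines "Y \<equiv> hom_presheaf S X"
  assumes X: "X \<in> obj S" and cov: "zariski_covering R A N s f" and ov: "covering_overlaps R N s f
      g h"
  shows "set_equalizer (fobj Y A)
          (\<Pi>\<^sub>E i\<in>{..<N}. fobj Y (src S (f i)))
          (\<Pi>\<^sub>E ij\<in>{..<N} \<times> {..<N}. fobj Y (src S (g ij)))
          (\<lambda>y. \<lambda>i\<in>{..<N}. pullback_along Y (f i) y)
          (\<lambda>y. \<lambda>ij\<in>{..<N} \<times> {..<N}. pullback_along Y (g ij) (y (fst ij)))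
          (\<lambda>y. \<lambda>ij\<in>{..<N} \<times> {..<N}. pullback_along Y (h ij) (y (snd ij)))"
proof -
  have S: "is_category S" unfolding S_def by (rule space_category_category)
  note Sc = is_categoryD[OF S]
  have A: "A \<in> obj S" and cs: "\<And>i. i < N \<Longrightarrow> coinvariant A (s i)"
    and ft: "\<And>i. i < N \<Longrightarrow> tgt S (f i) = A" and fl: "\<And>i. i < N \<Longrightarrow> localization_at R (s i) (f i)"
    using cov by (simp_all add: zariski_covering_def S_def)
  obtain c where c: "c \<in> {..<N} \<rightarrow> carrier A" "(\<Oplus>\<^bsub>A\<^esub>i\<in>{..<N}. c i \<otimes>\<^bsub>A\<^esub> s i) = \<one>\<^bsub>A\<^esub>"
    using cov by (auto simp: zariski_covering_def)
  define \<phi> B where "\<phi> i = comorphism (f i)" and "B i = src S (f i)" for i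
  have feq: "f i = (A, \<phi> i, B i)" if "i < N" for i
    using ft[OF that] by (cases "f i") (simp add: S_def space_category_simps \<phi>_def B_def)
  have farr: "f i \<in> arr S" if "i < N" for i
    using fl[OF that] by (simp add: localization_at_def S_def)
  have Ab: "braided_algebra R A" and Xb: "braided_algebra R X"
    using A X by (simp_all add: S_def space_category_simps)
  have Bb: "braided_algebra R (B i)" and \<phi>: "alg_morphism A (B i) (\<phi> i)" if "i < N" for i
    using farr[OF that] feq[OF that] by (simp_all add: S_def space_category_arr)
  have loc: "is_loc A (B i) (\<phi> i) (s i)" if "i < N" for i
    using is_loc_localization_at[OF _ cs[OF that]] fl[OF that] feq[OF that] by simp
  have inj: "a = a'" if "a \<in> carrier A" "a' \<in> carrier A" "\<And>i. i \<in> {..<N} \<Longrightarrow> \<phi> i a = \<phi> i a'" for a a'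
    by (rule jointly_injective[OF braided_algebraD(2)[OF Ab] _ _ c that]) (use loc in simp_all)

  have ovD: "tgt S (g (i, j)) = B i" "localization_at R (\<phi> i (s j)) (g (i, j))"
    "tgt S (h (i, j)) = B j" "localization_at R (\<phi> j (s i)) (h (i, j))"
    "src S (h (i, j)) = src S (g (i, j))" "cmp S (f i) (g (i, j)) = cmp S (f j) (h (i, j))"
    if "i < N" "j < N" for i j
    using ov that by (simp_all add: covering_overlaps_def S_def B_def \<phi>_def)
  define C \<gamma> \<eta> where "C i j = src S (g (i, j))" and "\<gamma> i j = comorphism (g (i, j))"
    and "\<eta> i j = comorphism (h (i, j))" for i j
  have geq: "g (i, j) = (B i, \<gamma> i j, C i j)" and heq: "h (i, j) = (B j, \<eta> i j, C i j)"
    if "i < N" "j < N" for i j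
    using ovD[OF that]
    by (cases "g (i, j)"; cases "h (i, j)"; simp add: S_def space_category_simps C_def \<gamma>_def \<eta>_def)+
  have garr: "g (i, j) \<in> arr S" "h (i, j) \<in> arr S" if "i < N" "j < N" for i j
    using ovD(2,4)[OF that] by (simp_all add: localization_at_def S_def)
  have \<eta>: "alg_morphism (B j) (C i j) (\<eta> i j)" if "i < N" "j < N" for i j
    using garr(2)[OF that] heq[OF that] by (simp add: S_def space_category_arr)
  \<comment> \<open>Equivariance of \<phi> i keeps the image of s j coinvariant, hence central in B
    i, so the second localization is of the same kind as the first.\<close>
  have locg: "is_loc (B i) (C i j) (\<gamma> i j) (\<phi> i (s j))" if ij: "i < N" "j < N" for i j
    using is_loc_localization_at[of "\<phi> i (s j)" "B i" "\<gamma> i j" "C i j"]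
      coinvariant_hom[OF Ab Bb[OF ij(1)] \<phi>[OF ij(1)] cs[OF ij(2)]] ovD(2)[OF ij] geq[OF ij] by simp
  \<comment> \<open>Compatibility of the two arrows from the overlap to X_A is an equality of maps
    restricted to \<open>carrier A\<close>, read off pointwise.\<close>
  have \<gamma>\<eta>: "\<gamma> i j (\<phi> i a) = \<eta> i j (\<phi> j a)" if ij: "i < N" "j < N" and a: "a \<in> carrier A" for i j a
  proof -
    have "compose (carrier A) (\<gamma> i j) (\<phi> i) = compose (carrier A) (\<eta> i j) (\<phi> j)"
      using ovD(6)[OF ij] unfolding feq[OF ij(1)] feq[OF ij(2)] geq[OF ij] heq[OF ij]
      by (simp add: S_def space_category_simps)
    from fun_cong[OF this, of a] show ?thesis using a by (simp add: compose_def)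
  qed

  have Yo: "fobj Y Z = homset S Z X" if "Z \<in> obj S" for Z
    unfolding Y_def by (rule hom_presheaf_simps(1)[OF that])
  have Yp: "pullback_along Y k u = cmp S u k" if "k \<in> arr S" "u \<in> homset S (tgt S k) X" for k u
    unfolding Y_def hom_presheaf_simps(2)[OF that(1)] using that(2) by simp
  have Bo: "B i \<in> obj S" if "i < N" for i unfolding B_def by (rule Sc(1)[OF farr[OF that]])
  have Co: "C i j \<in> obj S" if "i < N" "j < N" for i j unfolding C_def by (rule Sc(1)[OF garr(1)[OF
      that]])
  have chom: "cmp S u k \<in> homset S (src S k) X" if "k \<in> arr S" "u \<in> homset S (tgt S k) X" for k u
    using that Sc(6-8)[of k u] by (simp add: homset_def)
  let ?P = "\<Pi>\<^sub>E i\<in>{..<N}. fobj Y (src S (f i))" and ?Q = "\<Pi>\<^sub>E ij\<in>{..<N} \<times> {..<N}. fobj Y (src S (g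
      ij))"
  let ?e = "\<lambda>y. \<lambda>i\<in>{..<N}. pullback_along Y (f i) y"
  let ?p = "\<lambda>y. \<lambda>ij\<in>{..<N} \<times> {..<N}. pullback_along Y (g ij) (y (fst ij))"
  let ?q = "\<lambda>y. \<lambda>ij\<in>{..<N} \<times> {..<N}. pullback_along Y (h ij) (y (snd ij))"
  have Py: "y i \<in> homset S (B i) X" if "y \<in> ?P" "i < N" for y i
    using that Yo[OF Bo[OF that(2)]] by (auto simp: B_def)
  have pq: "pullback_along Y (g (i, j)) (y i) = cmp S (y i) (g (i, j))"
    "cmp S (y i) (g (i, j)) \<in> homset S (C i j) X"
    "pullback_along Y (h (i, j)) (y j) = cmp S (y j) (h (i, j))"
    "cmp S (y j) (h (i, j)) \<in> homset S (C i j) X"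
    if "y \<in> ?P" "i < N" "j < N" for y i j
    using Py[OF that(1,2)] Py[OF that(1,3)] Yp[OF garr(1)[OF that(2,3)], of "y i"] Yp[OF
        garr(2)[OF that(2,3)], of "y j"]
      chom[OF garr(1)[OF that(2,3)], of "y i"] chom[OF garr(2)[OF that(2,3)], of "y j"]
          ovD(1,3,5)[OF that(2,3)]
    by (simp_all add: C_def)
  have P1: "?p \<in> ?P \<rightarrow> ?Q" "?q \<in> ?P \<rightarrow> ?Q"
  proof -
    have "?p y ij \<in> fobj Y (src S (g ij)) \<and> ?q y ij \<in> fobj Y (src S (g ij))"
      if "y \<in> ?P" "ij \<in> {..<N} \<times> {..<N}" for y ij
      using that pq[OF that(1), of "fst ij" "snd ij"] Yo[OF Co, of "fst ij" "snd ij"]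
      by (cases ij) (simp add: C_def)
    then show "?p \<in> ?P \<rightarrow> ?Q" "?q \<in> ?P \<rightarrow> ?Q" by (simp_all add: Pi_iff PiE_iff)
  qed
  have e: "pullback_along Y (f i) u = cmp S u (f i)" "cmp S u (f i) \<in> homset S (B i) X"
    if "u \<in> homset S A X" "i < N" for u i
    using Yp[OF farr[OF that(2)], of u] chom[OF farr[OF that(2)], of u] that ft[OF that(2)] by
        (simp_all add: B_def)
  have "bij_betw ?e (fobj Y A) {y \<in> ?P. ?p y = ?q y}"
    unfolding Yo[OF A]
  proof (rule bij_betw_imageI)
    show "inj_on ?e (homset S A X)"
    proof (rule inj_onI)
      fix u u' assume u: "u \<in> homset S A X" and u': "u' \<in> homset S A X" and eq: "?e u = ?e u'"
      obtain \<mu> where \<mu>: "u = (X, \<mu>, A)" "alg_morphism X A \<mu>" "\<mu> \<in> extensional (carrier X)"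
        using u by (cases u) (auto simp: homset_def S_def space_category_simps space_category_arr)
      obtain \<mu>' where \<mu>': "u' = (X, \<mu>', A)" "alg_morphism X A \<mu>'" "\<mu>' \<in> extensional (carrier X)"
        using u' by (cases u') (auto simp: homset_def S_def space_category_simps space_category_arr)
      have "\<mu> x = \<mu>' x" if x: "x \<in> carrier X" for x
      proof (rule inj)
        show "\<mu> x \<in> carrier A" "\<mu>' x \<in> carrier A"
          by (rule linear_mapD(1)[OF alg_morphismD(1)[OF \<mu>(2)] x])
            (rule linear_mapD(1)[OF alg_morphismD(1)[OF \<mu>'(2)] x])
        fix i assume i: "i \<in> {..<N}"
        have "?e u i = ?e u' i" by (rule fun_cong[OF eq])
        then have "cmp S u (f i) = cmp S u' (f i)" using e(1)[OF u] e(1)[OF u'] i by simp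
        then have "compose (carrier X) (\<phi> i) \<mu> = compose (carrier X) (\<phi> i) \<mu>'"
          using i by (simp add: feq \<mu>(1) \<mu>'(1) S_def space_category_simps)
        from fun_cong[OF this, of x] show "\<phi> i (\<mu> x) = \<phi> i (\<mu>' x)" using x by (simp add:
            compose_def)
      qed
      then have "\<mu> = \<mu>'" by (rule extensionalityI[OF \<mu>(3) \<mu>'(3)])
      then show "u = u'" by (simp add: \<mu>(1) \<mu>'(1))
    qed
    have "?e u \<in> ?P \<and> ?p (?e u) = ?q (?e u)" if u: "u \<in> homset S A X" for u
    proof
      show P: "?e u \<in> ?P"
        using e[OF u] Yo[OF Bo] by (simp add: PiE_iff) (simp add: B_def)
      show "?p (?e u) = ?q (?e u)"
      proof (rule restrict_ext)
        fix ij assume "ij \<in> {..<N} \<times> {..<N}"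
        then obtain i j where ij: "ij = (i, j)" "i < N" "j < N" by auto
        have "cmp S (cmp S u (f i)) (g (i, j)) = cmp S u (cmp S (f i) (g (i, j)))"
          by (rule Sc(11)) (use u ij farr garr ovD ft in \<open>simp_all add: homset_def B_def\<close>)
        also have "\<dots> = cmp S (cmp S u (f j)) (h (i, j))"
          unfolding ovD(6)[OF ij(2,3)]
          by (rule Sc(11)[symmetric]) (use u ij farr garr ovD ft in \<open>simp_all add: homset_def
              B_def\<close>)
        finally show "pullback_along Y (g ij) (?e u (fst ij)) = pullback_along Y (h ij) (?e u (snd
            ij))"
          using pq(1,3)[OF P ij(2,3)] e(1)[OF u] ij by simp
      qed
    qed
    \<comment> \<open>Surjectivity onto the matching families, that is, gluing of morphisms.\<close>
    moreover have "y \<in> ?e ` homset S A X" if y: "y \<in> ?P" and eq: "?p y = ?q y" for y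
    proof -
      define \<upsilon> where "\<upsilon> i = comorphism (y i)" for i
      have yeq: "y i = (X, \<upsilon> i, B i)" and yarr: "y i \<in> arr S" if "i < N" for i
        using Py[OF y that] by (cases "y i"; simp add: homset_def S_def space_category_simps \<upsilon>_def)+
      have \<upsilon>: "alg_morphism X (B i) (\<upsilon> i)" if "i < N" for i
        using yarr[OF that] yeq[OF that] by (simp add: S_def space_category_arr)
      have comp: "\<gamma> i j (\<upsilon> i x) = \<eta> i j (\<upsilon> j x)" if ij: "i < N" "j < N" and x: "x \<in> carrier X" for
          i j x
      proof -
        have "?p y (i, j) = ?q y (i, j)" by (rule fun_cong[OF eq])
        then have "cmp S (y i) (g (i, j)) = cmp S (y j) (h (i, j))" using pq(1,3)[OF y ij] ij by
            simp
        then have "compose (carrier X) (\<gamma> i j) (\<upsilon> i) = compose (carrier X) (\<eta> i j) (\<upsilon> j)"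
          unfolding yeq[OF ij(1)] yeq[OF ij(2)] geq[OF ij] heq[OF ij]
          by (simp add: S_def space_category_simps)
        from fun_cong[OF this, of x] show ?thesis using x by (simp add: compose_def)
      qed
      \<comment> \<open>Gluing is applied to the values at each x separately. That the chosen
        elements depend on x through an algebra morphism is left to
        \<open>alg_morphism_descent\<close>.\<close>
      have "\<exists>a\<in>carrier A. \<forall>i\<in>{..<N}. \<phi> i a = \<upsilon> i x" if x: "x \<in> carrier X" for x
        by (rule glue_exists[where B = B and C = C and g = \<gamma> and h = \<eta>, OF braided_algebraD(2)[OF
            Ab] _ _ c])
          (use loc locg alg_morphismD(2)[OF \<eta>] \<gamma>\<eta> comp x linear_mapD(1)[OF alg_morphismD(1)[OF \<upsilon>]]
              in simp_all)
      then obtain m where m: "\<And>x. x \<in> carrier X \<Longrightarrow> m x \<in> carrier A"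
        "\<And>x i. x \<in> carrier X \<Longrightarrow> i < N \<Longrightarrow> \<phi> i (m x) = \<upsilon> i x" by (metis lessThan_iff)
      \<comment> \<open>Arrows are maps that are undefined outside the carrier, hence the
        restriction.\<close>
      define \<mu> where "\<mu> = restrict m (carrier X)"
      have \<mu>: "\<mu> x \<in> carrier A" "i < N \<Longrightarrow> \<phi> i (\<mu> x) = \<upsilon> i x" if "x \<in> carrier X" for x i
        using m that by (simp_all add: \<mu>_def)
      have "alg_morphism X A \<mu>"
        by (rule alg_morphism_descent[where I = "{..<N}" and B = B and \<phi> = \<phi> and \<upsilon> = \<upsilon>, OF Xb Ab])
          (use Bb \<phi> \<upsilon> inj \<mu> in simp_all)
      then have u: "(X, \<mu>, A) \<in> homset S A X"
        using X A by (simp add: homset_def S_def space_category_arr space_category_simps \<mu>_def)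
      have "y = ?e (X, \<mu>, A)"
      proof (rule extensionalityI[of _ "{..<N}"])
        show "y \<in> extensional {..<N}" using y by (simp add: PiE_iff)
        fix i assume i: "i \<in> {..<N}"
        have x\<upsilon>: "\<upsilon> i \<in> extensional (carrier X)"
          using yarr[of i] yeq[of i] i by (simp add: S_def space_category_arr)
        have "\<upsilon> i = compose (carrier X) (\<phi> i) \<mu>"
          by (rule extensionalityI[OF x\<upsilon>]) (use \<mu> i in \<open>simp_all add: compose_def\<close>)
        then show "y i = ?e (X, \<mu>, A) i"
          using i e(1)[OF u, of i] by (simp add: yeq feq S_def space_category_simps)
      qed simp
      then show ?thesis using u by blast
    qed
    ultimately show "?e ` homset S A X = {y \<in> ?P. ?p y = ?q y}" by blast
  qed
  then show ?thesis
    unfolding set_equalizer_iff_bij_betw using P1 by blast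
qed

theorem proposition5p1:
  fixes R :: "('k::field, 'n::finite) torus_form"
    and S :: "(('k, 'n, 'u) comod_alg, ('k, 'n, 'u) alg_arrow) category"
  assumes "cotriangular R"
    and "S = space_category R"
  shows "(\<forall>A\<in>obj S. is_sheaf R (hom_presheaf S A))
    \<and> fully_faithful_embedding S (sheaf_category R) (yoneda S)"
proof -
  interpret cotriangular_form R by (rule cotriangular_form.intro) fact
  have S: "is_category S" unfolding assms(2) by (rule space_category_category)
  have sheaf: "is_sheaf R (hom_presheaf S X)" if X: "X \<in> obj S" for X
    unfolding is_sheaf_def
    using hom_presheaf_functor[OF S X] hom_presheaf_equalizer X unfolding assms(2) by blast
  \<comment> \<open>The sheaf property of representable presheaves places them in the full
    subcategory, where the Yoneda lemma for presheaves takes over.\<close>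
  then show ?thesis
    unfolding sheaf_category_def using yoneda_fully_faithful[OF S, of "{Y. is_sheaf R Y}"]
        assms(2) by auto
qed

end
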